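(* Let $p$ be an odd prime, let $\sigma\subset\mathbb{C}_p$ be compact, let $\mu\in\mathbf{L}^*(\sigma)$ and let $\lambda\in\mathbb{C}_p$ satisfy $|\lambda|_p>\max_{x\in\mathrm{supp}(\mu)}|x|_p$. Then $$\log\Gamma_p^\mu(\lambda)=B_1^\mu(0)+\sum_{n=1}^{\infty}\frac{(-1)^{n+1}}{n(n+1)}B_{n+1}^\mu(0)\frac{1}{\lambda^n}+B_1^\mu(\lambda)\log_p\lambda-B_1^\mu(\lambda),$$ where $B_m^\mu(\lambda)=\int_\sigma(\lambda+x)^m\,d\mu(x)$ for $m\ge0$ (so $B_m^\mu(0)=\int_\sigma x^m\,d\mu(x)$), and $$\log\Gamma_p^\mu(\lambda)=\omega_v(\lambda)\frac{\partial}{\partial s}\zeta_p^\mu(s,\lambda)\Big|_{s=0},\qquad \zeta_p^\mu(s,\lambda)=\frac{1}{s-1}\int_\sigma\langle\lambda+x\rangle^{1-s}\,d\mu(x)\quad(s\in\mathbb{Z}_p\setminus\{1\}).$$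
   Context: Notation. $\mathbb{C}_p$ is the completion of an algebraic closure of $\mathbb{Q}_p$, $|p|_p=p^{-1}$, $v_p$ is the additive valuation with $v_p(p)=1$. Fix a compatible system of fractional powers $p^r\in\mathbb{C}_p$, $r\in\mathbb{Q}$ (with $p^{r+r'}=p^rp^{r'}$ and $p^1=p$). For $a\in\mathbb{C}_p^\times$ write $a=p^{v_p(a)}u$ with $|u|_p=1$, let $\hat a=\lim_{n\to\infty}u^{p^{n!}}$ (the root of unity of order prime to $p$ with $|\hat a-u|_p<1$), and put $\omega_v(a)=p^{v_p(a)}\hat a$ and $\langle a\rangle=a/\omega_v(a)$, so $|\langle a\rangle-1|_p<1$. For $s\in\mathbb{Z}_p$, $\langle a\rangle^s=\sum_{n\ge0}\binom{s}{n}(\langle a\rangle-1)^n$. $\log_p:\mathbb{C}_p^\times\to\mathbb{C}_p$ is the Iwasawa logarithm: the homomorphism given by the usual series on $\{|x-1|_p<1\}$ and with $\log_p p=0$; it vanishes on roots of unity and on all $p^r$. Locally analytic functions and generalized distributions. For compact $\sigma\subset\mathbb{C}_p$ and $r>0$ let $D_a(r)=\{z\in\mathbb{C}_p:|z-a|_p<r\}$ and $\mathbb{D}_\sigma(r)=\bigcup_{a\in\sigma}D_a(r)$. $B_r(\sigma)$ is the Banach space of functions $f$ on $\mathbb{D}_\sigma(r)$ given by a convergent power series on each $D_a(r)$, $a\in\sigma$, with finite norm $\|f\|_r=\sup_{z\in\mathbb{D}_\sigma(r)}|f(z)|_p$. $\mathbf{L}(\sigma)$, the space of locally analytic functions on $\sigma$,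 is the union (inductive limit over $r\to0$, functions being identified if they agree on some $\mathbb{D}_\sigma(r')$) of the $B_r(\sigma)$, with the inductive limit topology. $\mathbf{L}^*(\sigma)$ is the space of continuous $\mathbb{C}_p$-linear maps $\mu:\mathbf{L}(\sigma)\to\mathbb{C}_p$ (generalized distributions); one writes $\int_\sigma f\,d\mu=\mu(f)$. The support $\mathrm{supp}(\mu)$ is the complement in $\sigma$ of the largest open $U\subset\sigma$ on which $\mu$ vanishes (i.e. $\mu(f)=0$ for all $f\in\mathbf{L}(\sigma)$ supported in a clopen subset of $\sigma$ contained in $U$). The function $\zeta_p^\mu(s,\lambda)$ is defined whenever $-\lambda\notin\mathrm{supp}(\mu)$: if a function $\varphi$ is locally analytic only on a clopen neighbourhood $U$ of $\mathrm{supp}(\mu)$ in $\sigma$, $\int_\sigma\varphi\,d\mu$ means $\mu$ applied to the function equal to $\varphi$ on $U$ and $0$ on $\sigma\setminus U$. *)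

theory Defs
  imports "HOL-Analysis.Analysis" "HOL-Computational_Algebra.Polynomial"
begin

section \<open>The field of complex p-adic numbers\<close>

text \<open>
  A complete non-archimedean valued field of characteristic \<open>0\<close>. The library norm requires a real
  vector space, hence the separate absolute value, which is tied to the library metric.
\<close>

class ultrametric_field = field_char_0 + complete_space +
  fixes absv :: "'a \<Rightarrow> real"
  assumes dist_absv: "dist x y = absv (x - y)"
    and absv_mult: "absv (x * y) = absv x * absv y"
    and absv_ultrametric: "absv (x + y) \<le> max (absv x) (absv y)"

text \<open>
  If \<open>\<bar>p\<bar> = 1 / p\<close>, the absolute value restricts to the p-adic one on the rationals, whose closure
  is therefore their p-adic completion.
\<close>

definition padic_numbers :: "'a::ultrametric_field set" where
  "padic_numbers = closure \<rat>"

definition padic_integers :: "'a::ultrametric_field set" where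
  "padic_integers = closure \<int>"

definition padic_algebraic :: "'a::ultrametric_field set" where
  "padic_algebraic =
     {x. \<exists>q. q \<noteq> 0 \<and> (\<forall>i. coeff q i \<in> padic_numbers) \<and> poly q x = 0}"

text \<open>
  The type is a completion of an algebraic closure of the field of p-adic numbers:
  the elements algebraic over the p-adic numbers form an algebraically closed field which is
  dense in the (complete) type.
\<close>

definition padic_complex_numbers :: "nat \<Rightarrow> 'a::ultrametric_field itself \<Rightarrow> bool" where
  "padic_complex_numbers p K \<longleftrightarrow>
     prime p \<and>
     absv (of_nat p :: 'a) = 1 / real p \<and>
     (\<forall>q :: 'a poly. (\<forall>i. coeff q i \<in> padic_algebraic) \<and> degree q > 0 \<longrightarrow>
        (\<exists>x\<in>padic_algebraic. poly q x = 0)) \<and>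
     closure (padic_algebraic :: 'a set) = UNIV"

section \<open>Powers and logarithm\<close>

definition fractional_powers ::
    "nat \<Rightarrow> (rat \<Rightarrow> 'a::ultrametric_field) \<Rightarrow> bool" where
  "fractional_powers p pw \<longleftrightarrow>
     (\<forall>r r'. pw (r + r') = pw r * pw r') \<and> pw 1 = of_nat p"

text \<open>The value group is generated by the rational powers of \<open>p\<close>, so the additive
  valuation of a nonzero element is rational. The value at \<open>0\<close> is irrelevant.\<close>

definition padic_val :: "nat \<Rightarrow> 'a::ultrametric_field \<Rightarrow> rat" where
  "padic_val p a = (THE r. absv a = real p powr (- of_rat r))"

definition teichmueller ::
    "nat \<Rightarrow> (rat \<Rightarrow> 'a) \<Rightarrow> 'a \<Rightarrow> 'a::ultrametric_field" where
  "teichmueller p pw a = lim (\<lambda>n. (a / pw (padic_val p a)) ^ (p ^ fact n))"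

definition omega_v ::
    "nat \<Rightarrow> (rat \<Rightarrow> 'a) \<Rightarrow> 'a \<Rightarrow> 'a::ultrametric_field" where
  "omega_v p pw a = pw (padic_val p a) * teichmueller p pw a"

definition angle ::
    "nat \<Rightarrow> (rat \<Rightarrow> 'a) \<Rightarrow> 'a \<Rightarrow> 'a::ultrametric_field" where
  "angle p pw a = a / omega_v p pw a"

definition angle_power ::
    "nat \<Rightarrow> (rat \<Rightarrow> 'a) \<Rightarrow> 'a \<Rightarrow> 'a \<Rightarrow> 'a::ultrametric_field" where
  "angle_power p pw a s = (\<Sum>n. (s gchoose n) * (angle p pw a - 1) ^ n)"

text \<open>The Iwasawa logarithm lives on the nonzero elements; it is made total by the value
  \<open>0\<close> at \<open>0\<close>.\<close>

definition iwasawa_log :: "nat \<Rightarrow> 'a \<Rightarrow> 'a::ultrametric_field" where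
  "iwasawa_log p = (THE L.
     (\<forall>x y. x \<noteq> 0 \<longrightarrow> y \<noteq> 0 \<longrightarrow> L (x * y) = L x + L y) \<and>
     (\<forall>x. absv (x - 1) < 1 \<longrightarrow>
        (\<lambda>n. (- 1) ^ n * (x - 1) ^ Suc n / of_nat (Suc n)) sums L x) \<and>
     L (of_nat p) = 0 \<and>
     L 0 = 0)"

section \<open>Locally analytic functions and generalized distributions\<close>

definition disc_nbhd :: "'a::metric_space set \<Rightarrow> real \<Rightarrow> 'a set" where
  "disc_nbhd \<sigma> r = (\<Union>a\<in>\<sigma>. ball a r)"

text \<open>
  Functions on a neighbourhood of \<open>\<sigma>\<close> are represented by total functions whose values off that
  neighbourhood are arbitrary. Hence \<open>analytic_norm\<close> below is only a seminorm on total functions;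
  identifying functions at distance \<open>0\<close> gives the Banach space of functions on the neighbourhood.
\<close>

definition analytic_space ::
    "'a::ultrametric_field set \<Rightarrow> real \<Rightarrow> ('a \<Rightarrow> 'a) set" where
  "analytic_space \<sigma> r =
     {f. (\<forall>a\<in>\<sigma>. \<exists>c :: nat \<Rightarrow> 'a. \<forall>z\<in>ball a r. (\<lambda>n. c n * (z - a) ^ n) sums f z) \<and>
         bdd_above ((\<lambda>z. absv (f z)) ` disc_nbhd \<sigma> r)}"

text \<open>The inserted \<open>0\<close> only matters for empty \<open>\<sigma>\<close>.\<close>

definition analytic_norm ::
    "'a::ultrametric_field set \<Rightarrow> real \<Rightarrow> ('a \<Rightarrow> 'a) \<Rightarrow> real" where
  "analytic_norm \<sigma> r f = Sup (insert 0 ((\<lambda>z. absv (f z)) ` disc_nbhd \<sigma> r))"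

definition locally_analytic ::
    "'a::ultrametric_field set \<Rightarrow> ('a \<Rightarrow> 'a) set" where
  "locally_analytic \<sigma> = (\<Union>r\<in>{0<..}. analytic_space \<sigma> r)"

text \<open>
  Inductive limit topology: a set is open iff its trace on each \<^term>\<open>analytic_space \<sigma> r\<close> is open
  for the norm. The finest locally convex topology with continuous inclusions has the same
  continuous linear functionals.
  Open sets are saturated for equality on some \<^term>\<open>disc_nbhd \<sigma> r\<close>, so a continuous map
  into a Hausdorff space depends only on the germ of its argument around \<open>\<sigma>\<close>.
\<close>

definition open_locally_analytic ::
    "'a::ultrametric_field set \<Rightarrow> ('a \<Rightarrow> 'a) set \<Rightarrow> bool" where
  "open_locally_analytic \<sigma> U \<longleftrightarrow>
     U \<subseteq> locally_analytic \<sigma> \<and>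
     (\<forall>r>0. \<forall>f \<in> U \<inter> analytic_space \<sigma> r. \<exists>e>0. \<forall>g \<in> analytic_space \<sigma> r.
        analytic_norm \<sigma> r (\<lambda>z. g z - f z) < e \<longrightarrow> g \<in> U)"

definition locally_analytic_topology ::
    "'a::ultrametric_field set \<Rightarrow> ('a \<Rightarrow> 'a) topology" where
  "locally_analytic_topology \<sigma> = topology (open_locally_analytic \<sigma>)"

lemma open_locally_analyticD:
  assumes "open_locally_analytic \<sigma> U" "r > 0" "f \<in> U \<inter> analytic_space \<sigma> r"
  shows "\<exists>e>0. \<forall>g \<in> analytic_space \<sigma> r. analytic_norm \<sigma> r (\<lambda>z. g z - f z) < e \<longrightarrow> g \<in> U"
  using assms unfolding open_locally_analytic_def by simp

lemma istopology_open_locally_analytic: "istopology (open_locally_analytic \<sigma>)"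
  unfolding istopology_def
proof (intro conjI allI impI)
  fix S T assume S: "open_locally_analytic \<sigma> S" and T: "open_locally_analytic \<sigma> T"
  show "open_locally_analytic \<sigma> (S \<inter> T)"
    unfolding open_locally_analytic_def
  proof (intro conjI allI impI ballI)
    show "S \<inter> T \<subseteq> locally_analytic \<sigma>"
      using S by (auto simp: open_locally_analytic_def)
    fix r :: real and f assume r: "r > 0" and f: "f \<in> S \<inter> T \<inter> analytic_space \<sigma> r"
    obtain d where d: "d > 0"
      "\<And>g. g \<in> analytic_space \<sigma> r \<Longrightarrow> analytic_norm \<sigma> r (\<lambda>z. g z - f z) < d \<Longrightarrow> g \<in> S"
      using open_locally_analyticD[OF S r] f by blast
    obtain e where e: "e > 0"
      "\<And>g. g \<in> analytic_space \<sigma> r \<Longrightarrow> analytic_norm \<sigma> r (\<lambda>z. g z - f z) < e \<Longrightarrow> g \<in> T"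
      using open_locally_analyticD[OF T r] f by blast
    show "\<exists>e>0. \<forall>g\<in>analytic_space \<sigma> r. analytic_norm \<sigma> r (\<lambda>z. g z - f z) < e \<longrightarrow> g \<in> S \<inter> T"
      using d e by (intro exI[of _ "min d e"]) auto
  qed
next
  fix \<K> assume K: "\<forall>S\<in>\<K>. open_locally_analytic \<sigma> S"
  show "open_locally_analytic \<sigma> (\<Union>\<K>)"
    unfolding open_locally_analytic_def
  proof (intro conjI allI impI ballI)
    show "\<Union>\<K> \<subseteq> locally_analytic \<sigma>"
      using K by (auto simp: open_locally_analytic_def)
    fix r :: real and f assume r: "r > 0" and f: "f \<in> \<Union>\<K> \<inter> analytic_space \<sigma> r"
    then obtain S where S: "S \<in> \<K>" "f \<in> S \<inter> analytic_space \<sigma> r" by auto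
    obtain e where "e > 0"
      "\<forall>g\<in>analytic_space \<sigma> r. analytic_norm \<sigma> r (\<lambda>z. g z - f z) < e \<longrightarrow> g \<in> S"
      using open_locally_analyticD[OF bspec[OF K S(1)] r S(2)] by blast
    with S show "\<exists>e>0. \<forall>g\<in>analytic_space \<sigma> r.
        analytic_norm \<sigma> r (\<lambda>z. g z - f z) < e \<longrightarrow> g \<in> \<Union>\<K>" by blast
  qed
qed

lemma openin_locally_analytic_topology:
  "openin (locally_analytic_topology \<sigma>) U \<longleftrightarrow> open_locally_analytic \<sigma> U"
  unfolding locally_analytic_topology_def
  by (simp add: topology_inverse'[OF istopology_open_locally_analytic])

lemma topspace_locally_analytic_topology:
  "topspace (locally_analytic_topology \<sigma>) = locally_analytic \<sigma>"
proof -
  have "open_locally_analytic \<sigma> (locally_analytic \<sigma>)"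
    unfolding open_locally_analytic_def
  proof (intro conjI allI impI ballI subset_refl)
    fix r :: real and f assume "r > 0"
    then have "analytic_space \<sigma> r \<subseteq> locally_analytic \<sigma>"
      unfolding locally_analytic_def by blast
    then show "\<exists>e>0. \<forall>g\<in>analytic_space \<sigma> r.
        analytic_norm \<sigma> r (\<lambda>z. g z - f z) < e \<longrightarrow> g \<in> locally_analytic \<sigma>"
      by (intro exI[of _ 1]) (auto simp: subset_iff)
  qed
  moreover have "U \<subseteq> locally_analytic \<sigma>" if "open_locally_analytic \<sigma> U" for U
    using that by (simp add: open_locally_analytic_def)
  ultimately show ?thesis
    unfolding topspace_def openin_locally_analytic_topology by blast
qed

definition generalized_distribution ::
    "'a::ultrametric_field set \<Rightarrow> (('a \<Rightarrow> 'a) \<Rightarrow> 'a) \<Rightarrow> bool" where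
  "generalized_distribution \<sigma> \<mu> \<longleftrightarrow>
     (\<forall>f\<in>locally_analytic \<sigma>. \<forall>g\<in>locally_analytic \<sigma>. \<mu> (\<lambda>z. f z + g z) = \<mu> f + \<mu> g) \<and>
     (\<forall>c. \<forall>f\<in>locally_analytic \<sigma>. \<mu> (\<lambda>z. c * f z) = c * \<mu> f) \<and>
     continuous_map (locally_analytic_topology \<sigma>) euclidean \<mu>"

definition clopen_in :: "'a::topological_space set \<Rightarrow> 'a set \<Rightarrow> bool" where
  "clopen_in \<sigma> V \<longleftrightarrow> openin (top_of_set \<sigma>) V \<and> closedin (top_of_set \<sigma>) V"

text \<open>
  That \<open>f\<close> is supported in \<open>V\<close> means that the germ of \<open>f\<close> around \<open>\<sigma> - V\<close> is zero, not merely that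
  \<open>f\<close> is zero at the points of \<open>\<sigma> - V\<close>. The two differ at isolated points of \<open>\<sigma>\<close>.
\<close>

definition supported_in ::
    "'a::ultrametric_field set \<Rightarrow> ('a \<Rightarrow> 'a) \<Rightarrow> 'a set \<Rightarrow> bool" where
  "supported_in \<sigma> f V \<longleftrightarrow> (\<exists>r>0. \<forall>z\<in>disc_nbhd (\<sigma> - V) r. f z = 0)"

definition vanishes_on ::
    "'a::ultrametric_field set \<Rightarrow> (('a \<Rightarrow> 'a) \<Rightarrow> 'a) \<Rightarrow> 'a set \<Rightarrow> bool"
    where
  "vanishes_on \<sigma> \<mu> U \<longleftrightarrow>
     (\<forall>f\<in>locally_analytic \<sigma>. \<forall>V. clopen_in \<sigma> V \<and> V \<subseteq> U \<and> supported_in \<sigma> f V \<longrightarrow> \<mu> f = 0)"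

definition dist_support ::
    "'a::ultrametric_field set \<Rightarrow> (('a \<Rightarrow> 'a) \<Rightarrow> 'a) \<Rightarrow> 'a set" where
  "dist_support \<sigma> \<mu> = \<sigma> - \<Union>{U. openin (top_of_set \<sigma>) U \<and> vanishes_on \<sigma> \<mu> U}"

text \<open>
  The integral of a function \<open>\<phi>\<close> which is locally analytic on some clopen neighbourhood \<open>U\<close> of the
  support: the value of \<open>\<mu>\<close> at the germ \<open>g\<close> that is \<open>\<phi>\<close> around \<open>U\<close> and \<open>0\<close> around \<open>\<sigma> - U\<close>.
  It does not depend on \<open>U\<close>. For \<open>\<phi>\<close> locally analytic on \<open>\<sigma>\<close> it is \<open>\<mu> \<phi>\<close>.
\<close>

definition dist_integral ::
    "'a::ultrametric_field set \<Rightarrow> (('a \<Rightarrow> 'a) \<Rightarrow> 'a) \<Rightarrow> ('a \<Rightarrow> 'a) \<Rightarrow> 'a"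
    where
  "dist_integral \<sigma> \<mu> \<phi> = (THE v. \<exists>U g r.
     clopen_in \<sigma> U \<and> dist_support \<sigma> \<mu> \<subseteq> U \<and> \<phi> \<in> locally_analytic U \<and>
     g \<in> locally_analytic \<sigma> \<and> r > 0 \<and>
     (\<forall>z\<in>disc_nbhd U r. g z = \<phi> z) \<and> (\<forall>z\<in>disc_nbhd (\<sigma> - U) r. g z = 0) \<and>
     v = \<mu> g)"

section \<open>Bernoulli, zeta and log-gamma functions of a distribution\<close>

definition bernoulli_fun ::
    "(('a \<Rightarrow> 'a) \<Rightarrow> 'a) \<Rightarrow> nat \<Rightarrow> 'a \<Rightarrow> 'a::ultrametric_field" where
  "bernoulli_fun \<mu> m l = \<mu> (\<lambda>x. (l + x) ^ m)"

definition padic_zeta ::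
    "nat \<Rightarrow> (rat \<Rightarrow> 'a) \<Rightarrow> 'a set \<Rightarrow> (('a \<Rightarrow> 'a) \<Rightarrow> 'a) \<Rightarrow> 'a \<Rightarrow> 'a \<Rightarrow>
       'a::ultrametric_field" where
  "padic_zeta p pw \<sigma> \<mu> s l =
     1 / (s - 1) * dist_integral \<sigma> \<mu> (\<lambda>x. angle_power p pw (l + x) (1 - s))"

definition has_padic_derivative ::
    "('a \<Rightarrow> 'a) \<Rightarrow> 'a \<Rightarrow> 'a::ultrametric_field \<Rightarrow> bool" where
  "has_padic_derivative f D s \<longleftrightarrow>
     ((\<lambda>t. (f t - f s) / (t - s)) \<longlongrightarrow> D) (at s within padic_integers)"

definition padic_deriv ::
    "('a \<Rightarrow> 'a) \<Rightarrow> 'a \<Rightarrow> 'a::ultrametric_field" where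
  "padic_deriv f s = (THE D. has_padic_derivative f D s)"

definition log_gamma ::
    "nat \<Rightarrow> (rat \<Rightarrow> 'a) \<Rightarrow> 'a set \<Rightarrow> (('a \<Rightarrow> 'a) \<Rightarrow> 'a) \<Rightarrow> 'a \<Rightarrow>
       'a::ultrametric_field" where
  "log_gamma p pw \<sigma> \<mu> l = omega_v p pw l * padic_deriv (\<lambda>s. padic_zeta p pw \<sigma> \<mu> s l) 0"

end

theory Submission
  imports Defs "HOL-Computational_Algebra.Primes"
begin

text \<open>
  For \<open>\<bar>x\<bar> < \<bar>\<lambda>\<bar>\<close> one has \<open>\<omega>\<^sub>v(\<lambda> + x) = \<omega>\<^sub>v(\<lambda>)\<close>, so with \<open>A(x) = (\<lambda> + x) / \<omega>\<^sub>v(\<lambda>) - 1\<close> and \<open>M\<^sub>n = \<integral> A\<^sup>n d\<mu>\<close>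
  continuity of \<open>\<mu>\<close> gives the Mahler series \<open>\<integral> \<langle>\<lambda> + x\<rangle>\<^sup>t d\<mu> = \<Sum> (t choose n) M\<^sub>n\<close>. Splitting off two terms,
  this is \<open>M\<^sub>0 + t M\<^sub>1 + t (t - 1) G(t - 2)\<close> with \<open>G\<close> continuous on the p-adic integers, and the
  derivative of the zeta function at \<open>0\<close> is \<open>G(-1) - M\<^sub>0\<close>. Here \<open>M\<^sub>1 + G(-1)\<close> is the limit of the
  integrals of the partial sums in \<open>A\<close> of the series of \<open>(1 + A) log (1 + A)\<close>. Additivity of the
  logarithm shows that, uniformly near the support, these partial sums are asymptotic to
  \<open>\<langle>\<lambda> + x\<rangle> log \<lambda>\<close> plus \<open>\<langle>\<lambda>\<rangle>\<close> times the partial sums in \<open>x / \<lambda>\<close> of the same series, whose integrals are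
  the terms of Stirling's formula.
\<close>

section \<open>Ultrametric fields\<close>

text \<open>The factors \<open>t\<close> and \<open>t - 1\<close> are split off so that
  differentiating the zeta function becomes a question of continuity: after division by
  \<open>s - 1\<close> the remaining series carries an exact factor \<open>s\<close>, and no Mahler
  series is differentiated termwise. The price is the denominators \<open>(n + 1) (n + 2)\<close> in
  \<open>G\<close>; their inverses have absolute value at most \<open>n + 2\<close>, which the
  geometric decay of the powers of \<open>A\<close> near the support absorbs. The logarithm of
  \<lambda> + x is never integrated. The distribution is applied only to powers of
  \<langle>\<lambda> + x\<rangle> and to polynomials, so local analyticity of the logarithm is not
  an issue. Since \<sigma> may reach beyond |x| < |\<lambda>|, where \<lambda> + x can vanish,
  integrands are cut to the ball of radius |\<lambda>|; for polynomials this leaves the integral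
  unchanged. The properties of \<open>omega_v\<close> and of the logarithm rest on two facts
  transferred from algebraic elements by density: absolute values are rational powers of p, and
  residue classes are periodic under the p-th power map.\<close>

lemma absv_0 [simp]: "absv (0::'a::ultrametric_field) = 0"
  using dist_absv[of "0::'a" 0] by simp

lemma absv_eq_0_iff [simp]: "absv x = 0 \<longleftrightarrow> (x::'a::ultrametric_field) = 0"
  using dist_absv[of x 0] dist_eq_0_iff[of x 0] by simp

lemma absv_nonneg [simp]: "0 \<le> absv (x::'a::ultrametric_field)"
  using dist_absv[of x 0] zero_le_dist[of x 0] by simp

lemma absv_pos_iff [simp]: "0 < absv (x::'a::ultrametric_field) \<longleftrightarrow> x \<noteq> 0"
  using absv_nonneg[of x] absv_eq_0_iff[of x] by linarith

lemma absv_1 [simp]: "absv (1::'a::ultrametric_field) = 1"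
  using absv_mult[of "1::'a" 1] by simp

lemma absv_minus_commute: "absv (x - y) = absv (y - x)" for x y :: "'a::ultrametric_field"
  using dist_absv[of x y] dist_absv[of y x] dist_commute[of x y] by simp

lemma absv_minus [simp]: "absv (- x) = absv x" for x :: "'a::ultrametric_field"
  using absv_minus_commute[of 0 x] by simp

lemma absv_power: "absv (x ^ n) = absv x ^ n" for x :: "'a::ultrametric_field"
  by (induction n) (auto simp: absv_mult)

lemma absv_inverse: "absv (inverse x) = inverse (absv x)" for x :: "'a::ultrametric_field"
proof (cases "x = 0")
  case False
  then have "absv x * absv (inverse x) = 1"
    by (simp flip: absv_mult)
  then show ?thesis
    by (metis inverse_unique)
qed simp

lemma absv_divide: "absv (x / y) = absv x / absv y" for x y :: "'a::ultrametric_field"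
  by (simp add: divide_inverse absv_mult absv_inverse)

lemma absv_add_le: "absv x \<le> B \<Longrightarrow> absv y \<le> B \<Longrightarrow> absv (x + y) \<le> B"
  for x y :: "'a::ultrametric_field"
  using absv_ultrametric[of x y] by linarith

lemma absv_diff_le: "absv x \<le> B \<Longrightarrow> absv y \<le> B \<Longrightarrow> absv (x - y) \<le> B"
  for x y :: "'a::ultrametric_field"
  using absv_add_le[of x B "- y"] by simp

lemma absv_add_less: "absv x < B \<Longrightarrow> absv y < B \<Longrightarrow> absv (x + y) < B"
  for x y :: "'a::ultrametric_field"
  using absv_ultrametric[of x y] by linarith

lemma absv_diff_less: "absv x < B \<Longrightarrow> absv y < B \<Longrightarrow> absv (x - y) < B"
  for x y :: "'a::ultrametric_field"
  using absv_add_less[of x B "- y"] by simp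

lemma absv_diff_trans_less: "absv (x - y) < B \<Longrightarrow> absv (y - z) < B \<Longrightarrow> absv (x - z) < B"
  for x y z :: "'a::ultrametric_field"
  using absv_add_less[of "x - y" B "y - z"] by simp

text \<open>If |x + y| were below |y|, then y = (x + y) - x would be smaller than itself: all
  triangles are isosceles.\<close>

lemma absv_add_eq: "absv x < absv y \<Longrightarrow> absv (x + y) = absv y" for x y :: "'a::ultrametric_field"
  using absv_ultrametric[of x y] absv_diff_less[of "x + y" "absv y" x] by force

lemma absv_eq_of_close: "absv (x - y) < absv y \<Longrightarrow> absv x = absv y" for x y :: "'a::ultrametric_field"
  using absv_add_eq[of "x - y" y] by simp

lemma absv_sum_le:
  fixes f :: "'b \<Rightarrow> 'a::ultrametric_field"
  assumes "\<And>i. i \<in> A \<Longrightarrow> absv (f i) \<le> B" "0 \<le> B"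
  shows "absv (sum f A) \<le> B"
  using assms(1)
  by (induction A rule: infinite_finite_induct) (auto intro: absv_add_le assms(2))

lemma absv_sum_less:
  fixes f :: "'b \<Rightarrow> 'a::ultrametric_field"
  assumes "\<And>i. i \<in> A \<Longrightarrow> absv (f i) < B" "0 < B"
  shows "absv (sum f A) < B"
  using assms(1)
  by (induction A rule: infinite_finite_induct) (auto intro: absv_add_less assms(2))

lemma absv_of_nat_le_1: "absv (of_nat n :: 'a::ultrametric_field) \<le> 1"
  by (induction n) (auto intro: absv_add_le)

lemma absv_of_int_le_1: "absv (of_int n :: 'a::ultrametric_field) \<le> 1"
  by (cases n rule: int_cases2) (auto simp: absv_of_nat_le_1)

lemma absv_neg_one_power_mult [simp]: "absv ((- 1) ^ n * x) = absv x"
  for x :: "'a::ultrametric_field"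
  by (simp add: absv_mult absv_power)

lemma tendsto_absv_iff: "(f \<longlongrightarrow> l) F \<longleftrightarrow> ((\<lambda>x. absv (f x - l)) \<longlongrightarrow> 0) F"
  for l :: "'a::ultrametric_field"
  by (subst tendsto_dist_iff) (simp add: dist_absv)

lemma tendsto_0_absv_iff: "(f \<longlongrightarrow> 0) F \<longleftrightarrow> ((\<lambda>x. absv (f x)) \<longlongrightarrow> 0) F"
  for f :: "'b \<Rightarrow> 'a::ultrametric_field"
  by (subst tendsto_absv_iff) simp

lemma tendsto_0_absv_le:
  fixes f :: "'b \<Rightarrow> 'a::ultrametric_field"
  assumes "\<forall>\<^sub>F x in F. absv (f x) \<le> g x" "(g \<longlongrightarrow> 0) F"
  shows "(f \<longlongrightarrow> 0) F"
  unfolding tendsto_0_absv_iff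
  by (rule tendsto_sandwich[OF _ assms(1) tendsto_const assms(2)]) simp

section \<open>Continuity of the field operations and convergence criteria\<close>

instance ultrametric_field \<subseteq> topological_ab_group_add
proof
  fix a b :: 'a
  have *: "dist (x + y) (a + b) \<le> max (dist x a) (dist y b)" for x y
    using absv_ultrametric[of "x - a" "y - b"] by (simp add: dist_absv algebra_simps)
  show "LIM x (nhds a \<times>\<^sub>F nhds b). fst x + snd x :> nhds (a + b)"
  proof (rule tendstoI)
    fix e :: real assume "e > 0"
    then have "\<forall>\<^sub>F x in nhds a. dist x a < e" "\<forall>\<^sub>F x in nhds b. dist x b < e"
      by (auto simp: eventually_nhds_metric)
    then show "\<forall>\<^sub>F x in nhds a \<times>\<^sub>F nhds b. dist (fst x + snd x) (a + b) < e"
      unfolding eventually_prod_filter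
      by (intro exI[of _ "\<lambda>x. dist x a < e"] exI[of _ "\<lambda>x. dist x b < e"])
        (auto intro: le_less_trans[OF *])
  qed
  have "dist (- x) (- a) = dist x a" for x
    by (simp add: dist_absv absv_minus_commute)
  then show "(uminus \<longlongrightarrow> - a) (nhds a)"
    by (intro tendstoI) (auto simp: eventually_nhds_metric)
qed

text \<open>Apply the maximum inequality to xy - ab = (x - a)(y - b) + a(y - b) + (x - a)b.\<close>

instance ultrametric_field \<subseteq> topological_comm_monoid_mult
proof
  fix a b :: 'a
  show "LIM x (nhds a \<times>\<^sub>F nhds b). fst x * snd x :> nhds (a * b)"
    unfolding tendsto_absv_iff
  proof (rule tendsto_sandwich[OF _ _ tendsto_const])
    have a: "((\<lambda>x. absv (fst x - a)) \<longlongrightarrow> 0) (nhds a \<times>\<^sub>F nhds b)"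
      using filterlim_fst[of "nhds a" "nhds b"] tendsto_absv_iff by blast
    have b: "((\<lambda>x. absv (snd x - b)) \<longlongrightarrow> 0) (nhds a \<times>\<^sub>F nhds b)"
      using filterlim_snd[of "nhds b" "nhds a"] tendsto_absv_iff by blast
    show "((\<lambda>x. max (absv (fst x - a) * absv (snd x - b))
        (max (absv a * absv (snd x - b)) (absv (fst x - a) * absv b))) \<longlongrightarrow> 0) (nhds a \<times>\<^sub>F nhds b)"
      using tendsto_max[OF tendsto_mult[OF a b] tendsto_max[OF tendsto_mult_left[OF b, of "absv a"]
          tendsto_mult_right[OF a, of "absv b"]]] by simp
    have "absv (x * y - a * b) \<le> max (absv (x - a) * absv (y - b))
        (max (absv a * absv (y - b)) (absv (x - a) * absv b))" (is "_ \<le> max ?A (max ?B ?C)") for x y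
    proof -
      have "x * y - a * b = (x - a) * (y - b) + (a * (y - b) + (x - a) * b)"
        by (simp add: algebra_simps)
      moreover have "absv ((x - a) * (y - b) + (a * (y - b) + (x - a) * b)) \<le> max ?A (max ?B ?C)"
        by (intro absv_add_le) (simp_all add: absv_mult)
      ultimately show ?thesis
        by simp
    qed
    then show "\<forall>\<^sub>F x in nhds a \<times>\<^sub>F nhds b. absv (fst x * snd x - a * b) \<le>
        max (absv (fst x - a) * absv (snd x - b))
          (max (absv a * absv (snd x - b)) (absv (fst x - a) * absv b))"
      by (intro always_eventually) auto
  qed auto
qed

lemma eventually_absv_diff_less:
  fixes f :: "'b \<Rightarrow> 'a::ultrametric_field"
  assumes "(f \<longlongrightarrow> l) F" "0 < e"
  shows "\<forall>\<^sub>F x in F. absv (f x - l) < e"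
  using tendstoD[OF assms] by (simp add: dist_absv)

lemma closed_absv_le: "closed {x :: 'a::ultrametric_field. absv x \<le> B}"
proof -
  have "{x :: 'a. absv x \<le> B} = cball 0 B"
    by (auto simp: dist_absv)
  then show ?thesis
    by simp
qed

text \<open>An open disc is closed: a limit is closer than B to some member of the sequence, and
  that member is closer than B to the centre.\<close>

lemma closed_absv_less:
  fixes a :: "'a::ultrametric_field"
  assumes "0 < B"
  shows "closed {x. absv (x - a) < B}"
  unfolding closed_sequential_limits
proof (intro allI impI, elim conjE)
  fix f l assume f: "\<forall>n. f n \<in> {x. absv (x - a) < B}" and "f \<longlonglongrightarrow> l"
  from eventually_absv_diff_less[OF this(2) assms] obtain n where "absv (f n - l) < B"
    by (auto simp: eventually_sequentially)
  with f have "absv (l - a) < B"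
    by (metis absv_diff_trans_less absv_minus_commute mem_Collect_eq)
  then show "l \<in> {x. absv (x - a) < B}"
    by simp
qed

text \<open>By the maximum inequality a difference over many steps is no larger than the largest
  single step. For series this means that terms tending to 0 suffice.\<close>

lemma Cauchy_ultrametric:
  fixes f :: "nat \<Rightarrow> 'a::ultrametric_field"
  assumes "(\<lambda>n. f (Suc n) - f n) \<longlonglongrightarrow> 0"
  shows "convergent f"
proof (rule Cauchy_convergent, rule metric_CauchyI)
  fix e :: real assume "e > 0"
  then obtain N where N: "\<And>n. n \<ge> N \<Longrightarrow> absv (f (Suc n) - f n) < e"
    using eventually_absv_diff_less[OF assms] by (auto simp: eventually_sequentially)
  have *: "absv (f n - f N) < e" if "n \<ge> N" for n
    using that
  proof (induction n rule: dec_induct)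
    case (step n)
    then show ?case
      using absv_diff_trans_less[OF N[OF step(1)] step.IH] by simp
  qed (simp add: \<open>e > 0\<close>)
  have "dist (f m) (f n) < e" if "m \<ge> N" "n \<ge> N" for m n
    using absv_diff_trans_less[OF *[OF that(1)], of "f n"] *[OF that(2)]
    by (simp add: dist_absv absv_minus_commute[of "f N"])
  then show "\<exists>M. \<forall>m\<ge>M. \<forall>n\<ge>M. dist (f m) (f n) < e"
    by blast
qed

lemma summable_ultrametric:
  fixes f :: "nat \<Rightarrow> 'a::ultrametric_field"
  assumes "f \<longlonglongrightarrow> 0"
  shows "summable f"
  using Cauchy_ultrametric[of "\<lambda>n. \<Sum>i<n. f i"] assms
  by (simp add: summable_iff_convergent)

lemma summable_absv_le:
  fixes f :: "nat \<Rightarrow> 'a::ultrametric_field"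
  assumes "\<And>n. absv (f n) \<le> g n" "g \<longlonglongrightarrow> 0"
  shows "summable f"
  using summable_ultrametric tendsto_0_absv_le[OF always_eventually] assms by metis

lemma absv_suminf_le:
  fixes f :: "nat \<Rightarrow> 'a::ultrametric_field"
  assumes "summable f" "\<And>n. absv (f n) \<le> B"
  shows "absv (suminf f) \<le> B"
proof -
  have "0 \<le> B"
    using assms(2)[of 0] absv_nonneg order_trans by blast
  then show ?thesis
    using closed_sequentially[OF closed_absv_le, of "\<lambda>n. \<Sum>i<n. f i" B "suminf f"]
      absv_sum_le[of _ f B] assms summable_LIMSEQ by blast
qed

lemma sums_cmult: "f sums a \<Longrightarrow> (\<lambda>n. c * f n) sums (c * a)" for c :: "'a::ultrametric_field"
  unfolding sums_def using tendsto_mult[OF tendsto_const[of c]]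
  by (fastforce simp: sum_distrib_left)

lemma suminf_minus_partial_sum:
  fixes f :: "nat \<Rightarrow> 'a::ultrametric_field"
  assumes "summable f"
  shows "summable (\<lambda>i. f (i + n))" "suminf f - (\<Sum>i<n. f i) = (\<Sum>i. f (i + n))"
proof -
  have "(\<lambda>k. (\<Sum>i<k + n. f i) - (\<Sum>i<n. f i)) \<longlonglongrightarrow> suminf f - (\<Sum>i<n. f i)"
    by (intro tendsto_diff tendsto_const LIMSEQ_ignore_initial_segment summable_LIMSEQ assms)
  moreover have "(\<Sum>i<k + n. f i) - (\<Sum>i<n. f i) = (\<Sum>i<k. f (i + n))" for k
    by (induction k) auto
  ultimately have "(\<lambda>i. f (i + n)) sums (suminf f - (\<Sum>i<n. f i))"
    by (simp add: sums_def)
  then show "summable (\<lambda>i. f (i + n))" "suminf f - (\<Sum>i<n. f i) = (\<Sum>i. f (i + n))"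
    by (auto simp: sums_iff)
qed

lemma absv_suminf_minus_partial_sum_le:
  fixes f :: "nat \<Rightarrow> 'a::ultrametric_field"
  assumes "summable f" "\<And>i. i \<ge> n \<Longrightarrow> absv (f i) \<le> B"
  shows "absv (suminf f - (\<Sum>i<n. f i)) \<le> B"
  using suminf_minus_partial_sum[OF assms(1), of n] assms(2) by (auto intro: absv_suminf_le)

section \<open>Binomial series and the p-adic logarithm\<close>

lemma tendsto_gbinomial:
  fixes f :: "'b \<Rightarrow> 'a::ultrametric_field"
  assumes "(f \<longlongrightarrow> t) F"
  shows "((\<lambda>x. f x gchoose n) \<longlongrightarrow> t gchoose n) F"
  unfolding gbinomial_prod_rev divide_inverse
  by (intro tendsto_mult tendsto_prod' tendsto_diff assms tendsto_const)

text \<open>The power (1 + a)^t for p-adic integers t, with the base freed from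
  \<open>angle\<close>, so that multiplicativity can be stated for arbitrary small a.\<close>

definition binomial_power :: "'a::ultrametric_field \<Rightarrow> 'a \<Rightarrow> 'a" where
  "binomial_power a t = (\<Sum>n. (t gchoose n) * a ^ n)"

definition log1p :: "'a::ultrametric_field \<Rightarrow> 'a" where
  "log1p a = (\<Sum>n. (- 1) ^ n * a ^ Suc n / of_nat (Suc n))"

lemma binomial_power_of_nat: "binomial_power a (of_nat k) = (1 + a) ^ k"
proof -
  have "binomial_power a (of_nat k) = (\<Sum>n\<le>k. (of_nat k gchoose n) * a ^ n)"
    unfolding binomial_power_def
    by (rule suminf_finite) (auto simp: binomial_eq_0 simp flip: binomial_gbinomial)
  also have "\<dots> = (a + 1) ^ k"
    unfolding binomial_ring[of a 1 k] by (simp add: binomial_gbinomial)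
  finally show ?thesis
    by (simp add: add.commute)
qed

lemma log1p_0 [simp]: "log1p 0 = 0"
  by (simp add: log1p_def)

locale padic_valued_field =
  fixes p :: nat and K :: "'a::ultrametric_field itself"
  assumes prime_p: "prime p"
    and absv_p: "absv (of_nat p :: 'a) = 1 / real p"
begin

lemma p_gt_1: "p > 1"
  using prime_p prime_gt_1_nat by blast

lemma p_nonzero: "(of_nat p :: 'a) \<noteq> 0"
  using p_gt_1 by auto

lemma absv_p_power: "absv (of_nat p ^ n :: 'a) = (1 / real p) ^ n"
  by (simp add: absv_power absv_p)

lemma p_power_tendsto_0: "(\<lambda>n. of_nat (p ^ n) :: 'a) \<longlonglongrightarrow> 0"
  unfolding tendsto_0_absv_iff of_nat_power absv_p_power
  using p_gt_1 by (intro LIMSEQ_realpow_zero) auto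

text \<open>If |n| < 1, a Bezout relation u p + v n = 1 would give |1| < 1.\<close>

lemma absv_of_nat_coprime:
  assumes "\<not> p dvd n"
  shows "absv (of_nat n :: 'a) = 1"
proof (rule ccontr)
  assume "absv (of_nat n :: 'a) \<noteq> 1"
  then have n: "absv (of_nat n :: 'a) < 1"
    using absv_of_nat_le_1[of n, where 'a='a] by linarith
  from prime_p assms have "coprime (int p) (int n)"
    by (simp add: prime_imp_coprime)
  then obtain u v where uv: "u * int p + v * int n = 1"
    using bezout_int[of "int p" "int n"] by auto
  have "absv (of_int u * of_nat p + of_int v * of_nat n :: 'a) < 1"
  proof (intro absv_add_less)
    have "absv (of_int z * x) < 1" if "absv x < 1" for z and x :: 'a
      using that mult_left_le_one_le[OF absv_nonneg[of x] absv_nonneg absv_of_int_le_1[of z, where 'a='a]]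
      by (simp add: absv_mult)
    then show "absv (of_int u * of_nat p :: 'a) < 1" "absv (of_int v * of_nat n :: 'a) < 1"
      using n p_gt_1 by (simp_all add: absv_p)
  qed
  moreover have "of_int u * of_nat p + of_int v * of_nat n = (of_int (u * int p + v * int n) :: 'a)"
    by simp
  ultimately show False
    by (simp add: uv)
qed

lemma absv_of_nat:
  assumes "n > 0"
  obtains k where "absv (of_nat n :: 'a) = (1 / real p) ^ k" "p ^ k \<le> n"
proof -
  from assms prime_p obtain m where m: "n = p ^ multiplicity p n * m" "\<not> p dvd m"
    using multiplicity_decompose'[of n p] by (metis not_gr_zero not_prime_unit)
  have "absv (of_nat n :: 'a) = (1 / real p) ^ multiplicity p n"
    by (subst m(1)) (simp add: absv_mult absv_p_power absv_of_nat_coprime[OF m(2)])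
  moreover have "p ^ multiplicity p n \<le> n"
    using assms by (intro dvd_imp_le multiplicity_dvd) auto
  ultimately show thesis
    using that by blast
qed

text \<open>For n > 0 the value |1/n| is the power of p contained in n, hence at most n. Such linear
  growth is harmless against a geometric factor.\<close>

lemma absv_inverse_of_nat_le: "absv (1 / of_nat n :: 'a) \<le> real n"
proof (cases "n = 0")
  case False
  then obtain k where "absv (of_nat n :: 'a) = (1 / real p) ^ k" "p ^ k \<le> n"
    using absv_of_nat by blast
  then show ?thesis
    by (simp add: absv_divide power_divide flip: of_nat_power)
qed simp

text \<open>The partial fractions 1/(n+1) - 1/(n+2) keep the bound linear, since a difference is
  bounded by the larger of its two terms.\<close>

lemma absv_inverse_consecutive_le: "absv (1 / (of_nat (Suc n) * of_nat (Suc (Suc n))) :: 'a) \<le> real (n + 2)"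
proof -
  have "(1 / (of_nat (Suc n) * of_nat (Suc (Suc n))) :: 'a) = 1 / of_nat (Suc n) - 1 / of_nat (Suc (Suc n))"
    by (simp add: diff_frac_eq del: of_nat_Suc) simp
  then show ?thesis
    using absv_inverse_of_nat_le[of "Suc n"] absv_inverse_of_nat_le[of "Suc (Suc n)"]
    by (auto intro!: absv_diff_le)
qed

section \<open>The p-adic integers and binomial series in the exponent\<close>

lemma padic_integers_of_int: "of_int z \<in> (padic_integers :: 'a set)"
  unfolding padic_integers_def by (intro subsetD[OF closure_subset] Ints_of_int)

lemma padic_integers_of_nat: "of_nat n \<in> (padic_integers :: 'a set)"
  using padic_integers_of_int[of "int n"] by simp

text \<open>Natural numbers are dense in the p-adic integers. This is how identities and bounds
  known for natural exponents reach arbitrary ones.\<close>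

lemma padic_integers_limit:
  fixes t :: 'a
  assumes "t \<in> padic_integers"
  obtains f where "(\<lambda>n. of_nat (f n)) \<longlonglongrightarrow> t"
proof -
  from assms obtain x where x: "\<And>n. x n \<in> \<int>" "x \<longlonglongrightarrow> t"
    unfolding padic_integers_def closure_sequential by blast
  have "\<forall>n. \<exists>z. x n = of_int z"
    using x(1) by (auto elim: Ints_cases)
  then obtain z where z: "\<And>n. x n = of_int (z n)"
    unfolding choice_iff by blast
  \<comment> \<open>The added multiple of \<open>p ^ n\<close> makes the integer nonnegative,
    because \<open>p ^ n \<ge> 1\<close>, and moves it by an amount tending to 0.\<close>
  define f where "f n = nat (z n + int (p ^ n) * \<bar>z n\<bar>)" for n
  have f: "of_nat (f n) = x n + of_nat (p ^ n) * of_int \<bar>z n\<bar>" for n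
  proof -
    have "\<bar>z n\<bar> \<le> int (p ^ n) * \<bar>z n\<bar>"
      using p_gt_1 mult_right_mono[of 1 "int (p ^ n)" "\<bar>z n\<bar>"] by simp
    then have "int (f n) = z n + int (p ^ n) * \<bar>z n\<bar>"
      by (simp add: f_def)
    then have "(of_int (int (f n)) :: 'a) = of_int (z n + int (p ^ n) * \<bar>z n\<bar>)"
      by presburger
    then show ?thesis
      by (simp add: z)
  qed
  have "(\<lambda>n. of_nat (p ^ n) * of_int \<bar>z n\<bar> :: 'a) \<longlonglongrightarrow> 0"
  proof (rule tendsto_0_absv_le[OF always_eventually])
    show "(\<lambda>n. absv (of_nat (p ^ n) :: 'a)) \<longlonglongrightarrow> 0"
      by (rule iffD1[OF tendsto_0_absv_iff p_power_tendsto_0])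
  qed (auto simp: absv_mult intro: mult_left_le[OF absv_of_int_le_1])
  from tendsto_add[OF x(2) this] have "(\<lambda>n. of_nat (f n)) \<longlonglongrightarrow> t"
    by (simp add: f)
  then show thesis
    using that by blast
qed

lemma padic_integers_closed: "closed (padic_integers :: 'a set)"
  by (simp add: padic_integers_def)

lemma padic_integers_add:
  fixes s t :: 'a
  assumes "s \<in> padic_integers" "t \<in> padic_integers"
  shows "s + t \<in> padic_integers"
proof -
  from assms obtain f g where "(\<lambda>n. of_nat (f n)) \<longlonglongrightarrow> s" "(\<lambda>n. of_nat (g n)) \<longlonglongrightarrow> t"
    by (metis padic_integers_limit)
  then have "(\<lambda>n. of_nat (f n + g n)) \<longlonglongrightarrow> s + t"
    by (simp add: tendsto_add)
  then show ?thesis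
    using padic_integers_closed padic_integers_of_nat by (metis (lifting) closed_sequentially)
qed

lemma padic_integers_minus:
  fixes t :: 'a
  assumes "t \<in> padic_integers"
  shows "- t \<in> padic_integers"
proof -
  from assms obtain f where "(\<lambda>n. of_nat (f n)) \<longlonglongrightarrow> t"
    by (metis padic_integers_limit)
  then have "(\<lambda>n. of_int (- int (f n))) \<longlonglongrightarrow> - t"
    by (simp add: tendsto_minus)
  then show ?thesis
    using padic_integers_closed padic_integers_of_int by (metis (lifting) closed_sequentially)
qed

lemma padic_integers_diff:
  "s \<in> padic_integers \<Longrightarrow> t \<in> padic_integers \<Longrightarrow> s - t \<in> padic_integers" for s t :: 'a
  using padic_integers_add[of s "- t"] padic_integers_minus by simp

text \<open>For natural t the binomial coefficient is a natural number; the bound survives the limit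
  because the coefficient is a polynomial in t.\<close>

lemma absv_gbinomial_le_1:
  fixes t :: 'a
  assumes "t \<in> padic_integers"
  shows "absv (t gchoose n) \<le> 1"
proof -
  from assms obtain f where "(\<lambda>k. of_nat (f k)) \<longlonglongrightarrow> t"
    by (metis padic_integers_limit)
  from tendsto_gbinomial[OF this, of n]
  have "(\<lambda>k. of_nat (f k choose n)) \<longlonglongrightarrow> t gchoose n"
    by (simp add: binomial_gbinomial)
  from closed_sequentially[OF closed_absv_le[of 1] _ this] show ?thesis
    by (simp add: absv_of_nat_le_1)
qed

lemma summable_binomial_series:
  fixes t :: 'a
  assumes "t \<in> padic_integers" "b \<longlonglongrightarrow> 0"
  shows "summable (\<lambda>n. (t gchoose n) * b n)"
  using assms absv_gbinomial_le_1[OF assms(1)]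
  by (intro summable_absv_le[of _ "\<lambda>n. absv (b n)"])
    (auto simp: absv_mult mult_left_le_one_le simp flip: tendsto_0_absv_iff)

text \<open>The binomial coefficients are bounded by 1 for all p-adic integers at once, so the tails
  are uniformly small and continuity reduces to that of finitely many polynomials. This is the easy
  direction of Mahler's theorem.\<close>

lemma tendsto_binomial_series:
  fixes t :: 'a
  assumes b: "b \<longlonglongrightarrow> 0" and f: "(f \<longlongrightarrow> t) F"
    and mem: "\<forall>\<^sub>F x in F. f x \<in> padic_integers" "t \<in> padic_integers"
  shows "((\<lambda>x. \<Sum>n. (f x gchoose n) * b n) \<longlongrightarrow> (\<Sum>n. (t gchoose n) * b n)) F"
proof (rule tendstoI)
  fix e :: real assume e: "e > 0"
  from eventually_absv_diff_less[OF b, of "e / 2"] e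
  obtain N where N: "\<And>n. n \<ge> N \<Longrightarrow> absv (b n) < e / 2"
    by (auto simp: eventually_sequentially)
  have tail: "absv ((\<Sum>n. (s gchoose n) * b n) - (\<Sum>n<N. (s gchoose n) * b n)) < e"
    if s: "s \<in> padic_integers" for s
  proof -
    have "absv ((s gchoose n) * b n) \<le> e / 2" if "n \<ge> N" for n
      using N[OF that] absv_gbinomial_le_1[OF s, of n] mult_left_le_one_le[of "absv (b n)" "absv (s gchoose n)"]
      by (simp add: absv_mult)
    then show ?thesis
      using absv_suminf_minus_partial_sum_le[OF summable_binomial_series[OF s b], of N "e / 2"] e by simp
  qed
  have "((\<lambda>x. \<Sum>n<N. (f x gchoose n) * b n) \<longlongrightarrow> (\<Sum>n<N. (t gchoose n) * b n)) F"
    by (intro tendsto_sum tendsto_mult tendsto_const tendsto_gbinomial f)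
  from eventually_conj[OF eventually_absv_diff_less[OF this e] mem(1)]
  show "\<forall>\<^sub>F x in F. dist (\<Sum>n. (f x gchoose n) * b n) (\<Sum>n. (t gchoose n) * b n) < e"
  proof (eventually_elim)
    case (elim x)
    with tail[of "f x"] tail[OF mem(2)] show ?case
      unfolding dist_absv by (metis absv_diff_trans_less absv_minus_commute)
  qed
qed

lemma power_tendsto_0: "absv a < 1 \<Longrightarrow> (\<lambda>n. a ^ n) \<longlonglongrightarrow> 0" for a :: 'a
  by (simp add: tendsto_0_absv_iff absv_power LIMSEQ_realpow_zero)

lemma tendsto_binomial_power:
  fixes a t :: 'a
  assumes "absv a < 1" "(f \<longlongrightarrow> t) F" "\<forall>\<^sub>F x in F. f x \<in> padic_integers" "t \<in> padic_integers"
  shows "((\<lambda>x. binomial_power a (f x)) \<longlongrightarrow> binomial_power a t) F"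
  unfolding binomial_power_def by (intro tendsto_binomial_series power_tendsto_0 assms)

lemma absv_add_mult_less_1: "absv a < 1 \<Longrightarrow> absv b < 1 \<Longrightarrow> absv (a + b + a * b) < 1" for a b :: 'a
  using mult_strict_mono'[of "absv a" 1 "absv b" 1] by (intro absv_add_less) (simp_all add: absv_mult)

text \<open>Both sides are continuous in t and agree for natural t, where they are powers of (1 +
  a)(1 + b).\<close>

lemma binomial_power_mult:
  fixes a b t :: 'a
  assumes "absv a < 1" "absv b < 1" "t \<in> padic_integers"
  shows "binomial_power a t * binomial_power b t = binomial_power (a + b + a * b) t"
proof -
  from assms(3) obtain f where f: "(\<lambda>n. of_nat (f n)) \<longlonglongrightarrow> t"
    by (metis padic_integers_limit)
  have *: "(\<lambda>n. binomial_power c (of_nat (f n))) \<longlonglongrightarrow> binomial_power c t" if "absv c < 1" for c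
    using that f assms(3) by (intro tendsto_binomial_power always_eventually allI padic_integers_of_nat)
  have "binomial_power a (of_nat n) * binomial_power b (of_nat n) = binomial_power (a + b + a * b) (of_nat n)" for n
    unfolding binomial_power_of_nat power_mult_distrib[symmetric] by (simp add: algebra_simps)
  then have "(\<lambda>n. binomial_power (a + b + a * b) (of_nat (f n))) \<longlonglongrightarrow> binomial_power a t * binomial_power b t"
    using tendsto_mult[OF *[OF assms(1)] *[OF assms(2)]] by simp
  from LIMSEQ_unique[OF this *[OF absv_add_mult_less_1[OF assms(1,2)]]] show ?thesis .
qed

section \<open>The p-adic logarithm as the derivative of powers at exponent 0\<close>

lemma absv_power_divide_le:
  "absv (a ^ n / of_nat n) \<le> real n * absv a ^ n" for a :: 'a
proof -
  have "a ^ n / of_nat n = 1 / of_nat n * a ^ n"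
    by simp
  then show ?thesis
    using mult_right_mono[OF absv_inverse_of_nat_le, of "absv a ^ n" n]
    by (simp only: absv_mult absv_power) simp
qed

lemma power_divide_tendsto_0:
  fixes a :: 'a
  assumes "absv a < 1"
  shows "(\<lambda>n. a ^ Suc n / of_nat (Suc n)) \<longlonglongrightarrow> 0"
proof -
  have "(\<lambda>n. real (Suc n) * absv a ^ Suc n) \<longlonglongrightarrow> 0"
    using assms powser_times_n_limit_0[of "absv a"] by (intro LIMSEQ_Suc) simp
  then show ?thesis
    by (rule tendsto_0_absv_le[OF always_eventually, rotated]) (intro allI absv_power_divide_le)
qed

lemma log1p_sums:
  fixes a :: 'a
  assumes "absv a < 1"
  shows "(\<lambda>n. (- 1) ^ n * a ^ Suc n / of_nat (Suc n)) sums log1p a"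
proof -
  have "(\<lambda>n. (- 1) ^ n * a ^ Suc n / of_nat (Suc n)) \<longlonglongrightarrow> 0"
    using power_divide_tendsto_0[OF assms] unfolding tendsto_0_absv_iff[of _ sequentially]
    by (simp add: absv_mult absv_divide absv_power)
  then show ?thesis
    unfolding log1p_def by (intro summable_sums summable_ultrametric)
qed

text \<open>The absorption identity for binomial coefficients cancels t and leaves a binomial series
  with coefficients tending to 0. The difference quotient thus extends continuously to t =
  0.\<close>

lemma binomial_power_quotient:
  fixes a t :: 'a
  assumes "absv a < 1" "t \<in> padic_integers" "t \<noteq> 0"
  shows "(binomial_power a t - 1) / t = (\<Sum>n. (t - 1 gchoose n) * (a ^ Suc n / of_nat (Suc n)))"
proof -
  have "t - 1 \<in> padic_integers"
    using assms padic_integers_diff[OF assms(2) padic_integers_of_nat[of 1]] by simp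
  then have "summable (\<lambda>n. (t - 1 gchoose n) * (a ^ Suc n / of_nat (Suc n)))"
    by (intro summable_binomial_series power_divide_tendsto_0 assms)
  then have "(\<lambda>n. t * ((t - 1 gchoose n) * (a ^ Suc n / of_nat (Suc n)))) sums
      (t * (\<Sum>n. (t - 1 gchoose n) * (a ^ Suc n / of_nat (Suc n))))" (is "?f sums ?s")
    by (intro sums_cmult summable_sums)
  moreover have "?f n = (t gchoose Suc n) * a ^ Suc n" for n
    using gbinomial_absorption[of n t] by (simp add: field_simps del: of_nat_Suc power_Suc)
  ultimately have "(\<lambda>n. (t gchoose Suc n) * a ^ Suc n) sums ?s"
    by simp
  then have "(\<lambda>n. (t gchoose n) * a ^ n) sums (?s + (t gchoose 0) * a ^ 0)"
    by (rule sums_Suc)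
  then have "binomial_power a t = ?s + 1"
    by (simp add: binomial_power_def sums_iff)
  then show ?thesis
    using assms(3) by simp
qed

lemma gbinomial_minus_1: "(- 1 :: 'a) gchoose n = (- 1) ^ n"
  using gbinomial_minus[of "1::'a" n] binomial_gbinomial[of n n, where 'a='a] by simp

text \<open>Here \<open>p ^ k\<close> plays the exponent t tending to 0 in the difference quotient
  of (1 + a)^t; as -1 gchoose n is (-1)^n, the limiting series is that of the logarithm.\<close>

lemma log1p_limit:
  fixes a :: 'a
  assumes "absv a < 1"
  shows "(\<lambda>k. ((1 + a) ^ (p ^ k) - 1) / of_nat (p ^ k)) \<longlonglongrightarrow> log1p a"
proof -
  have "(\<lambda>k. \<Sum>n. (of_nat (p ^ k) - 1 gchoose n) * (a ^ Suc n / of_nat (Suc n)))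
      \<longlonglongrightarrow> (\<Sum>n. (0 - 1 gchoose n) * (a ^ Suc n / of_nat (Suc n)))"
    using padic_integers_diff[OF padic_integers_of_nat padic_integers_of_nat[of 1]]
      padic_integers_diff[OF padic_integers_of_nat[of 0] padic_integers_of_nat[of 1]]
    by (intro tendsto_binomial_series power_divide_tendsto_0 tendsto_diff p_power_tendsto_0
        tendsto_const assms) (auto simp del: of_nat_power)
  moreover have "(\<Sum>n. (of_nat (p ^ k) - 1 gchoose n) * (a ^ Suc n / of_nat (Suc n))) =
      ((1 + a) ^ (p ^ k) - 1) / of_nat (p ^ k)" for k
    using binomial_power_quotient[OF assms padic_integers_of_nat, of "p ^ k"] p_nonzero
    unfolding binomial_power_of_nat by simp
  ultimately show ?thesis
    by (simp add: gbinomial_minus_1 log1p_def)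
qed

text \<open>With \<open>X\<close>, \<open>Y\<close> the \<open>p\<^sup>k\<close>-th powers, \<open>XY - 1 = (X - 1) + (Y - 1) + (X - 1)(Y - 1)\<close>,
  and the last product is divisible by \<open>p\<^sup>2\<^sup>k\<close> up to a bounded factor.\<close>

lemma log1p_add:
  fixes a b :: 'a
  assumes "absv a < 1" "absv b < 1"
  shows "log1p (a + b + a * b) = log1p a + log1p b"
proof -
  define q where "q c k = ((1 + c) ^ (p ^ k) - 1) / of_nat (p ^ k)" for c :: 'a and k
  have lim: "q c \<longlonglongrightarrow> log1p c" if "absv c < 1" for c
    unfolding q_def using log1p_limit[OF that] .
  have "q (a + b + a * b) k = q a k + q b k + of_nat (p ^ k) * (q a k * q b k)" for k
  proof -
    define P :: 'a where "P = of_nat (p ^ k)"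
    have P: "P \<noteq> 0"
      using p_gt_1 by (simp add: P_def)
    have *: "1 + (a + b + a * b) = (1 + a) * (1 + b)"
      by (simp add: algebra_simps)
    show ?thesis
      unfolding q_def P_def[symmetric] * power_mult_distrib using P by (simp add: field_simps)
  qed
  then have "q (a + b + a * b) = (\<lambda>k. q a k + q b k + of_nat (p ^ k) * (q a k * q b k))"
    by blast
  moreover have "(\<lambda>k. q a k + q b k + of_nat (p ^ k) * (q a k * q b k)) \<longlonglongrightarrow>
      log1p a + log1p b + 0 * (log1p a * log1p b)"
    by (intro tendsto_add tendsto_mult lim assms p_power_tendsto_0)
  ultimately have "q (a + b + a * b) \<longlonglongrightarrow> log1p a + log1p b"
    by simp
  from LIMSEQ_unique[OF lim[OF absv_add_mult_less_1[OF assms]] this] show ?thesis .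
qed

text \<open>A partial sum of the Taylor series of (1 + a) log (1 + a). The linear term stands apart
  because the other coefficients, (-1 gchoose n) / ((n + 1)(n + 2)), are those that build
  \<open>G (- 1)\<close> from the moments.\<close>

definition xlogx_poly :: "nat \<Rightarrow> 'a \<Rightarrow> 'a" where
  "xlogx_poly N a = a + (\<Sum>n<N. (- 1) ^ n * (a ^ (n + 2) / (of_nat (Suc n) * of_nat (Suc (Suc n)))))"

lemma absv_xlogx_term_le:
  fixes a :: 'a
  assumes "absv a \<le> \<rho>"
  shows "absv (a ^ (n + 2) / (of_nat (Suc n) * of_nat (Suc (Suc n)))) \<le> real (n + 2) * \<rho> ^ (n + 2)"
proof -
  have "a ^ (n + 2) / (of_nat (Suc n) * of_nat (Suc (Suc n))) =
      1 / (of_nat (Suc n) * of_nat (Suc (Suc n))) * a ^ (n + 2)"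
    by simp
  also have "absv \<dots> \<le> real (n + 2) * \<rho> ^ (n + 2)"
    unfolding absv_mult[of _ "a ^ (n + 2)"] absv_power
    by (intro mult_mono absv_inverse_consecutive_le power_mono assms) auto
  finally show ?thesis .
qed

lemma times_power_tendsto_0:
  fixes \<rho> :: real
  assumes "0 \<le> \<rho>" "\<rho> < 1"
  shows "(\<lambda>n. real (n + 2) * \<rho> ^ (n + 2)) \<longlonglongrightarrow> 0"
  using LIMSEQ_ignore_initial_segment[OF powser_times_n_limit_0[of \<rho>], of 2] assms by simp

text \<open>With L = log1p a the sum is (L - a) + a L. Up to the sign (-1)^n, the power a^(n+2)
  receives -1/(n+2) from the first part and 1/(n+1) from the second.\<close>

lemma xlogx_sums:
  fixes a :: 'a
  assumes "absv a < 1"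
  shows "(\<lambda>n. (- 1) ^ n * (a ^ (n + 2) / (of_nat (Suc n) * of_nat (Suc (Suc n)))))
    sums ((1 + a) * log1p a - a)"
proof -
  have "(\<lambda>n. (- 1) ^ Suc n * a ^ Suc (Suc n) / of_nat (Suc (Suc n))) sums (log1p a - a)"
  proof -
    have "summable (\<lambda>n. (- 1) ^ n * a ^ Suc n / of_nat (Suc n))"
      using log1p_sums[OF assms] sums_iff by blast
    from suminf_minus_partial_sum[OF this, of 1] show ?thesis
      by (simp add: sums_iff log1p_def)
  qed
  from sums_add[OF this sums_cmult[OF log1p_sums[OF assms], of a]]
  have "(\<lambda>n. (- 1) ^ Suc n * a ^ Suc (Suc n) / of_nat (Suc (Suc n)) +
      a * ((- 1) ^ n * a ^ Suc n / of_nat (Suc n))) sums ((1 + a) * log1p a - a)"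
    by (simp add: algebra_simps)
  moreover have "(- 1) ^ Suc n * a ^ Suc (Suc n) / of_nat (Suc (Suc n)) +
      a * ((- 1) ^ n * a ^ Suc n / of_nat (Suc n)) =
      (- 1) ^ n * (a ^ (n + 2) / (of_nat (Suc n) * of_nat (Suc (Suc n))))" for n
  proof -
    have "- x / v + x / u = x / (u * v)" if "u \<noteq> 0" "v \<noteq> 0" "v = u + 1" for x u v :: 'a
      using that by (simp add: field_simps)
    moreover have "of_nat (Suc n) \<noteq> (0::'a)" "of_nat (Suc (Suc n)) \<noteq> (0::'a)"
      using of_nat_neq_0 by blast+
    moreover have "of_nat (Suc (Suc n)) = (of_nat (Suc n) + 1 :: 'a)"
      by simp
    ultimately have "- ((- 1) ^ n * a ^ (n + 2)) / of_nat (Suc (Suc n)) + ((- 1) ^ n * a ^ (n + 2)) / of_nat (Suc n) =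
        (- 1) ^ n * a ^ (n + 2) / (of_nat (Suc n) * of_nat (Suc (Suc n)))"
      by blast
    then show ?thesis
      by (simp add: mult_ac del: of_nat_Suc)
  qed
  ultimately show ?thesis
    by simp
qed

text \<open>\<open>B\<close> bounds the whole tail: n \<rho>^n need not decrease from the start, so
  its value at the cut-off does not control the later terms.\<close>

lemma absv_xlogx_minus_poly_le:
  fixes a :: 'a
  assumes "absv a \<le> \<rho>" "\<rho> < 1" "\<And>n. n \<ge> N \<Longrightarrow> real (n + 2) * \<rho> ^ (n + 2) \<le> B"
  shows "absv ((1 + a) * log1p a - xlogx_poly N a) \<le> B"
proof -
  have "absv a < 1"
    using assms by simp
  have "absv (((1 + a) * log1p a - a) - (\<Sum>n<N. (- 1) ^ n * (a ^ (n + 2) / (of_nat (Suc n) * of_nat (Suc (Suc n)))))) \<le> B"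
    unfolding sums_unique[OF xlogx_sums[OF \<open>absv a < 1\<close>]]
    using absv_xlogx_term_le[OF assms(1)] assms(3) order_trans
    by (intro absv_suminf_minus_partial_sum_le sums_summable[OF xlogx_sums] \<open>absv a < 1\<close>)
      (simp only: absv_neg_one_power_mult, blast)
  then show ?thesis
    by (simp only: xlogx_poly_def diff_diff_eq)
qed

end

section \<open>Value group and residue field\<close>

text \<open>Cauchy's functional equation on the rationals. Applied to ln |p^r| it fixes the absolute
  value of the fractional powers; applied to L(p^r) it shows that a logarithm killing p kills them
  all.\<close>

lemma additive_rat_linear:
  fixes f :: "rat \<Rightarrow> 'b::field_char_0"
  assumes add: "\<And>r s. f (r + s) = f r + f s"
  shows "f r = of_rat r * f 1"
proof -
  have zero: "f 0 = 0"
    using add[of 0 0] by simp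
  have nat: "f (of_nat n * r) = of_nat n * f r" for n r
    by (induction n) (auto simp: zero add algebra_simps)
  have neg: "f (- r) = - f r" for r
    using add[of r "- r"] zero by (simp add: eq_neg_iff_add_eq_0 add.commute)
  have int: "f (of_int z * r) = of_int z * f r" for z r
    by (cases z rule: int_cases2) (auto simp: nat neg)
  obtain a b where r: "r = of_int a / of_int b" "b \<noteq> 0"
    by (metis quotient_of_div quotient_of_denom_pos less_irrefl prod.exhaust)
  have "of_int b * f r = f (of_int b * r)"
    by (simp only: int)
  also have "of_int b * r = of_int a * 1"
    using r by simp
  also have "f (of_int a * 1) = of_int a * f 1"
    by (simp only: int)
  finally have "f r = of_int a / of_int b * f 1"
    using r(2) by (simp add: field_simps)
  then show ?thesis
    by (simp add: r of_rat_divide)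
qed

text \<open>If the largest absolute value were attained only once, the sum would have that absolute
  value and could not vanish.\<close>

lemma ultrametric_sum_zero:
  fixes f :: "'b \<Rightarrow> 'a::ultrametric_field"
  assumes "finite A" "a \<in> A" "sum f A = 0" "f a \<noteq> 0"
  obtains i j where "i \<in> A" "j \<in> A" "i \<noteq> j" "absv (f i) = absv (f j)" "f i \<noteq> 0"
proof -
  define M where "M = Max ((\<lambda>i. absv (f i)) ` A)"
  have le: "absv (f i) \<le> M" if "i \<in> A" for i
    using that assms(1) by (simp add: M_def)
  have "M \<in> (\<lambda>i. absv (f i)) ` A"
    using assms by (auto simp: M_def intro!: Max_in)
  then obtain i where i: "i \<in> A" "absv (f i) = M"
    by auto
  have "M > 0"
    using le[OF assms(2)] assms(4) by (meson absv_pos_iff less_le_trans)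
  have "sum f A = sum f (A - {i}) + f i"
    using assms(1) i(1) by (simp add: sum.remove)
  then have "\<not> absv (sum f (A - {i})) < absv (f i)"
    using absv_add_eq[of "sum f (A - {i})" "f i"] \<open>M > 0\<close> i(2) assms(3) by auto
  then obtain j where "j \<in> A - {i}" "\<not> absv (f j) < M"
    using absv_sum_less[of "A - {i}" f M] \<open>M > 0\<close> i(2) by blast
  then show thesis
    using that[of i j] i le[of j] \<open>M > 0\<close> by force
qed

lemma padic_numbers_approx:
  fixes c :: "'a::ultrametric_field"
  assumes "c \<in> padic_numbers" "0 < e"
  obtains q where "q \<in> \<rat>" "absv (c - q) < e"
  using assms unfolding padic_numbers_def closure_approachable dist_absv
  by (metis absv_minus_commute)

context padic_valued_field
begin

lemma absv_of_int_value:
  assumes "z \<noteq> 0"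
  obtains k :: int where "absv (of_int z :: 'a) = real p powr of_int k"
proof -
  obtain k where "absv (of_nat (nat \<bar>z\<bar>) :: 'a) = (1 / real p) ^ k"
    using assms absv_of_nat[of "nat \<bar>z\<bar>"] by auto
  moreover have "absv (of_nat (nat \<bar>z\<bar>) :: 'a) = absv (of_int z :: 'a)"
    by (cases "z \<ge> 0") auto
  moreover have "(1 / real p) ^ k = real p powr of_int (- int k)"
    using p_gt_1 by (simp add: powr_minus powr_realpow power_one_over inverse_eq_divide)
  ultimately show thesis
    using that by metis
qed

text \<open>A rational number closer to c than |c| has the same absolute value, so completing the
  rationals adds no new values.\<close>

lemma absv_padic_number_value:
  assumes "c \<in> padic_numbers" "(c :: 'a) \<noteq> 0"
  obtains k :: int where "absv c = real p powr of_int k"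
proof -
  obtain q where q: "q \<in> \<rat>" "absv (c - q) < absv c"
    using padic_numbers_approx[OF assms(1), of "absv c"] assms(2) by auto
  then have eq: "absv q = absv c"
    by (intro absv_eq_of_close) (simp add: absv_minus_commute)
  obtain a b where ab: "b > 0" "q = of_int a / of_int b"
    using q(1) by (rule Rats_cases')
  have "a \<noteq> 0"
    using eq assms(2) ab by auto
  with ab(1)[THEN less_imp_neq, symmetric] obtain k l where "absv (of_int a :: 'a) = real p powr of_int k"
    "absv (of_int b :: 'a) = real p powr of_int l"
    by (metis absv_of_int_value)
  then have "absv c = real p powr of_int (k - l)"
    using eq by (simp add: ab(2) absv_divide powr_diff)
  then show thesis
    using that by blast
qed

text \<open>In an algebraic equation for x two monomials have equal nonzero absolute value. This
  determines the logarithm of |x| to base p as a quotient of integers, up to sign a slope of the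
  Newton polygon.\<close>

lemma absv_algebraic_value:
  assumes "x \<in> padic_algebraic" "(x :: 'a) \<noteq> 0"
  obtains r :: rat where "absv x = real p powr of_rat r"
proof -
  from assms(1) obtain q where q: "q \<noteq> 0" "\<And>i. coeff q i \<in> padic_numbers" "poly q x = 0"
    by (auto simp: padic_algebraic_def)
  have "(\<Sum>i\<le>degree q. coeff q i * x ^ i) = 0"
    using q(3) by (simp add: poly_altdef)
  moreover have "coeff q (degree q) * x ^ degree q \<noteq> 0"
    using q(1) assms(2) by simp
  ultimately obtain i j where ij: "i \<noteq> j"
    "absv (coeff q i * x ^ i) = absv (coeff q j * x ^ j)" "coeff q i * x ^ i \<noteq> 0"
    by (rule ultrametric_sum_zero[OF finite_atMost, OF atMost_iff[THEN iffD2, OF order_refl]]) auto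
  then have "absv (coeff q j * x ^ j) \<noteq> 0"
    by (metis absv_eq_0_iff)
  then have nz: "coeff q i \<noteq> 0" "coeff q j \<noteq> 0"
    using ij(3) by auto
  obtain u v where uv: "absv (coeff q i) = real p powr of_int u" "absv (coeff q j) = real p powr of_int v"
    using absv_padic_number_value q(2) nz by metis
  define w where "w = log (real p) (absv x)"
  have w: "absv x = real p powr w"
    using assms(2) p_gt_1 by (simp add: w_def)
  have "real p powr (of_int u + real i * w) = real p powr (of_int v + real j * w)"
    using ij(2) p_gt_1 by (simp add: absv_mult absv_power uv w powr_add powr_power mult.commute)
  then have "of_int u + real i * w = of_int v + real j * w"
    using p_gt_1 by (subst (asm) powr_inj) auto
  then have "w = of_int (u - v) / of_int (int j - int i)"
    using ij(1) by (simp add: field_simps)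
  also have "\<dots> = of_rat (of_int (u - v) / of_int (int j - int i))"
    unfolding of_rat_divide of_rat_of_int_eq ..
  finally show thesis
    using that w by blast
qed

text \<open>The residue field of the rationals is the prime field: the denominator b is prime to p,
  and if s inverts b modulo p, then a s has the residue of a / b.\<close>

lemma rational_integer_residue:
  assumes "q \<in> \<rat>" "absv (q :: 'a) \<le> 1"
  obtains z where "absv (q - of_int z) < 1"
proof -
  from assms(1) obtain a b where ab: "b > 0" "coprime a b" "q = of_int a / of_int b"
    by (cases rule: Rats_cases') auto
  \<comment> \<open>Otherwise p would not divide a, so |a| = 1, whereas a = b q would have absolute
    value at most 1/p.\<close>
  have b: "\<not> int p dvd b"
  proof
    assume "int p dvd b"
    then obtain b' where b': "b = int p * b'" ..
    have "\<not> int p dvd a"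
      using coprime_common_divisor[OF ab(2) _ \<open>int p dvd b\<close>] p_gt_1 by auto
    then have "\<not> p dvd nat \<bar>a\<bar>"
      by simp
    then have "absv (of_nat (nat \<bar>a\<bar>) :: 'a) = 1"
      by (rule absv_of_nat_coprime)
    moreover have "absv (of_nat (nat \<bar>a\<bar>) :: 'a) = absv (of_int a :: 'a)"
      by (cases "a \<ge> 0") auto
    ultimately have a: "absv (of_int a :: 'a) = 1"
      by simp
    have "(of_int a :: 'a) = of_nat p * of_int b' * q"
      using ab(1) unfolding ab(3) b' by auto
    with a have "absv (of_nat p * of_int b' * q) = 1"
      by simp
    then have "absv (of_int b' :: 'a) * absv q = real p"
      using p_gt_1 by (simp add: absv_mult absv_p divide_eq_eq)
    moreover have "absv (of_int b' :: 'a) * absv q \<le> 1"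
      using assms(2) absv_of_int_le_1 by (intro mult_le_one) auto
    ultimately show False
      using p_gt_1 by simp
  qed
  then have "coprime b (int p)"
    using prime_imp_coprime[of "int p" b] prime_p by (simp add: coprime_commute)
  then obtain s t where st: "s * b + t * int p = 1"
    using bezout_int[of b "int p"] by auto
  have "\<not> p dvd nat b"
    using b ab(1) by (metis int_dvd_int_iff int_nat_eq less_imp_le)
  then have "absv (of_nat (nat b) :: 'a) = 1"
    by (rule absv_of_nat_coprime)
  then have "absv (of_int b :: 'a) = 1"
    using ab(1) by simp
  have "(of_int b :: 'a) \<noteq> 0"
    using ab(1) by simp
  then have "q - of_int (a * s) = of_int a * (1 - of_int (s * b)) / of_int b"
    unfolding ab(3) by (simp add: field_simps)
  also have "1 - of_int (s * b) = (of_int (1 - s * b) :: 'a)"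
    by simp
  also have "1 - s * b = t * int p"
    using st by simp
  finally have "absv (q - of_int (a * s)) = absv (of_int (a * t) :: 'a) * (1 / real p)"
    using \<open>absv (of_int b :: 'a) = 1\<close> by (simp add: absv_mult absv_divide absv_p)
  also have "\<dots> \<le> 1 / real p"
    using absv_of_int_le_1[of "a * t", where 'a='a] by (intro mult_left_le_one_le) auto
  also have "\<dots> < 1"
    using p_gt_1 by simp
  finally show thesis
    using that by blast
qed

text \<open>Put e = x - y and expand (e + y)^p: every middle term has a binomial coefficient
  divisible by p and at least one factor e.\<close>

lemma frobenius_difference:
  fixes x y :: 'a
  assumes "absv x \<le> 1" "absv y \<le> 1"
  shows "absv (x ^ p - y ^ p - (x - y) ^ p) \<le> absv (x - y) / real p"
proof -
  define e where "e = x - y"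
  have e: "absv e \<le> 1"
    unfolding e_def using assms by (rule absv_diff_le)
  have "{..p} = insert 0 (insert p {1..<p})"
    using p_gt_1 by auto
  then have "(e + y) ^ p = y ^ p + (e ^ p + (\<Sum>k\<in>{1..<p}. of_nat (p choose k) * e ^ k * y ^ (p - k)))"
    unfolding binomial_ring using p_gt_1 by simp
  then have "x ^ p - y ^ p - (x - y) ^ p = (\<Sum>k\<in>{1..<p}. of_nat (p choose k) * e ^ k * y ^ (p - k))"
    by (simp add: e_def)
  also have "absv \<dots> \<le> absv e / real p"
  proof (rule absv_sum_le)
    fix k assume k: "k \<in> {1..<p}"
    then have "p dvd p choose k"
      using prime_p by (intro dvd_choose_prime) auto
    then obtain m where m: "p choose k = p * m" ..
    have "absv e ^ k \<le> absv e"
      using k e power_decreasing[of 1 k "absv e"] by simp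
    moreover have "absv y ^ (p - k) \<le> 1"
      using assms by (intro power_le_one) auto
    moreover have "absv (of_nat m :: 'a) \<le> 1"
      by (rule absv_of_nat_le_1)
    ultimately have "absv (of_nat m :: 'a) * (absv e ^ k * absv y ^ (p - k)) \<le> 1 * (absv e * 1)"
      by (intro mult_mono) auto
    then have "(1 / real p) * (absv (of_nat m :: 'a) * (absv e ^ k * absv y ^ (p - k))) \<le> (1 / real p) * absv e"
      by (intro mult_left_mono) auto
    then show "absv (of_nat (p choose k) * e ^ k * y ^ (p - k)) \<le> absv e / real p"
      by (simp add: m absv_mult absv_power absv_p mult.assoc)
  qed simp
  finally show ?thesis
    by (simp add: e_def)
qed

text \<open>With e = x - y, the middle binomial terms contribute at most |e| / p, and |e|^p \<le>
  |e|^2 because |e| \<le> 1 and p is at least 2.\<close>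

lemma frobenius_contraction:
  fixes x y :: 'a
  assumes "absv x \<le> 1" "absv y \<le> 1"
  shows "absv (x ^ p - y ^ p) \<le> max (1 / real p) (absv (x - y)) * absv (x - y)"
proof -
  define e where "e = absv (x - y)"
  have e: "0 \<le> e" "e \<le> 1"
    using assms by (auto simp: e_def intro: absv_diff_le)
  have "e ^ p \<le> e ^ 2"
    using e p_gt_1 by (intro power_decreasing) auto
  then have "absv ((x - y) ^ p) \<le> e * e"
    by (simp add: absv_power e_def power2_eq_square)
  also have "e * e \<le> max (1 / real p) e * e"
    using e by (intro mult_right_mono) auto
  finally have 1: "absv ((x - y) ^ p) \<le> max (1 / real p) e * e" .
  have "e / real p = 1 / real p * e"
    by simp
  also have "\<dots> \<le> max (1 / real p) e * e"
    using e by (intro mult_right_mono) auto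
  finally have "absv (x ^ p - y ^ p - (x - y) ^ p) \<le> max (1 / real p) e * e"
    using frobenius_difference[OF assms] by (simp add: e_def)
  from absv_add_le[OF this 1] show ?thesis
    by (simp add: e_def)
qed

text \<open>Distances never grow under the p-th power, so the factor of the first step remains valid
  at all later ones.\<close>

lemma frobenius_power_contraction:
  fixes x y :: 'a
  assumes "absv x \<le> 1" "absv y \<le> 1"
  shows "absv (x ^ (p ^ n) - y ^ (p ^ n)) \<le> max (1 / real p) (absv (x - y)) ^ n * absv (x - y)"
proof (induction n)
  case (Suc n)
  define e \<kappa> D where "e = absv (x - y)" and "\<kappa> = max (1 / real p) e" and
    "D = absv (x ^ (p ^ n) - y ^ (p ^ n))"
  have e: "0 \<le> e" "e \<le> 1"
    using assms by (auto simp: e_def intro: absv_diff_le)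
  have \<kappa>: "0 \<le> \<kappa>" "\<kappa> \<le> 1"
    using e p_gt_1 by (auto simp: \<kappa>_def)
  have D: "D \<le> \<kappa> ^ n * e" "0 \<le> D"
    using Suc by (auto simp: D_def \<kappa>_def e_def)
  have "\<kappa> ^ n * e \<le> 1 * e"
    using \<kappa> e by (intro mult_right_mono power_le_one) auto
  then have "max (1 / real p) D \<le> \<kappa>"
    using D by (auto simp: \<kappa>_def)
  then have "max (1 / real p) D * D \<le> \<kappa> * (\<kappa> ^ n * e)"
    using D \<kappa> by (intro mult_mono) auto
  moreover have "absv (x ^ (p ^ Suc n) - y ^ (p ^ Suc n)) \<le> max (1 / real p) D * D"
    using frobenius_contraction[of "x ^ (p ^ n)" "y ^ (p ^ n)"] assms
    by (simp add: D_def power_mult[symmetric] mult.commute absv_power power_le_one)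
  ultimately show ?case
    by (simp add: e_def \<kappa>_def)
qed simp

text \<open>Modulo the maximal ideal X^p - Y^p is (X - Y)^p, so the p-th power map is injective on
  residue classes.\<close>

lemma frobenius_power_cancel:
  fixes x y :: 'a
  assumes "absv x \<le> 1" "absv y \<le> 1" "absv (x ^ (p ^ n) - y ^ (p ^ n)) < 1"
  shows "absv (x - y) < 1"
  using assms(3)
proof (induction n)
  case (Suc n)
  define X Y where "X = x ^ (p ^ n)" and "Y = y ^ (p ^ n)"
  have XY: "absv X \<le> 1" "absv Y \<le> 1"
    using assms by (simp_all add: X_def Y_def absv_power power_le_one)
  have "absv (X - Y) / real p < 1"
    using absv_diff_le[OF XY] p_gt_1 by (simp add: divide_less_eq)
  then have 1: "absv (X ^ p - Y ^ p - (X - Y) ^ p) < 1"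
    using frobenius_difference[OF XY] by simp
  have "absv (X ^ p - Y ^ p) < 1"
    using Suc(2) by (simp add: X_def Y_def power_mult[symmetric] mult.commute)
  from absv_diff_less[OF this 1] have "absv (X - Y) ^ p < 1"
    by (simp add: absv_power)
  then have "absv (X - Y) < 1"
    using one_le_power[of "absv (X - Y)" p] by linarith
  then show ?case
    using Suc(1) by (simp add: X_def Y_def)
qed simp

text \<open>An algebraic \<open>\<alpha>\<close> satisfies, modulo the maximal ideal, a monic equation of some degree \<open>d\<close>
  over the prime field, so its powers fall into at most \<open>p\<^sup>d\<close> residue classes. Two of the powers
  \<open>\<alpha>\<close>, \<open>\<alpha>\<^sup>p\<close>, \<open>\<alpha>\<^sup>p\<^sup>2\<close>, ... are therefore congruent, and the Frobenius map is injective on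
  residue classes.\<close>

lemma algebraic_frobenius_periodic:
  fixes \<alpha> :: 'a
  assumes "\<alpha> \<in> padic_algebraic" "absv \<alpha> \<le> 1"
  obtains k where "k > 0" "absv (\<alpha> ^ (p ^ k) - \<alpha>) < 1"
proof -
  from assms(1) obtain q where q: "q \<noteq> 0" "\<And>i. coeff q i \<in> padic_numbers" "poly q \<alpha> = 0"
    by (auto simp: padic_algebraic_def)
  define m where "m = degree q"
  \<comment> \<open>The reduction is done relative to the largest coefficient size \<open>M\<close>.
    The last index \<open>d\<close> attaining it is the degree of the reduced equation, which
    division by the rational approximation \<open>r d\<close> makes monic.\<close>
  define M where "M = Max ((\<lambda>i. absv (coeff q i)) ` {..m})"
  have le_M: "absv (coeff q i) \<le> M" if "i \<le> m" for i
    using that by (simp add: M_def)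
  have M_pos: "M > 0"
    using le_M[of m] q(1) unfolding m_def
    by (meson absv_pos_iff leading_coeff_0_iff less_le_trans order_refl)
  have "M \<in> (\<lambda>i. absv (coeff q i)) ` {..m}"
    unfolding M_def by (intro Max_in) auto
  then have ex: "\<exists>i\<le>m. absv (coeff q i) = M"
    by auto
  define d where "d = (GREATEST i. i \<le> m \<and> absv (coeff q i) = M)"
  have d: "d \<le> m" "absv (coeff q d) = M"
    using GreatestI_ex_nat[of "\<lambda>i. i \<le> m \<and> absv (coeff q i) = M" m] ex by (auto simp: d_def)
  have d_max: "absv (coeff q i) < M" if "d < i" "i \<le> m" for i
    using Greatest_le_nat[of "\<lambda>i. i \<le> m \<and> absv (coeff q i) = M" i m] that le_M[of i]
    by (force simp: d_def)
  have "\<forall>i. \<exists>r. r \<in> \<rat> \<and> absv (coeff q i - r) < M"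
    using padic_numbers_approx[OF q(2) M_pos] by metis
  then obtain r where r: "\<And>i. r i \<in> \<rat>" "\<And>i. absv (coeff q i - r i) < M"
    unfolding choice_iff by auto
  have r_le: "absv (r i) \<le> M" if "i \<le> m" for i
    using absv_diff_le[OF le_M[OF that] less_imp_le[OF r(2)[of i]]] by simp
  have r_less: "absv (r i) < M" if "d < i" "i \<le> m" for i
    using absv_diff_less[OF d_max[OF that] r(2)[of i]] by simp
  have r_d: "absv (r d) = M"
    using absv_eq_of_close[of "r d" "coeff q d"] r(2)[of d] d(2) by (simp add: absv_minus_commute)
  then have r_d_nz: "r d \<noteq> 0"
    using M_pos by auto
  have \<alpha>_power: "absv (c * \<alpha> ^ i) \<le> absv c" for c i
    using assms(2) by (auto simp: absv_mult absv_power intro!: mult_left_le power_le_one)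
  have "absv (\<Sum>i\<le>m. (coeff q i - r i) * \<alpha> ^ i) < M"
    using r(2) \<alpha>_power by (intro absv_sum_less M_pos) (meson le_less_trans)
  moreover have "(\<Sum>i\<le>m. (coeff q i - r i) * \<alpha> ^ i) = - (\<Sum>i\<le>m. r i * \<alpha> ^ i)"
    using q(3) by (simp add: poly_altdef m_def left_diff_distrib sum_subtractf)
  ultimately have sum_less: "absv (\<Sum>i\<le>m. r i * \<alpha> ^ i) < M"
    by simp
  have high_less: "absv (\<Sum>i\<in>{d<..m}. r i * \<alpha> ^ i) < M"
    using r_less \<alpha>_power by (intro absv_sum_less M_pos) (auto intro: le_less_trans)
  have "{..m} = {..<d} \<union> ({d} \<union> {d<..m})"
    using d(1) by auto
  then have "(\<Sum>i\<le>m. r i * \<alpha> ^ i) =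
      (\<Sum>i<d. r i * \<alpha> ^ i) + (r d * \<alpha> ^ d + (\<Sum>i\<in>{d<..m}. r i * \<alpha> ^ i))"
    by (simp only:) (subst sum.union_disjoint; auto)+
  then have eq: "r d * \<alpha> ^ d + (\<Sum>i<d. r i * \<alpha> ^ i) =
      (\<Sum>i\<le>m. r i * \<alpha> ^ i) - (\<Sum>i\<in>{d<..m}. r i * \<alpha> ^ i)"
    by simp
  have low_less: "absv (r d * \<alpha> ^ d + (\<Sum>i<d. r i * \<alpha> ^ i)) < M"
    unfolding eq by (rule absv_diff_less[OF sum_less high_less])
  have "\<alpha> ^ d + (\<Sum>i<d. r i / r d * \<alpha> ^ i) = (r d * \<alpha> ^ d + (\<Sum>i<d. r i * \<alpha> ^ i)) / r d"
    using r_d_nz by (simp add: add_divide_distrib sum_divide_distrib)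
  then have monic: "absv (\<alpha> ^ d + (\<Sum>i<d. r i / r d * \<alpha> ^ i)) < 1"
    using low_less M_pos by (simp add: absv_divide r_d)
  have "\<exists>z. absv (r i / r d - of_int z) < 1" if "i < d" for i
  proof -
    have "absv (r i / r d) \<le> 1"
      using r_le[of i] that d(1) M_pos by (simp add: absv_divide r_d)
    moreover have "r i / r d \<in> \<rat>"
      using r(1) by (intro Rats_divide)
    ultimately show ?thesis
      using rational_integer_residue by metis
  qed
  then have "\<forall>i. \<exists>z. i < d \<longrightarrow> absv (r i / r d - of_int z) < 1"
    by blast
  then obtain z where z: "\<And>i. i < d \<Longrightarrow> absv (r i / r d - of_int (z i)) < 1"
    unfolding choice_iff by blast
  \<comment> \<open>\<open>T\<close> collects the elements congruent to integer combinations of the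
    first \<open>d\<close> powers of \<alpha>. It contains 1 and, by the monic relation, is stable
    under multiplication by \<alpha>; so all powers of \<alpha> lie in it.\<close>
  define T where "T = {x. \<exists>c. absv (x - (\<Sum>i<d. of_int (c i) * \<alpha> ^ i)) < 1}"
  have T_less: "x \<in> T" if "absv x < 1" for x
    using that by (auto simp: T_def intro: exI[of _ "\<lambda>_. 0"])
  have T_add: "x + y \<in> T" if "x \<in> T" "y \<in> T" for x y
  proof -
    from that obtain c c' where "absv (x - (\<Sum>i<d. of_int (c i) * \<alpha> ^ i)) < 1"
      "absv (y - (\<Sum>i<d. of_int (c' i) * \<alpha> ^ i)) < 1"
      by (auto simp: T_def)
    from absv_add_less[OF this] have "absv (x + y - (\<Sum>i<d. of_int (c i + c' i) * \<alpha> ^ i)) < 1"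
      by (simp add: distrib_right sum.distrib algebra_simps)
    then show ?thesis
      unfolding T_def by (intro CollectI exI[of _ "\<lambda>i. c i + c' i"])
  qed
  have T_mult: "of_int a * x \<in> T" if "x \<in> T" for a x
  proof -
    from that obtain c where "absv (x - (\<Sum>i<d. of_int (c i) * \<alpha> ^ i)) < 1"
      by (auto simp: T_def)
    then have "absv (of_int a * (x - (\<Sum>i<d. of_int (c i) * \<alpha> ^ i))) < 1"
      using absv_of_int_le_1[of a, where 'a='a] unfolding absv_mult
      by (intro order.strict_trans1[OF mult_left_le_one_le]) auto
    then have "absv (of_int a * x - (\<Sum>i<d. of_int (a * c i) * \<alpha> ^ i)) < 1"
      by (simp add: right_diff_distrib sum_distrib_left mult.assoc)
    then show ?thesis
      unfolding T_def by (intro CollectI exI[of _ "\<lambda>i. a * c i"])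
  qed
  have T_sum: "(\<Sum>i\<in>A. of_int (c i) * f i) \<in> T" if "\<And>i. i \<in> A \<Longrightarrow> f i \<in> T" for A :: "nat set" and c f
    using that by (induction A rule: infinite_finite_induct) (auto intro: T_add T_mult T_less)
  have T_basis: "\<alpha> ^ i \<in> T" if "i < d" for i
  proof -
    have "(\<Sum>j<d. of_int (if j = i then 1 else 0) * \<alpha> ^ j) = \<alpha> ^ i"
      using that by (simp add: if_distrib[of of_int] if_distrib[of "\<lambda>x. x * _"] cong: if_cong)
    then have "absv (\<alpha> ^ i - (\<Sum>j<d. of_int ((\<lambda>j. if j = i then 1 else 0) j) * \<alpha> ^ j)) < 1"
      by simp
    then show ?thesis
      unfolding T_def by (intro CollectI exI)
  qed
  have T_d: "\<alpha> ^ d \<in> T"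
  proof -
    have "absv (\<Sum>i<d. (r i / r d - of_int (z i)) * \<alpha> ^ i) < 1"
      using z \<alpha>_power by (intro absv_sum_less) (auto intro: le_less_trans)
    from absv_diff_less[OF monic this]
    have "absv (\<alpha> ^ d - (\<Sum>i<d. of_int (- z i) * \<alpha> ^ i)) < 1"
      by (simp add: left_diff_distrib sum_subtractf sum_negf)
    then show ?thesis
      unfolding T_def by (intro CollectI exI[of _ "\<lambda>i. - z i"])
  qed
  have T_shift: "\<alpha> * x \<in> T" if "x \<in> T" for x
  proof -
    from that obtain c where c: "absv (x - (\<Sum>i<d. of_int (c i) * \<alpha> ^ i)) < 1"
      by (auto simp: T_def)
    have "absv (\<alpha> * (x - (\<Sum>i<d. of_int (c i) * \<alpha> ^ i))) < 1"
      using c assms(2) unfolding absv_mult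
      by (intro order.strict_trans1[OF mult_left_le_one_le]) auto
    moreover have "\<alpha> ^ Suc i \<in> T" if "i < d" for i
      using T_basis[of "Suc i"] T_d that by (cases "Suc i = d") auto
    then have "(\<Sum>i<d. of_int (c i) * \<alpha> ^ Suc i) \<in> T"
      by (intro T_sum) auto
    ultimately have "\<alpha> * (x - (\<Sum>i<d. of_int (c i) * \<alpha> ^ i)) + (\<Sum>i<d. of_int (c i) * \<alpha> ^ Suc i) \<in> T"
      by (rule T_add[OF T_less])
    moreover have "(\<Sum>i<d. of_int (c i) * \<alpha> ^ Suc i) = \<alpha> * (\<Sum>i<d. of_int (c i) * \<alpha> ^ i)"
      by (simp add: sum_distrib_left mult_ac)
    ultimately show ?thesis
      by (simp add: right_diff_distrib)
  qed
  have "1 \<in> T"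
    using T_basis[of 0] T_d by (cases "d = 0") auto
  then have T_power: "\<alpha> ^ n \<in> T" for n
    by (induction n) (auto intro: T_shift)
  \<comment> \<open>Coefficients matter only modulo p, and extensional functions make the set of
    representatives finite, ready for the pigeonhole argument.\<close>
  define S where "S = {..<d} \<rightarrow>\<^sub>E {..<p}"
  have T_S: "\<exists>c\<in>S. absv (x - (\<Sum>i<d. of_nat (c i) * \<alpha> ^ i)) < 1" if "x \<in> T" for x
  proof -
    from that obtain c where c: "absv (x - (\<Sum>i<d. of_int (c i) * \<alpha> ^ i)) < 1"
      by (auto simp: T_def)
    define c' where "c' = restrict (\<lambda>i. nat (c i mod int p)) {..<d}"
    have "c' \<in> S"
      using p_gt_1 by (auto simp: S_def c'_def nat_less_iff)
    have "absv (\<Sum>i<d. (of_int (c i) - of_nat (c' i)) * \<alpha> ^ i) < 1"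
    proof (rule absv_sum_less)
      fix i assume "i \<in> {..<d}"
      then have "int (c' i) = c i mod int p"
        using p_gt_1 by (simp add: c'_def)
      then have "c i - int (c' i) = int p * (c i div int p)"
        by (simp add: minus_mod_eq_mult_div)
      then have "of_int (c i - int (c' i)) = (of_int (int p * (c i div int p)) :: 'a)"
        by simp
      then have "of_int (c i) - of_nat (c' i) = (of_nat p * of_int (c i div int p) :: 'a)"
        by simp
      moreover have "absv (of_nat p * of_int (c i div int p) :: 'a) < 1"
        using absv_of_int_le_1[of "c i div int p", where 'a='a] p_gt_1
        by (simp add: absv_mult absv_p divide_less_eq)
      ultimately show "absv ((of_int (c i) - of_nat (c' i)) * \<alpha> ^ i) < 1"
        using \<alpha>_power[of "of_int (c i) - of_nat (c' i)" i] by simp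
    qed simp
    from absv_add_less[OF c this] \<open>c' \<in> S\<close> show ?thesis
      by (intro bexI[of _ c']) (simp_all add: left_diff_distrib sum_subtractf)
  qed
  have "\<forall>n. \<exists>c. c \<in> S \<and> absv (\<alpha> ^ (p ^ n) - (\<Sum>i<d. of_nat (c i) * \<alpha> ^ i)) < 1"
    using T_S[OF T_power] by blast
  then obtain c where c: "\<And>n. c n \<in> S"
    "\<And>n. absv (\<alpha> ^ (p ^ n) - (\<Sum>i<d. of_nat (c n i) * \<alpha> ^ i)) < 1"
    unfolding choice_iff by blast
  have "finite S"
    by (auto simp: S_def intro: finite_PiE)
  then have "finite (range c)"
    using c(1) by (auto intro: finite_subset)
  then have "\<not> inj c"
    using finite_imageD by auto
  then obtain m n where "m < n" "c m = c n"
    unfolding inj_def by (metis linorder_neqE_nat)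
  from absv_diff_less[OF c(2)[of n] c(2)[of m]] this(2)
  have "absv (\<alpha> ^ (p ^ n) - \<alpha> ^ (p ^ m)) < 1"
    by simp
  \<comment> \<open>Both powers are p^m-th powers; cancelling these leaves n - m as a
    period.\<close>
  moreover have "\<alpha> ^ (p ^ n) = (\<alpha> ^ (p ^ (n - m))) ^ (p ^ m)"
    using \<open>m < n\<close> by (simp flip: power_mult power_add)
  ultimately have "absv ((\<alpha> ^ (p ^ (n - m))) ^ (p ^ m) - \<alpha> ^ (p ^ m)) < 1"
    by metis
  then have "absv (\<alpha> ^ (p ^ (n - m)) - \<alpha>) < 1"
    by (rule frobenius_power_cancel[rotated 2]) (simp_all add: assms(2) absv_power power_le_one)
  then show thesis
    using that[of "n - m"] \<open>m < n\<close> by simp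
qed

end

section \<open>Teichmueller representatives and the Iwasawa logarithm\<close>

locale padic_complex_field = padic_valued_field p K
  for p :: nat and K :: "'a::ultrametric_field itself" +
  fixes pw :: "rat \<Rightarrow> 'a"
  assumes algebraic_dense: "closure (padic_algebraic :: 'a set) = UNIV"
    and pw_add: "pw (r + r') = pw r * pw r'"
    and pw_1: "pw 1 = of_nat p"
begin

lemma pw_nonzero [simp]: "pw r \<noteq> 0"
  using pw_add[of r "1 - r"] pw_1 p_nonzero by auto

lemma pw_0 [simp]: "pw 0 = 1"
  using pw_add[of 0 0] by simp

lemma absv_pw: "absv (pw r) = real p powr (- of_rat r)"
proof -
  have "ln (absv (pw r)) = of_rat r * ln (absv (pw 1))"
    by (rule additive_rat_linear) (simp add: pw_add absv_mult ln_mult)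
  then have "ln (absv (pw r)) = - of_rat r * ln (real p)"
    using p_gt_1 by (simp add: pw_1 absv_p ln_div)
  then have "exp (ln (absv (pw r))) = real p powr (- of_rat r)"
    using p_gt_1 by (simp add: powr_def)
  then show ?thesis
    by simp
qed

lemma approx_algebraic:
  fixes x :: 'a
  assumes "0 < e"
  obtains \<alpha> where "\<alpha> \<in> padic_algebraic" "absv (\<alpha> - x) < e"
proof -
  have "x \<in> closure padic_algebraic"
    by (simp add: algebraic_dense)
  then show thesis
    using that assms unfolding closure_approachable dist_absv by blast
qed

lemma obtain_algebraic_close:
  fixes x :: 'a
  assumes "x \<noteq> 0"
  obtains \<alpha> where "\<alpha> \<in> padic_algebraic" "absv (\<alpha> - x) < absv x"
proof -
  have "0 < absv x"
    using assms by simp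
  then show thesis
    using that approx_algebraic by blast
qed

text \<open>An algebraic element closer to x than |x| has the same absolute value, so a rational
  exponent exists. It is unique because real powers of p are injective in the exponent, and hence
  the description in \<open>padic_val\<close> is met.\<close>

lemma absv_padic_val:
  fixes x :: 'a
  assumes "x \<noteq> 0"
  shows "absv x = real p powr (- of_rat (padic_val p x))"
proof -
  obtain \<alpha> where \<alpha>: "\<alpha> \<in> padic_algebraic" "absv (\<alpha> - x) < absv x"
    using obtain_algebraic_close[OF assms] .
  then have eq: "absv \<alpha> = absv x"
    by (intro absv_eq_of_close)
  with assms have "\<alpha> \<noteq> 0"
    by auto
  with \<alpha>(1) obtain r where "absv \<alpha> = real p powr of_rat r"
    using absv_algebraic_value by blast
  then have "absv x = real p powr (- of_rat (- r))"
    by (simp add: eq of_rat_minus)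
  moreover have "r' = s" if "absv x = real p powr (- of_rat r')" "absv x = real p powr (- of_rat s)" for r' s
  proof -
    have "- (of_rat r' :: real) = - of_rat s"
      using that p_gt_1 powr_inj[of "real p" "- of_rat r'" "- of_rat s"] by simp
    then show ?thesis
      by simp
  qed
  ultimately have "\<exists>!r. absv x = real p powr (- of_rat r)"
    by blast
  then show ?thesis
    unfolding padic_val_def by (rule theI')
qed

lemma padic_val_eqI:
  fixes x :: 'a
  assumes "absv x = real p powr (- of_rat r)"
  shows "padic_val p x = r"
proof -
  have "x \<noteq> 0"
    using assms p_gt_1 by auto
  then have "- (of_rat (padic_val p x) :: real) = - of_rat r"
    using absv_padic_val[of x] assms p_gt_1
      powr_inj[of "real p" "- of_rat (padic_val p x)" "- of_rat r"] by simp
  then show ?thesis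
    by simp
qed

definition unit_part :: "'a \<Rightarrow> 'a" where
  "unit_part x = x / pw (padic_val p x)"

lemma absv_pw_padic_val: "x \<noteq> 0 \<Longrightarrow> absv (pw (padic_val p x)) = absv x" for x :: 'a
  by (metis absv_pw absv_padic_val)

lemma absv_unit_part: "x \<noteq> 0 \<Longrightarrow> absv (unit_part x) = 1"
  by (simp add: unit_part_def absv_divide absv_pw_padic_val)

lemma padic_val_mult: "x \<noteq> 0 \<Longrightarrow> y \<noteq> 0 \<Longrightarrow> padic_val p (x * y) = padic_val p x + padic_val p y"
  for x y :: 'a
  by (intro padic_val_eqI)
    (simp add: absv_mult absv_padic_val of_rat_add powr_add[symmetric])

lemma unit_part_mult: "x \<noteq> 0 \<Longrightarrow> y \<noteq> 0 \<Longrightarrow> unit_part (x * y) = unit_part x * unit_part y"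
  by (simp add: unit_part_def padic_val_mult pw_add)

text \<open>The property depends only on the residue class of u, and that class contains an
  algebraic element.\<close>

lemma frobenius_periodic:
  fixes u :: 'a
  assumes "absv u = 1"
  obtains k where "k > 0" "absv (u ^ (p ^ k) - u) < 1"
proof -
  obtain \<alpha> where \<alpha>: "\<alpha> \<in> padic_algebraic" "absv (\<alpha> - u) < 1"
    using approx_algebraic[of 1 u] by auto
  have "absv \<alpha> = 1"
    using absv_eq_of_close[of \<alpha> u] \<alpha>(2) assms by simp
  then obtain k where k: "k > 0" "absv (\<alpha> ^ (p ^ k) - \<alpha>) < 1"
    using algebraic_frobenius_periodic[OF \<alpha>(1)] by auto
  have "max (1 / real p) (absv (\<alpha> - u)) ^ k \<le> 1"
    using \<alpha>(2) p_gt_1 by (intro power_le_one) (auto simp: le_max_iff_disj)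
  then have "max (1 / real p) (absv (\<alpha> - u)) ^ k * absv (\<alpha> - u) \<le> 1 * absv (\<alpha> - u)"
    by (intro mult_right_mono) auto
  then have "absv (\<alpha> ^ (p ^ k) - u ^ (p ^ k)) < 1"
    using frobenius_power_contraction[of \<alpha> u k] \<open>absv \<alpha> = 1\<close> assms \<alpha>(2) by simp
  then have "absv (u ^ (p ^ k) - \<alpha> ^ (p ^ k)) < 1"
    by (simp add: absv_minus_commute)
  from absv_diff_trans_less[OF absv_diff_trans_less[OF this k(2)] \<alpha>(2)] k(1) show thesis
    using that by blast
qed

text \<open>If k is a period of the residue class, the iterates of u under the p^k-th power converge
  to a fixed point. Every k divides n! for large n, which is why the exponents p^(n!) serve all u
  alike.\<close>

lemma teichmueller_limit:
  fixes u :: 'a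
  assumes u: "absv u = 1"
  obtains w m where "(\<lambda>n. u ^ (p ^ fact n)) \<longlonglongrightarrow> w" "absv (w - u) < 1" "m > 0" "w ^ m = 1"
proof -
  obtain k where k: "k > 0" "absv (u ^ (p ^ k) - u) < 1"
    using frobenius_periodic[OF u] .
  define W where "W j = u ^ (p ^ (k * j))" for j
  have abs_u: "absv (u ^ n) = 1" for n
    by (simp add: absv_power u)
  define \<kappa> where "\<kappa> = max (1 / real p) (absv (u ^ (p ^ k) - u))"
  have \<kappa>: "0 \<le> \<kappa>" "\<kappa> < 1"
    using k p_gt_1 by (auto simp: \<kappa>_def le_max_iff_disj)
  have W_Suc: "W (Suc j) = W j ^ (p ^ k)" for j
    by (simp add: W_def power_add mult_ac flip: power_mult)
  have step: "absv (W (Suc j) - W j) \<le> \<kappa> ^ (k * j) * absv (u ^ (p ^ k) - u)" for j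
  proof -
    have "W (Suc j) = (u ^ (p ^ k)) ^ (p ^ (k * j))"
      by (simp add: W_def power_add mult_ac flip: power_mult)
    then show ?thesis
      using frobenius_power_contraction[of "u ^ (p ^ k)" u "k * j"]
      by (simp add: W_def \<kappa>_def abs_u u)
  qed
  have "absv (W (Suc j) - W j) \<le> \<kappa> ^ j" for j
  proof -
    have "\<kappa> ^ (k * j) * absv (u ^ (p ^ k) - u) \<le> \<kappa> ^ j * 1"
      using \<kappa> k by (intro mult_mono power_decreasing) auto
    with step show ?thesis
      by (auto intro: order_trans)
  qed
  moreover have "(\<lambda>j. \<kappa> ^ j) \<longlonglongrightarrow> 0"
    using \<kappa> by (intro LIMSEQ_realpow_zero)
  ultimately have "(\<lambda>j. W (Suc j) - W j) \<longlonglongrightarrow> 0"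
    by (intro tendsto_0_absv_le[OF always_eventually]) auto
  then have "convergent W"
    by (rule Cauchy_ultrametric)
  then obtain w where w: "W \<longlonglongrightarrow> w"
    unfolding convergent_def ..
  have "absv (W j - u) < 1" for j
  proof (induction j)
    case (Suc j)
    have "\<kappa> ^ (k * j) * absv (u ^ (p ^ k) - u) \<le> 1 * absv (u ^ (p ^ k) - u)"
      using \<kappa> by (intro mult_right_mono power_le_one) auto
    with step[of j] have "absv (W (Suc j) - W j) < 1"
      using k(2) by linarith
    from absv_diff_trans_less[OF this Suc] show ?case .
  qed (simp add: W_def)
  then have "w \<in> {x. absv (x - u) < 1}"
    by (intro closed_sequentially[OF closed_absv_less _ w]) auto
  then have w_u: "absv (w - u) < 1"
    by simp
  have "fact n div k \<ge> Z" if "n \<ge> Z * k" for n Z :: nat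
  proof -
    have "Z = Z * k div k"
      using k(1) by simp
    also have "\<dots> \<le> fact n div k"
      using that fact_ge_self[of n] by (intro div_le_mono) linarith
    finally show ?thesis .
  qed
  then have "filterlim (\<lambda>n. fact n div k) sequentially sequentially"
    by (auto simp: filterlim_at_top eventually_at_top_linorder)
  from filterlim_compose[OF w this] have lim: "(\<lambda>n. W (fact n div k)) \<longlonglongrightarrow> w" .
  have "\<forall>\<^sub>F n in sequentially. W (fact n div k) = u ^ (p ^ fact n)"
    using eventually_ge_at_top[of k]
  proof eventually_elim
    case (elim n)
    then have "k dvd fact n"
      using k(1) by (intro dvd_fact) auto
    then show ?case
      by (simp add: W_def)
  qed
  from Lim_transform_eventually[OF lim this] have lim': "(\<lambda>n. u ^ (p ^ fact n)) \<longlonglongrightarrow> w" .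
  \<comment> \<open>Advancing j by one raises \<open>W j\<close> to the p^k-th power, so the limit
    is fixed by that power and is a root of unity of order dividing p^k - 1.\<close>
  have "(\<lambda>j. W j ^ (p ^ k)) \<longlonglongrightarrow> w ^ (p ^ k)"
    by (rule tendsto_power_strong[OF w tendsto_const])
  moreover have "(\<lambda>j. W j ^ (p ^ k)) \<longlonglongrightarrow> w"
    using LIMSEQ_Suc[OF w] by (simp add: W_Suc)
  ultimately have fix_w: "w ^ (p ^ k) = w"
    by (rule LIMSEQ_unique)
  have "absv w = 1"
    using absv_eq_of_close[of w u] w_u u by simp
  then have "w \<noteq> 0"
    by auto
  have "p ^ k > 1"
    using one_less_power[OF p_gt_1 k(1)] .
  then have "w ^ (p ^ k - 1) * w = w ^ (p ^ k)"
    by (intro power_minus_mult) linarith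
  with fix_w have "w ^ (p ^ k - 1) * w = 1 * w"
    by simp
  then have "w ^ (p ^ k - 1) = 1"
    using \<open>w \<noteq> 0\<close> by simp
  with lim' w_u \<open>p ^ k > 1\<close> show thesis
    using that[of w "p ^ k - 1"] by simp
qed

lemma teichmueller:
  assumes "x \<noteq> 0"
  shows teichmueller_LIMSEQ: "(\<lambda>n. unit_part x ^ (p ^ fact n)) \<longlonglongrightarrow> teichmueller p pw x"
    and teichmueller_close: "absv (teichmueller p pw x - unit_part x) < 1"
    and teichmueller_torsion: "\<exists>m>0. teichmueller p pw x ^ m = 1"
proof -
  obtain w m where w: "(\<lambda>n. unit_part x ^ (p ^ fact n)) \<longlonglongrightarrow> w" "absv (w - unit_part x) < 1"
    "m > 0" "w ^ m = 1"
    using teichmueller_limit[OF absv_unit_part[OF assms]] .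
  then have "teichmueller p pw x = w"
    unfolding teichmueller_def unit_part_def[symmetric] by (intro limI)
  with w show "(\<lambda>n. unit_part x ^ (p ^ fact n)) \<longlonglongrightarrow> teichmueller p pw x"
    "absv (teichmueller p pw x - unit_part x) < 1" "\<exists>m>0. teichmueller p pw x ^ m = 1"
    by auto
qed

lemma absv_teichmueller: "x \<noteq> 0 \<Longrightarrow> absv (teichmueller p pw x) = 1"
  using absv_eq_of_close[of "teichmueller p pw x" "unit_part x"] teichmueller_close[of x] absv_unit_part[of x]
  by simp

lemma teichmueller_mult:
  assumes "x \<noteq> 0" "y \<noteq> 0"
  shows "teichmueller p pw (x * y) = teichmueller p pw x * teichmueller p pw y"
proof -
  have "(\<lambda>n. unit_part (x * y) ^ (p ^ fact n)) \<longlonglongrightarrow> teichmueller p pw x * teichmueller p pw y"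
    unfolding unit_part_mult[OF assms] power_mult_distrib
    by (intro tendsto_mult teichmueller_LIMSEQ assms)
  moreover have "(\<lambda>n. unit_part (x * y) ^ (p ^ fact n)) \<longlonglongrightarrow> teichmueller p pw (x * y)"
    using assms by (intro teichmueller_LIMSEQ) auto
  ultimately show ?thesis
    using LIMSEQ_unique by metis
qed

lemma omega_v_nonzero:
  assumes "x \<noteq> 0"
  shows "omega_v p pw x \<noteq> 0"
proof -
  have "teichmueller p pw x \<noteq> 0"
    using absv_teichmueller[OF assms] by auto
  then show ?thesis
    by (simp add: omega_v_def)
qed

lemma absv_omega_v: "x \<noteq> 0 \<Longrightarrow> absv (omega_v p pw x) = absv x"
  by (simp add: omega_v_def absv_mult absv_teichmueller absv_pw_padic_val)

lemma omega_v_mult: "x \<noteq> 0 \<Longrightarrow> y \<noteq> 0 \<Longrightarrow> omega_v p pw (x * y) = omega_v p pw x * omega_v p pw y"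
  by (simp add: omega_v_def padic_val_mult pw_add teichmueller_mult)

lemma absv_angle_minus_1_less:
  assumes "x \<noteq> 0"
  shows "absv (angle p pw x - 1) < 1"
proof -
  define t where "t = teichmueller p pw x"
  have t: "absv t = 1" "t \<noteq> 0"
    using absv_teichmueller[OF assms] by (auto simp: t_def)
  have "angle p pw x - 1 = (unit_part x - t) / t"
    using t by (simp add: angle_def omega_v_def unit_part_def t_def diff_divide_distrib)
  then show ?thesis
    using teichmueller_close[OF assms] t by (simp add: absv_divide absv_minus_commute t_def)
qed

text \<open>The valuation of x is 0, and repeated p-th powers contract x towards 1, so both factors
  of \<open>omega_v\<close> are trivial.\<close>

lemma omega_v_1_unit:
  assumes "absv (x - 1) < 1"
  shows "omega_v p pw x = 1"
proof -
  have x: "absv x = 1"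
    using absv_eq_of_close[of x 1] assms by simp
  then have "x \<noteq> 0"
    by auto
  have "padic_val p x = 0"
    using p_gt_1 by (intro padic_val_eqI) (simp add: x)
  moreover have "teichmueller p pw x = 1"
  proof -
    have "(\<lambda>n. max (1 / real p) (absv (x - 1)) ^ fact n * absv (x - 1)) \<longlonglongrightarrow> 0 * absv (x - 1)"
    proof (rule tendsto_mult_right)
      have "(\<lambda>n. max (1 / real p) (absv (x - 1)) ^ n) \<longlonglongrightarrow> 0"
        using assms p_gt_1 by (intro LIMSEQ_realpow_zero) (auto simp: le_max_iff_disj)
      moreover have "filterlim (fact :: nat \<Rightarrow> nat) sequentially sequentially"
        using filterlim_at_top_mono[OF filterlim_ident always_eventually] fact_ge_self by blast
      ultimately show "(\<lambda>n. max (1 / real p) (absv (x - 1)) ^ fact n) \<longlonglongrightarrow> 0"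
        by (rule filterlim_compose)
    qed
    then have "(\<lambda>n. x ^ (p ^ fact n) - 1) \<longlonglongrightarrow> 0"
      using frobenius_power_contraction[of x 1] x
      by (intro tendsto_0_absv_le[OF always_eventually]) auto
    from tendsto_add[OF this tendsto_const[of 1]] have "(\<lambda>n. x ^ (p ^ fact n)) \<longlonglongrightarrow> 1"
      by simp
    moreover have "(\<lambda>n. x ^ (p ^ fact n)) \<longlonglongrightarrow> teichmueller p pw x"
      using teichmueller_LIMSEQ[OF \<open>x \<noteq> 0\<close>] by (simp add: unit_part_def \<open>padic_val p x = 0\<close>)
    ultimately show ?thesis
      using LIMSEQ_unique by metis
  qed
  ultimately show ?thesis
    by (simp add: omega_v_def)
qed

text \<open>By multiplicativity it suffices that \<open>omega_v\<close> is 1 at x / y, which is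
  close to 1.\<close>

lemma omega_v_cong:
  assumes "absv (x - y) < absv y"
  shows "omega_v p pw x = omega_v p pw y"
proof -
  have nz: "x \<noteq> 0" "y \<noteq> 0"
    using assms absv_eq_of_close[OF assms] by auto
  have "absv (x / y - 1) = absv ((x - y) / y)"
    using nz by (simp add: diff_divide_distrib)
  also have "\<dots> < 1"
    using assms nz by (simp add: absv_divide)
  finally have "omega_v p pw (x / y) = 1"
    by (rule omega_v_1_unit)
  then show ?thesis
    using omega_v_mult[of "x / y" y] nz by simp
qed

lemma omega_v_p: "omega_v p pw (of_nat p) = of_nat p"
proof -
  have val: "padic_val p (of_nat p :: 'a) = 1"
    using p_gt_1 by (intro padic_val_eqI) (simp add: absv_p powr_minus inverse_eq_divide)
  have "(\<lambda>n. unit_part (of_nat p) ^ (p ^ fact n)) \<longlonglongrightarrow> 1"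
    using p_nonzero by (simp add: unit_part_def val pw_1)
  then have "teichmueller p pw (of_nat p) = 1"
    using teichmueller_LIMSEQ[OF p_nonzero] LIMSEQ_unique by metis
  then show ?thesis
    by (simp add: omega_v_def val pw_1)
qed

lemma angle_mult: "x \<noteq> 0 \<Longrightarrow> y \<noteq> 0 \<Longrightarrow> angle p pw (x * y) = angle p pw x * angle p pw y"
  by (simp add: angle_def omega_v_mult)

lemma log1p_mult:
  fixes x y :: 'a
  assumes "absv (x - 1) < 1" "absv (y - 1) < 1"
  shows "log1p (x * y - 1) = log1p (x - 1) + log1p (y - 1)"
proof -
  have "x * y - 1 = (x - 1) + (y - 1) + (x - 1) * (y - 1)"
    by (simp add: algebra_simps)
  then show ?thesis
    using log1p_add[OF assms] by metis
qed

text \<open>Uniqueness of the Iwasawa logarithm: every \<open>x\<close> is the product of a power \<open>p\<^sup>r\<close>, a root of unity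
  and \<open>\<langle>x\<rangle>\<close>, and an additive function into a field of characteristic \<open>0\<close> kills the first two.\<close>

lemma iwasawa_log_eq:
  assumes "x \<noteq> 0"
  shows "iwasawa_log p x = log1p (angle p pw x - 1)"
proof -
  define Q where "Q L \<longleftrightarrow> (\<forall>x y. x \<noteq> 0 \<longrightarrow> y \<noteq> 0 \<longrightarrow> L (x * y) = L x + L y) \<and>
     (\<forall>x. absv (x - 1) < 1 \<longrightarrow>
        (\<lambda>n. (- 1) ^ n * (x - 1) ^ Suc n / of_nat (Suc n)) sums L x) \<and>
     L (of_nat p) = 0 \<and> L 0 = 0" for L :: "'a \<Rightarrow> 'a"
  define L0 where "L0 x = (if x = 0 then 0 else log1p (angle p pw x - 1))" for x
  have "Q L0"
    unfolding Q_def
  proof (intro conjI allI impI)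
    fix x y :: 'a assume "x \<noteq> 0" "y \<noteq> 0"
    then show "L0 (x * y) = L0 x + L0 y"
      by (simp add: L0_def angle_mult log1p_mult absv_angle_minus_1_less)
  next
    fix x :: 'a assume x: "absv (x - 1) < 1"
    then have "x \<noteq> 0"
      by auto
    then show "(\<lambda>n. (- 1) ^ n * (x - 1) ^ Suc n / of_nat (Suc n)) sums L0 x"
      using log1p_sums[OF x] omega_v_1_unit[OF x] by (simp add: L0_def angle_def)
  next
    show "L0 (of_nat p) = 0" "L0 0 = 0"
      using p_nonzero by (simp_all add: L0_def angle_def omega_v_p)
  qed
  have unique: "L = L0" if "Q L" for L
  proof
    fix x :: 'a
    have mult: "L (x * y) = L x + L y" if "x \<noteq> 0" "y \<noteq> 0" for x y
      using \<open>Q L\<close> that unfolding Q_def by blast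
    have L_p: "L (of_nat p) = 0" and L_0: "L 0 = 0"
      using \<open>Q L\<close> unfolding Q_def by auto
    have L_series: "L y = log1p (y - 1)" if "absv (y - 1) < 1" for y
    proof -
      from \<open>Q L\<close> that have "(\<lambda>n. (- 1) ^ n * (y - 1) ^ Suc n / of_nat (Suc n)) sums L y"
        unfolding Q_def by blast
      then show ?thesis
        using log1p_sums[OF that] sums_unique2 by blast
    qed
    have L_1: "L 1 = 0"
      using mult[of 1 1] by simp
    have L_power: "L (y ^ n) = of_nat n * L y" if "y \<noteq> 0" for y n
      using that by (induction n) (simp_all add: L_1 mult algebra_simps)
    show "L x = L0 x"
    proof (cases "x = 0")
      case False
      define t where "t = teichmueller p pw x"
      define r where "r = padic_val p x"
      have t: "t \<noteq> 0"
        using absv_teichmueller[OF False] by (auto simp: t_def)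
      have "L (pw r) = of_rat r * L (pw 1)"
        by (rule additive_rat_linear) (simp add: pw_add mult)
      then have L_pw: "L (pw r) = 0"
        by (simp add: pw_1 L_p)
      obtain m where m: "m > 0" "t ^ m = 1"
        using teichmueller_torsion[OF False] by (auto simp: t_def)
      then have "of_nat m * L t = 0"
        using L_power[OF t, of m] L_1 by simp
      then have L_t: "L t = 0"
        using m(1) by simp
      have \<omega>: "omega_v p pw x = pw r * t"
        by (simp add: omega_v_def r_def t_def)
      have "angle p pw x \<noteq> 0"
        using False omega_v_nonzero[OF False] by (simp add: angle_def)
      moreover have "x = pw r * t * angle p pw x"
        using t by (simp add: angle_def \<omega>)
      ultimately have "L x = L (angle p pw x)"
        using mult[of "pw r * t" "angle p pw x"] mult[of "pw r" t] t L_pw L_t by simp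
      then show ?thesis
        using False L_series[OF absv_angle_minus_1_less[OF False]] by (simp add: L0_def)
    qed (simp add: L_0 L0_def)
  qed
  have "iwasawa_log p = (THE L. Q L)"
    unfolding iwasawa_log_def Q_def ..
  also have "\<dots> = L0"
    using \<open>Q L0\<close> unique by (rule the_equality)
  finally show ?thesis
    using assms by (simp add: L0_def)
qed

end

section \<open>Generalized distributions\<close>

lemma in_ball_absv: "z \<in> ball a r \<longleftrightarrow> absv (z - a) < r" for a :: "'a::ultrametric_field"
  by (simp add: dist_absv absv_minus_commute)

text \<open>Points at distance below R lie in the same balls of radius R.\<close>

lemma ball_mem_cong:
  fixes z a c :: "'a::ultrametric_field"
  assumes "z \<in> ball a r" "r \<le> R"
  shows "z \<in> ball c R \<longleftrightarrow> a \<in> ball c R"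
proof -
  have "absv (z - a) < R" "absv (a - z) < R"
    using assms unfolding in_ball_absv by (simp_all add: absv_minus_commute[of a z])
  from absv_diff_trans_less[OF this(1)] absv_diff_trans_less[OF this(2)] show ?thesis
    unfolding in_ball_absv by blast
qed

lemma closed_ball_ultrametric: "0 < R \<Longrightarrow> closed (ball c R)" for c :: "'a::ultrametric_field"
proof -
  assume "0 < R"
  moreover have "ball c R = {x. absv (x - c) < R}"
    by (intro set_eqI) (simp only: in_ball_absv mem_Collect_eq)
  ultimately show ?thesis
    by (simp add: closed_absv_less)
qed

lemma clopen_in_ball: "0 < R \<Longrightarrow> clopen_in \<sigma> (\<sigma> \<inter> ball c R)" for c :: "'a::ultrametric_field"
  unfolding clopen_in_def by (simp add: openin_open_Int closedin_closed_Int closed_ball_ultrametric)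

lemma disc_nbhd_iff: "z \<in> disc_nbhd \<sigma> r \<longleftrightarrow> (\<exists>a\<in>\<sigma>. z \<in> ball a r)"
  by (auto simp: disc_nbhd_def)

lemma disc_nbhd_mono: "\<sigma> \<subseteq> \<tau> \<Longrightarrow> r \<le> s \<Longrightarrow> disc_nbhd \<sigma> r \<subseteq> disc_nbhd \<tau> s"
  unfolding disc_nbhd_def by (intro UN_mono subset_ball)

lemma analytic_spaceI:
  assumes "\<And>a. a \<in> \<sigma> \<Longrightarrow> \<exists>c :: nat \<Rightarrow> 'a::ultrametric_field. \<forall>z\<in>ball a r. (\<lambda>n. c n * (z - a) ^ n) sums f z"
    and "\<And>z. z \<in> disc_nbhd \<sigma> r \<Longrightarrow> absv (f z) \<le> B"
  shows "f \<in> analytic_space \<sigma> r"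
  using assms unfolding analytic_space_def bdd_above_def by blast

lemma analytic_space_bounded:
  assumes "f \<in> analytic_space \<sigma> r"
  obtains B where "\<And>z. z \<in> disc_nbhd \<sigma> r \<Longrightarrow> absv (f z) \<le> B"
  using assms unfolding analytic_space_def bdd_above_def by blast

lemma analytic_space_mono:
  assumes "f \<in> analytic_space \<tau> s" "\<sigma> \<subseteq> \<tau>" "r \<le> s"
  shows "f \<in> analytic_space \<sigma> r"
proof -
  obtain B where B: "\<And>z. z \<in> disc_nbhd \<tau> s \<Longrightarrow> absv (f z) \<le> B"
    using analytic_space_bounded[OF assms(1)] by blast
  show ?thesis
  proof (rule analytic_spaceI)
    fix a assume "a \<in> \<sigma>"
    with assms obtain c where "\<forall>z\<in>ball a s. (\<lambda>n. c n * (z - a) ^ n) sums f z"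
      unfolding analytic_space_def by blast
    with assms(3) show "\<exists>c. \<forall>z\<in>ball a r. (\<lambda>n. c n * (z - a) ^ n) sums f z"
      by (intro exI[of _ c]) auto
  next
    fix z assume "z \<in> disc_nbhd \<sigma> r"
    then show "absv (f z) \<le> B"
      using disc_nbhd_mono[OF assms(2,3)] B by blast
  qed
qed

lemma analytic_space_add:
  assumes "f \<in> analytic_space \<sigma> r" "g \<in> analytic_space \<sigma> r"
  shows "(\<lambda>z. f z + g z) \<in> analytic_space \<sigma> r"
proof -
  obtain B where B: "\<And>z. z \<in> disc_nbhd \<sigma> r \<Longrightarrow> absv (f z) \<le> B"
    using analytic_space_bounded[OF assms(1)] by blast
  obtain C where C: "\<And>z. z \<in> disc_nbhd \<sigma> r \<Longrightarrow> absv (g z) \<le> C"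
    using analytic_space_bounded[OF assms(2)] by blast
  show ?thesis
  proof (rule analytic_spaceI)
    fix a assume "a \<in> \<sigma>"
    with assms obtain c d where "\<And>z. z \<in> ball a r \<Longrightarrow> (\<lambda>n. c n * (z - a) ^ n) sums f z"
      "\<And>z. z \<in> ball a r \<Longrightarrow> (\<lambda>n. d n * (z - a) ^ n) sums g z"
      unfolding analytic_space_def by blast
    then have "\<forall>z\<in>ball a r. (\<lambda>n. (c n + d n) * (z - a) ^ n) sums (f z + g z)"
      by (auto simp: distrib_right intro: sums_add)
    then show "\<exists>c. \<forall>z\<in>ball a r. (\<lambda>n. c n * (z - a) ^ n) sums (f z + g z)"
      by (intro exI[of _ "\<lambda>n. c n + d n"])
  next
    fix z assume "z \<in> disc_nbhd \<sigma> r"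
    from B[OF this] C[OF this] show "absv (f z + g z) \<le> max B C"
      by (intro absv_add_le) auto
  qed
qed

lemma analytic_space_cmult:
  assumes "f \<in> analytic_space \<sigma> r"
  shows "(\<lambda>z. k * f z) \<in> analytic_space \<sigma> r"
proof -
  obtain B where B: "\<And>z. z \<in> disc_nbhd \<sigma> r \<Longrightarrow> absv (f z) \<le> B"
    using analytic_space_bounded[OF assms(1)] by blast
  show ?thesis
  proof (rule analytic_spaceI)
    fix a assume "a \<in> \<sigma>"
    with assms obtain c where "\<And>z. z \<in> ball a r \<Longrightarrow> (\<lambda>n. c n * (z - a) ^ n) sums f z"
      unfolding analytic_space_def by blast
    then have "\<forall>z\<in>ball a r. (\<lambda>n. (k * c n) * (z - a) ^ n) sums (k * f z)"
      by (auto simp: mult.assoc intro: sums_cmult)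
    then show "\<exists>c. \<forall>z\<in>ball a r. (\<lambda>n. c n * (z - a) ^ n) sums (k * f z)"
      by (intro exI[of _ "\<lambda>n. k * c n"])
  next
    fix z assume "z \<in> disc_nbhd \<sigma> r"
    from B[OF this] show "absv (k * f z) \<le> absv k * B"
      by (simp add: absv_mult mult_left_mono)
  qed
qed

lemma analytic_space_diff:
  assumes "f \<in> analytic_space \<sigma> r" "g \<in> analytic_space \<sigma> r"
  shows "(\<lambda>z. f z - g z) \<in> analytic_space \<sigma> r"
  using analytic_space_add[OF assms(1) analytic_space_cmult[OF assms(2), of "- 1"]] by simp

lemma analytic_space_0: "(\<lambda>_. 0) \<in> analytic_space \<sigma> r"
  by (rule analytic_spaceI[where B = 0]) (auto intro: exI[of _ "\<lambda>_. 0"])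

text \<open>Boundedness of \<sigma> makes the norm finite; the bound on the values follows Horner's
  scheme.\<close>

lemma analytic_space_poly:
  assumes "bounded \<sigma>"
  shows "poly q \<in> analytic_space \<sigma> r"
proof -
  obtain e where e: "\<And>y. y \<in> \<sigma> \<Longrightarrow> dist 0 y \<le> e"
    using assms unfolding bounded_any_center[of \<sigma> 0] by blast
  define B where "B = max e r"
  have z: "absv z \<le> B" if nbhd: "z \<in> disc_nbhd \<sigma> r" for z
  proof -
    obtain a where "a \<in> \<sigma>" "absv (z - a) < r"
      using nbhd unfolding disc_nbhd_iff in_ball_absv by blast
    with e[of a] absv_add_le[of "z - a" B a] show ?thesis
      by (auto simp: dist_absv B_def)
  qed
  have "\<exists>C. \<forall>z. absv z \<le> B \<longrightarrow> absv (poly q z) \<le> C"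
  proof (induction q)
    case (pCons a q)
    then obtain C where C: "\<And>z. absv z \<le> B \<Longrightarrow> absv (poly q z) \<le> C"
      by blast
    have "absv (a + z * poly q z) \<le> max (absv a) (B * C)" if "absv z \<le> B" for z
      using mult_mono[OF that C[OF that]] order_trans[OF absv_nonneg that]
      by (intro absv_add_le) (auto simp: absv_mult)
    then show ?case
      by auto
  qed auto
  then obtain C where C: "\<And>z. absv z \<le> B \<Longrightarrow> absv (poly q z) \<le> C"
    by blast
  show ?thesis
  proof (rule analytic_spaceI)
    fix a assume "a \<in> \<sigma>"
    \<comment> \<open>This is q(X + a), whose coefficients are the Taylor coefficients at a.\<close>
    define q' where "q' = pcompose q [:a, 1:]"
    have "(\<lambda>n. coeff q' n * (z - a) ^ n) sums poly q z" for z
    proof -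
      have "(\<lambda>n. coeff q' n * (z - a) ^ n) sums (\<Sum>n\<le>degree q'. coeff q' n * (z - a) ^ n)"
        by (intro sums_finite) (auto simp: coeff_eq_0)
      also have "(\<Sum>n\<le>degree q'. coeff q' n * (z - a) ^ n) = poly q z"
        by (simp flip: poly_altdef) (simp add: q'_def poly_pcompose)
      finally show ?thesis .
    qed
    then show "\<exists>c. \<forall>z\<in>ball a r. (\<lambda>n. c n * (z - a) ^ n) sums poly q z"
      by blast
  qed (use C z in blast)
qed

lemma locally_analyticI: "f \<in> analytic_space \<sigma> r \<Longrightarrow> 0 < r \<Longrightarrow> f \<in> locally_analytic \<sigma>"
  by (auto simp: locally_analytic_def)

lemma locally_analyticE:
  assumes "f \<in> locally_analytic \<sigma>"
  obtains r where "0 < r" "f \<in> analytic_space \<sigma> r"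
  using assms by (auto simp: locally_analytic_def)

lemma locally_analytic_cmult: "f \<in> locally_analytic \<sigma> \<Longrightarrow> (\<lambda>z. k * f z) \<in> locally_analytic \<sigma>"
  by (auto elim!: locally_analyticE intro: locally_analyticI analytic_space_cmult)

lemma locally_analytic_add:
  assumes "f \<in> locally_analytic \<sigma>" "g \<in> locally_analytic \<sigma>"
  shows "(\<lambda>z. f z + g z) \<in> locally_analytic \<sigma>"
proof -
  obtain r where r: "0 < r" "f \<in> analytic_space \<sigma> r"
    using assms(1) by (rule locally_analyticE)
  obtain s where s: "0 < s" "g \<in> analytic_space \<sigma> s"
    using assms(2) by (rule locally_analyticE)
  from r s show ?thesis
    by (intro locally_analyticI[of _ _ "min r s"] analytic_space_add) (auto intro: analytic_space_mono)
qed

lemma locally_analytic_diff: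
  assumes "f \<in> locally_analytic \<sigma>" "g \<in> locally_analytic \<sigma>"
  shows "(\<lambda>z. f z - g z) \<in> locally_analytic \<sigma>"
  using locally_analytic_add[OF assms(1) locally_analytic_cmult[OF assms(2), of "- 1"]] by simp

text \<open>For \<open>r \<le> R\<close> a ball of radius \<open>r\<close> is contained in a given ball of radius \<open>R\<close> or disjoint from it,
  so truncation to the latter preserves analyticity.\<close>

definition cut_ball :: "'a::ultrametric_field \<Rightarrow> real \<Rightarrow> ('a \<Rightarrow> 'a) \<Rightarrow> 'a \<Rightarrow> 'a" where
  "cut_ball c R f = (\<lambda>z. if z \<in> ball c R then f z else 0)"

lemma cut_ball_inside: "z \<in> ball a r \<Longrightarrow> r \<le> R \<Longrightarrow> a \<in> ball c R \<Longrightarrow> cut_ball c R f z = f z"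
  unfolding cut_ball_def using ball_mem_cong by metis

lemma cut_ball_outside: "z \<in> ball a r \<Longrightarrow> r \<le> R \<Longrightarrow> a \<notin> ball c R \<Longrightarrow> cut_ball c R f z = 0"
  unfolding cut_ball_def using ball_mem_cong by metis

lemma cut_ball_disc_nbhd:
  "z \<in> disc_nbhd (\<sigma> \<inter> ball c R) r \<Longrightarrow> r \<le> R \<Longrightarrow> cut_ball c R f z = f z"
  unfolding disc_nbhd_iff using cut_ball_inside by blast

lemma absv_cut_ball_le:
  assumes "r \<le> R" "0 \<le> B" "\<And>z. z \<in> disc_nbhd (\<sigma> \<inter> ball c R) r \<Longrightarrow> absv (f z) \<le> B"
    and "z \<in> disc_nbhd \<sigma> r"
  shows "absv (cut_ball c R f z) \<le> B"
proof -
  obtain a where a: "a \<in> \<sigma>" "z \<in> ball a r"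
    using assms(4) unfolding disc_nbhd_iff by blast
  show ?thesis
  proof (cases "a \<in> ball c R")
    case True
    then have "z \<in> disc_nbhd (\<sigma> \<inter> ball c R) r"
      unfolding disc_nbhd_iff using a by blast
    then show ?thesis
      using assms(3) cut_ball_disc_nbhd[OF _ assms(1), of z \<sigma> c f] by simp
  qed (use cut_ball_outside[OF a(2) assms(1)] assms(2) in simp)
qed

lemma analytic_space_cut_ball:
  assumes "f \<in> analytic_space (\<sigma> \<inter> ball c R) r" "r \<le> R"
  shows "cut_ball c R f \<in> analytic_space \<sigma> r"
proof -
  obtain B where B: "\<And>z. z \<in> disc_nbhd (\<sigma> \<inter> ball c R) r \<Longrightarrow> absv (f z) \<le> B"
    using analytic_space_bounded[OF assms(1)] by blast
  show ?thesis
  proof (rule analytic_spaceI)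
    fix a assume a: "a \<in> \<sigma>"
    show "\<exists>d. \<forall>z\<in>ball a r. (\<lambda>n. d n * (z - a) ^ n) sums cut_ball c R f z"
    proof (cases "a \<in> ball c R")
      case True
      with a assms(1) obtain d where "\<forall>z\<in>ball a r. (\<lambda>n. d n * (z - a) ^ n) sums f z"
        unfolding analytic_space_def by blast
      then show ?thesis
        using cut_ball_inside[OF _ assms(2) True, where f = f] by metis
    next
      case False
      have "\<forall>z\<in>ball a r. (\<lambda>n. 0 * (z - a) ^ n) sums cut_ball c R f z"
        using cut_ball_outside[OF _ assms(2) False, where f = f] by simp
      then show ?thesis
        by (intro exI[of _ "\<lambda>_. 0"])
    qed
  next
    fix z assume "z \<in> disc_nbhd \<sigma> r"
    then show "absv (cut_ball c R f z) \<le> max 0 B"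
      using B by (intro absv_cut_ball_le[OF assms(2)]) (auto simp: le_max_iff_disj)
  qed
qed

lemma locally_analytic_cut_ball:
  assumes "f \<in> locally_analytic \<sigma>" "0 < R"
  shows "cut_ball c R f \<in> locally_analytic \<sigma>"
proof -
  obtain r where r: "0 < r" "f \<in> analytic_space \<sigma> r"
    using assms(1) by (rule locally_analyticE)
  then have "f \<in> analytic_space (\<sigma> \<inter> ball c R) (min r R)"
    by (intro analytic_space_mono[OF r(2)]) auto
  then have "cut_ball c R f \<in> analytic_space \<sigma> (min r R)"
    by (rule analytic_space_cut_ball) simp
  then show ?thesis
    by (rule locally_analyticI) (simp add: r(1) assms(2))
qed

section \<open>Continuity and locality of a distribution\<close>

locale distribution =
  fixes \<sigma> :: "'a::ultrametric_field set" and \<mu> :: "('a \<Rightarrow> 'a) \<Rightarrow> 'a"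
  assumes compact_\<sigma>: "compact \<sigma>"
    and distribution: "generalized_distribution \<sigma> \<mu>"
begin

lemma \<mu>_add: "f \<in> locally_analytic \<sigma> \<Longrightarrow> g \<in> locally_analytic \<sigma> \<Longrightarrow> \<mu> (\<lambda>z. f z + g z) = \<mu> f + \<mu> g"
  using distribution by (simp add: generalized_distribution_def)

lemma \<mu>_cmult: "f \<in> locally_analytic \<sigma> \<Longrightarrow> \<mu> (\<lambda>z. c * f z) = c * \<mu> f"
  using distribution by (simp add: generalized_distribution_def)

lemma zero_locally_analytic: "(\<lambda>_. 0) \<in> locally_analytic \<sigma>"
  using analytic_space_0 by (rule locally_analyticI[of _ _ 1]) simp

lemma \<mu>_0: "\<mu> (\<lambda>_. 0) = 0"
  using \<mu>_cmult[OF zero_locally_analytic, of 0] by simp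

lemma \<mu>_diff:
  assumes "f \<in> locally_analytic \<sigma>" "g \<in> locally_analytic \<sigma>"
  shows "\<mu> (\<lambda>z. f z - g z) = \<mu> f - \<mu> g"
  using \<mu>_add[OF assms(1) locally_analytic_cmult[OF assms(2), of "- 1"]] \<mu>_cmult[OF assms(2), of "- 1"]
  by simp

text \<open>Continuity at 0, read on one step of the inductive limit: the preimage of a disc is
  open, so its trace on \<open>analytic_space \<sigma> r\<close> contains a ball around 0 for the
  norm.\<close>

lemma \<mu>_small:
  assumes "0 < r" "0 < e"
  obtains d where "0 < d"
    "\<And>g. g \<in> analytic_space \<sigma> r \<Longrightarrow> (\<And>z. z \<in> disc_nbhd \<sigma> r \<Longrightarrow> absv (g z) \<le> d) \<Longrightarrow> absv (\<mu> g) < e"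
proof -
  define S where "S = {f \<in> locally_analytic \<sigma>. \<mu> f \<in> ball 0 e}"
  have "open_locally_analytic \<sigma> S"
    using distribution openin_continuous_map_preimage[of "locally_analytic_topology \<sigma>" euclidean \<mu> "ball 0 e"]
    by (simp add: S_def generalized_distribution_def topspace_locally_analytic_topology
        flip: openin_locally_analytic_topology)
  moreover have "(\<lambda>_. 0) \<in> S \<inter> analytic_space \<sigma> r"
    using assms by (simp add: S_def \<mu>_0 zero_locally_analytic analytic_space_0)
  ultimately obtain d where d: "0 < d"
    "\<And>g. g \<in> analytic_space \<sigma> r \<Longrightarrow> analytic_norm \<sigma> r (\<lambda>z. g z - 0) < d \<Longrightarrow> g \<in> S"
    using open_locally_analyticD[OF _ assms(1)] by blast
  have "absv (\<mu> g) < e"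
    if g: "g \<in> analytic_space \<sigma> r" "\<And>z. z \<in> disc_nbhd \<sigma> r \<Longrightarrow> absv (g z) \<le> d / 2" for g
  proof -
    \<comment> \<open>The halved bound keeps the supremum strictly below \<open>d\<close>.\<close>
    have "analytic_norm \<sigma> r g \<le> d / 2"
      unfolding analytic_norm_def using g(2) d(1) by (intro cSup_least) auto
    then have "g \<in> S"
      using d(1) by (intro d(2) g(1)) simp
    then show ?thesis
      by (simp add: S_def dist_absv)
  qed
  with d(1) show thesis
    using that[of "d / 2"] by simp
qed

lemma \<mu>_tendsto_0:
  assumes "0 < r" "\<And>n. g n \<in> analytic_space \<sigma> r"
    and "\<And>n z. z \<in> disc_nbhd \<sigma> r \<Longrightarrow> absv (g n z) \<le> B n" "B \<longlonglongrightarrow> (0 :: real)"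
  shows "(\<lambda>n. \<mu> (g n)) \<longlonglongrightarrow> 0"
proof (rule tendstoI)
  fix e :: real assume "0 < e"
  obtain d where d: "0 < d"
    "\<And>g. g \<in> analytic_space \<sigma> r \<Longrightarrow> (\<And>z. z \<in> disc_nbhd \<sigma> r \<Longrightarrow> absv (g z) \<le> d) \<Longrightarrow> absv (\<mu> g) < e"
    using \<mu>_small[OF assms(1) \<open>0 < e\<close>] by blast
  from order_tendstoD(2)[OF assms(4) d(1)]
  show "\<forall>\<^sub>F n in sequentially. dist (\<mu> (g n)) 0 < e"
  proof eventually_elim
    case (elim n)
    have "absv (g n z) \<le> d" if "z \<in> disc_nbhd \<sigma> r" for z
      using assms(3)[OF that, of n] elim by simp
    then have "absv (\<mu> (g n)) < e"
      using assms(2) by (intro d(2))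
    then show ?case
      by (simp add: dist_absv)
  qed
qed

text \<open>On a small enough neighbourhood the norm of f is 0, so continuity applies to the
  constant sequence f: the distribution sees only the germ.\<close>

lemma \<mu>_eq_0:
  assumes "f \<in> locally_analytic \<sigma>" "0 < r" "\<And>z. z \<in> disc_nbhd \<sigma> r \<Longrightarrow> f z = 0"
  shows "\<mu> f = 0"
proof -
  obtain s where s: "0 < s" "f \<in> analytic_space \<sigma> s"
    using assms(1) by (rule locally_analyticE)
  define t where "t = min r s"
  have t: "0 < t" "f \<in> analytic_space \<sigma> t"
    using s assms(2) by (auto simp: t_def intro: analytic_space_mono)
  have "f z = 0" if "z \<in> disc_nbhd \<sigma> t" for z
    using assms(3) disc_nbhd_mono[of \<sigma> \<sigma> t r] that by (auto simp: t_def)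
  then have "(\<lambda>n::nat. \<mu> f) \<longlonglongrightarrow> 0"
    using t by (intro \<mu>_tendsto_0[where r = t and B = "\<lambda>_. 0"]) auto
  then show ?thesis
    by (simp add: LIMSEQ_const_iff)
qed

text \<open>Peel off one ball. The part of f on it is killed by hypothesis, and the rest of f
  vanishes there, hence is supported in the other balls. Overlaps do no harm.\<close>

lemma \<mu>_vanishing_balls:
  assumes "finite F"
    and "\<And>x. x \<in> F \<Longrightarrow> 0 < \<rho> x \<and> (\<exists>U. vanishes_on \<sigma> \<mu> U \<and> \<sigma> \<inter> ball x (\<rho> x) \<subseteq> U)"
    and "f \<in> locally_analytic \<sigma>" "supported_in \<sigma> f (\<sigma> \<inter> (\<Union>x\<in>F. ball x (\<rho> x)))"
  shows "\<mu> f = 0"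
  using assms
proof (induction F arbitrary: f rule: finite_induct)
  case empty
  then show ?case
    by (auto simp: supported_in_def intro: \<mu>_eq_0)
next
  case (insert x F)
  define B where "B = ball x (\<rho> x)"
  define f1 where "f1 = cut_ball x (\<rho> x) f"
  obtain U where U: "0 < \<rho> x" "vanishes_on \<sigma> \<mu> U" "\<sigma> \<inter> B \<subseteq> U"
    using insert.prems(1)[of x] by (auto simp: B_def)
  have f1: "f1 \<in> locally_analytic \<sigma>"
    unfolding f1_def by (intro locally_analytic_cut_ball insert.prems U(1))
  have "supported_in \<sigma> f1 (\<sigma> \<inter> B)"
    unfolding supported_in_def
  proof (intro exI[of _ "\<rho> x"] conjI ballI U(1))
    fix z assume "z \<in> disc_nbhd (\<sigma> - \<sigma> \<inter> B) (\<rho> x)"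
    then obtain a where "a \<notin> B" "z \<in> ball a (\<rho> x)"
      by (auto simp: disc_nbhd_iff)
    then show "f1 z = 0"
      unfolding f1_def B_def using cut_ball_outside by blast
  qed
  moreover have "clopen_in \<sigma> (\<sigma> \<inter> B)"
    unfolding B_def using U(1) by (rule clopen_in_ball)
  ultimately have 1: "\<mu> f1 = 0"
    using U f1 unfolding vanishes_on_def by blast
  obtain r where r: "0 < r" "\<And>z. z \<in> disc_nbhd (\<sigma> - \<sigma> \<inter> (\<Union>x\<in>insert x F. ball x (\<rho> x))) r \<Longrightarrow> f z = 0"
    using insert.prems(3) unfolding supported_in_def by blast
  have "supported_in \<sigma> (\<lambda>z. f z - f1 z) (\<sigma> \<inter> (\<Union>x\<in>F. ball x (\<rho> x)))"
    unfolding supported_in_def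
  proof (intro exI[of _ "min r (\<rho> x)"] conjI ballI)
    fix z assume "z \<in> disc_nbhd (\<sigma> - \<sigma> \<inter> (\<Union>x\<in>F. ball x (\<rho> x))) (min r (\<rho> x))"
    then obtain a where a: "a \<in> \<sigma>" "a \<notin> (\<Union>x\<in>F. ball x (\<rho> x))" "z \<in> ball a (min r (\<rho> x))"
      unfolding disc_nbhd_iff by blast
    have zB: "z \<in> B \<longleftrightarrow> a \<in> B"
      unfolding B_def using a(3) by (rule ball_mem_cong) simp
    show "f z - f1 z = 0"
    proof (cases "a \<in> B")
      case True
      then show ?thesis
        using zB by (simp add: f1_def cut_ball_def B_def)
    next
      case False
      then have "a \<in> \<sigma> - \<sigma> \<inter> (\<Union>x\<in>insert x F. ball x (\<rho> x))"
        using a(1,2) by (auto simp: B_def)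
      moreover have "z \<in> ball a r"
        using a(3) by simp
      ultimately have "f z = 0"
        by (intro r(2)) (auto simp: disc_nbhd_iff)
      then show ?thesis
        by (simp add: f1_def cut_ball_def)
    qed
  qed (use r(1) U(1) in simp)
  then have "\<mu> (\<lambda>z. f z - f1 z) = 0"
    by (intro insert.IH insert.prems(1) locally_analytic_diff insert.prems(2) f1) auto
  then show ?case
    using 1 \<mu>_diff[OF insert.prems(2) f1] by simp
qed

text \<open>The support is defined by vanishing on each open set separately; that vanishing extends
  over their union has to be proved. Compactness of V reduces it to finitely many balls, each
  meeting \<sigma> inside one such open set.\<close>

lemma \<mu>_vanishes_off_support:
  assumes f: "f \<in> locally_analytic \<sigma>" and V: "clopen_in \<sigma> V" "V \<inter> dist_support \<sigma> \<mu> = {}"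
    and supp: "supported_in \<sigma> f V"
  shows "\<mu> f = 0"
proof -
  have "closedin (top_of_set \<sigma>) V"
    using V(1) by (simp add: clopen_in_def)
  then have "V \<subseteq> \<sigma>" "compact V"
    using compact_\<sigma> by (auto dest: closedin_imp_subset intro: closedin_compact)
  have "\<exists>\<rho>>0. \<exists>U. vanishes_on \<sigma> \<mu> U \<and> \<sigma> \<inter> ball x \<rho> \<subseteq> U" if "x \<in> V" for x
  proof -
    have "x \<in> \<sigma>" "x \<notin> dist_support \<sigma> \<mu>"
      using that V(2) \<open>V \<subseteq> \<sigma>\<close> by auto
    then obtain U where U: "openin (top_of_set \<sigma>) U" "vanishes_on \<sigma> \<mu> U" "x \<in> U"
      by (auto simp: dist_support_def)
    then obtain T where T: "open T" "U = \<sigma> \<inter> T"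
      by (auto simp: openin_open)
    with U(3) obtain \<rho> where "0 < \<rho>" "ball x \<rho> \<subseteq> T"
      by (auto simp: open_contains_ball)
    with U(2) T(2) show ?thesis
      by blast
  qed
  then obtain \<rho> where \<rho>: "\<And>x. x \<in> V \<Longrightarrow> 0 < \<rho> x \<and> (\<exists>U. vanishes_on \<sigma> \<mu> U \<and> \<sigma> \<inter> ball x (\<rho> x) \<subseteq> U)"
    by metis
  then have "V \<subseteq> (\<Union>x\<in>V. ball x (\<rho> x))"
    by fastforce
  then obtain F where F: "F \<subseteq> V" "finite F" "V \<subseteq> (\<Union>x\<in>F. ball x (\<rho> x))"
    using compactE_image[OF \<open>compact V\<close>, of V "\<lambda>x. ball x (\<rho> x)"] by auto
  have "supported_in \<sigma> f (\<sigma> \<inter> (\<Union>x\<in>F. ball x (\<rho> x)))"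
  proof -
    have "disc_nbhd (\<sigma> - \<sigma> \<inter> (\<Union>x\<in>F. ball x (\<rho> x))) r \<subseteq> disc_nbhd (\<sigma> - V) r" for r
      using F(3) by (intro disc_nbhd_mono) auto
    then show ?thesis
      using supp unfolding supported_in_def by blast
  qed
  then show ?thesis
    using \<rho> F by (intro \<mu>_vanishing_balls[OF F(2) _ f]) auto
qed

text \<open>The difference is supported in \<open>\<sigma> - U\<close>, which misses the
  support.\<close>

lemma \<mu>_cong:
  assumes f: "f \<in> locally_analytic \<sigma>" "g \<in> locally_analytic \<sigma>"
    and U: "clopen_in \<sigma> U" "dist_support \<sigma> \<mu> \<subseteq> U"
    and eq: "0 < r" "\<And>z. z \<in> disc_nbhd U r \<Longrightarrow> f z = g z"
  shows "\<mu> f = \<mu> g"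
proof -
  have "U \<subseteq> \<sigma>"
    using U(1) by (auto simp: clopen_in_def dest: closedin_imp_subset)
  then have "\<sigma> - (\<sigma> - U) = U"
    by auto
  moreover have "clopen_in \<sigma> (\<sigma> - U)"
    using U(1) by (auto simp: clopen_in_def openin_diff closedin_diff)
  ultimately have "\<mu> (\<lambda>z. f z - g z) = 0"
    using U(2) eq by (intro \<mu>_vanishes_off_support[where V = "\<sigma> - U"] locally_analytic_diff f)
      (auto simp: supported_in_def)
  then show ?thesis
    using \<mu>_diff[OF f] by simp
qed

text \<open>Two admissible choices agree near the intersection of their clopen sets, again a clopen
  neighbourhood of the support, so the description defining the integral has exactly one
  value.\<close>

lemma dist_integral_eq:
  assumes U: "clopen_in \<sigma> U" "dist_support \<sigma> \<mu> \<subseteq> U"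
    and \<phi>: "\<phi> \<in> locally_analytic U" and g: "g \<in> locally_analytic \<sigma>"
    and r: "0 < r" "\<And>z. z \<in> disc_nbhd U r \<Longrightarrow> g z = \<phi> z"
      "\<And>z. z \<in> disc_nbhd (\<sigma> - U) r \<Longrightarrow> g z = 0"
  shows "dist_integral \<sigma> \<mu> \<phi> = \<mu> g"
  unfolding dist_integral_def
proof (rule the_equality)
  show "\<exists>U g' r. clopen_in \<sigma> U \<and> dist_support \<sigma> \<mu> \<subseteq> U \<and> \<phi> \<in> locally_analytic U \<and>
      g' \<in> locally_analytic \<sigma> \<and> r > 0 \<and>
      (\<forall>z\<in>disc_nbhd U r. g' z = \<phi> z) \<and> (\<forall>z\<in>disc_nbhd (\<sigma> - U) r. g' z = 0) \<and> \<mu> g = \<mu> g'"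
    using assms by blast
next
  fix v
  assume "\<exists>U g r. clopen_in \<sigma> U \<and> dist_support \<sigma> \<mu> \<subseteq> U \<and> \<phi> \<in> locally_analytic U \<and>
      g \<in> locally_analytic \<sigma> \<and> r > 0 \<and>
      (\<forall>z\<in>disc_nbhd U r. g z = \<phi> z) \<and> (\<forall>z\<in>disc_nbhd (\<sigma> - U) r. g z = 0) \<and> v = \<mu> g"
  then obtain U' g' r' where *: "clopen_in \<sigma> U'" "dist_support \<sigma> \<mu> \<subseteq> U'" "g' \<in> locally_analytic \<sigma>"
    "r' > 0" "\<forall>z\<in>disc_nbhd U' r'. g' z = \<phi> z" "v = \<mu> g'"
    by blast
  have "clopen_in \<sigma> (U \<inter> U')"
    using U(1) *(1) by (auto simp: clopen_in_def)
  moreover have "disc_nbhd (U \<inter> U') (min r r') \<subseteq> disc_nbhd U r \<inter> disc_nbhd U' r'"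
    using disc_nbhd_mono[of "U \<inter> U'" U "min r r'" r] disc_nbhd_mono[of "U \<inter> U'" U' "min r r'" r'] by auto
  then have "g' z = g z" if "z \<in> disc_nbhd (U \<inter> U') (min r r')" for z
    using that r(2) *(5) by fastforce
  ultimately have "\<mu> g' = \<mu> g"
    using U(2) * r(1) by (intro \<mu>_cong[OF *(3) g, of "U \<inter> U'" "min r r'"]) auto
  then show "v = \<mu> g"
    using *(6) by simp
qed

lemma dist_integral_cut_ball:
  assumes "0 < r" "r \<le> R" "dist_support \<sigma> \<mu> \<subseteq> ball c R" "\<phi> \<in> analytic_space (\<sigma> \<inter> ball c R) r"
  shows "dist_integral \<sigma> \<mu> \<phi> = \<mu> (cut_ball c R \<phi>)"
proof (rule dist_integral_eq[of "\<sigma> \<inter> ball c R" _ _ r])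
  show "clopen_in \<sigma> (\<sigma> \<inter> ball c R)"
    using assms by (intro clopen_in_ball) simp
  show "dist_support \<sigma> \<mu> \<subseteq> \<sigma> \<inter> ball c R"
    using assms(3) by (auto simp: dist_support_def)
  show "\<phi> \<in> locally_analytic (\<sigma> \<inter> ball c R)"
    using assms by (intro locally_analyticI)
  show "cut_ball c R \<phi> \<in> locally_analytic \<sigma>"
    using assms by (intro locally_analyticI analytic_space_cut_ball)
next
  fix z assume "z \<in> disc_nbhd (\<sigma> \<inter> ball c R) r"
  then show "cut_ball c R \<phi> z = \<phi> z"
    using assms(2) by (rule cut_ball_disc_nbhd)
next
  fix z assume "z \<in> disc_nbhd (\<sigma> - \<sigma> \<inter> ball c R) r"
  then obtain a where "a \<notin> ball c R" "z \<in> ball a r"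
    unfolding disc_nbhd_iff by blast
  then show "cut_ball c R \<phi> z = 0"
    using cut_ball_outside assms(2) by blast
qed (rule assms)

lemma \<mu>_cut_ball:
  assumes "0 < R" "dist_support \<sigma> \<mu> \<subseteq> ball c R" "f \<in> locally_analytic \<sigma>"
  shows "\<mu> (cut_ball c R f) = \<mu> f"
proof (rule \<mu>_cong[of _ _ "\<sigma> \<inter> ball c R" R])
  show "cut_ball c R f \<in> locally_analytic \<sigma>"
    using assms by (intro locally_analytic_cut_ball)
  show "dist_support \<sigma> \<mu> \<subseteq> \<sigma> \<inter> ball c R"
    using assms(2) by (auto simp: dist_support_def)
  fix z assume "z \<in> disc_nbhd (\<sigma> \<inter> ball c R) R"
  then show "cut_ball c R f z = f z"
    using order_refl by (rule cut_ball_disc_nbhd)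
qed (use assms clopen_in_ball in auto)

text \<open>Serves the case \<lambda> = 0, in which |x| < |\<lambda>| leaves no room for a
  support.\<close>

lemma \<mu>_empty_support:
  assumes "dist_support \<sigma> \<mu> = {}" "f \<in> locally_analytic \<sigma>"
  shows "\<mu> f = 0"
  using \<mu>_cong[OF assms(2) zero_locally_analytic, of "{}" 1] assms(1) \<mu>_0
  by (simp add: clopen_in_def disc_nbhd_def)

lemma dist_integral_empty_support:
  assumes "dist_support \<sigma> \<mu> = {}"
  shows "dist_integral \<sigma> \<mu> \<phi> = 0"
proof -
  have "\<phi> \<in> locally_analytic {}"
    by (rule locally_analyticI[of _ _ 1]) (auto simp: analytic_space_def disc_nbhd_def)
  then have "dist_integral \<sigma> \<mu> \<phi> = \<mu> (\<lambda>_. 0)"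
    using assms by (intro dist_integral_eq[of "{}" _ _ 1])
      (auto simp: clopen_in_def disc_nbhd_def zero_locally_analytic)
  then show ?thesis
    by (simp add: \<mu>_0)
qed

end

section \<open>The log-gamma function of a distribution\<close>

text \<open>A distribution takes functions, not formal polynomials; with this predicate, closure
  rules give the local analyticity of a polynomial integrand from its shape.\<close>

definition is_poly :: "('a::comm_ring_1 \<Rightarrow> 'a) \<Rightarrow> bool" where
  "is_poly f \<longleftrightarrow> (\<exists>q. f = poly q)"

lemma is_poly_const: "is_poly (\<lambda>_. c)"
  unfolding is_poly_def by (rule exI[of _ "[:c:]"]) auto

lemma is_poly_id: "is_poly (\<lambda>x. x)"
  unfolding is_poly_def by (rule exI[of _ "[:0, 1:]"]) auto

lemma is_poly_add: "is_poly f \<Longrightarrow> is_poly g \<Longrightarrow> is_poly (\<lambda>x. f x + g x)"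
  unfolding is_poly_def by (elim exE, rule_tac x = "q + qa" in exI) auto

lemma is_poly_mult: "is_poly f \<Longrightarrow> is_poly g \<Longrightarrow> is_poly (\<lambda>x. f x * g x)"
  unfolding is_poly_def by (elim exE, rule_tac x = "q * qa" in exI) auto

lemma is_poly_diff: "is_poly f \<Longrightarrow> is_poly g \<Longrightarrow> is_poly (\<lambda>x. f x - g x)"
  unfolding is_poly_def by (elim exE, rule_tac x = "q - qa" in exI) auto

lemma is_poly_divide: "is_poly f \<Longrightarrow> is_poly (\<lambda>x. f x / c)" for c :: "'a::field"
  using is_poly_mult[OF _ is_poly_const[of "inverse c"]] by (simp add: divide_inverse)

lemma is_poly_power: "is_poly f \<Longrightarrow> is_poly (\<lambda>x. f x ^ n)"
  by (induction n) (auto intro: is_poly_const is_poly_mult)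

lemma is_poly_sum: "(\<And>i. i \<in> A \<Longrightarrow> is_poly (f i)) \<Longrightarrow> is_poly (\<lambda>x. \<Sum>i\<in>A. f i x)"
  by (induction A rule: infinite_finite_induct) (auto intro: is_poly_const is_poly_add)

lemmas is_poly_intros = is_poly_const is_poly_id is_poly_add is_poly_mult is_poly_diff is_poly_divide
  is_poly_power is_poly_sum

lemma (in distribution) is_poly_analytic: "is_poly f \<Longrightarrow> f \<in> analytic_space (\<sigma> \<inter> T) s"
  unfolding is_poly_def
  using analytic_space_poly bounded_subset[OF compact_imp_bounded[OF compact_\<sigma>], of "\<sigma> \<inter> T"] by auto

lemma (in distribution) is_poly_locally_analytic: "is_poly f \<Longrightarrow> f \<in> locally_analytic \<sigma>"
  using is_poly_analytic[of f UNIV 1] by (auto intro: locally_analyticI[of _ _ 1])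

context padic_valued_field
begin

text \<open>The powers of p are nonzero p-adic integers tending to 0. This makes the derivative at 0
  unique, so that \<open>padic_deriv\<close> is determined.\<close>

lemma zero_islimpt_padic_integers: "at (0 :: 'a) within padic_integers \<noteq> bot"
proof -
  have "\<forall>n. of_nat (p ^ n) \<in> padic_integers - {0 :: 'a}"
    using padic_integers_of_nat p_nonzero by (simp del: of_nat_power)
  then have "(0 :: 'a) islimpt padic_integers"
    unfolding islimpt_sequential by (intro exI conjI) (assumption, rule p_power_tendsto_0)
  then show ?thesis
    by (simp add: trivial_limit_within)
qed

lemma padic_deriv_eqI:
  fixes D :: 'a
  assumes "has_padic_derivative f D 0"
  shows "padic_deriv f 0 = D"
  unfolding padic_deriv_def
proof (rule the_equality)
  show "D' = D" if "has_padic_derivative f D' 0" for D'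
    using that assms tendsto_unique[OF zero_islimpt_padic_integers]
    unfolding has_padic_derivative_def by blast
qed (rule assms)

end

locale log_gamma_setting = padic_complex_field p K pw + distribution \<sigma> \<mu>
  for p :: nat and K :: "'a::ultrametric_field itself" and pw and \<sigma> :: "'a set" and \<mu> +
  fixes l :: 'a
  assumes l_nonzero: "l \<noteq> 0"
    and support_less: "x \<in> dist_support \<sigma> \<mu> \<Longrightarrow> absv x < absv l"
begin

definition R :: real where "R = absv l"
text \<open>Strictly below \<open>R\<close>, so that the r-neighbourhood of a compact subset of the
  ball of radius \<open>R\<close> stays within a strictly smaller radius.\<close>

definition r :: real where "r = absv l / 2"
definition U :: "'a set" where "U = \<sigma> \<inter> ball 0 R"
definition \<omega> :: 'a where "\<omega> = omega_v p pw l"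
definition u :: 'a where "u = angle p pw l"
definition A :: "'a \<Rightarrow> 'a" where "A z = (l + z) / \<omega> - 1"
text \<open>The integrands are controlled only for |z| < |l|, where the support lies; cutting there
  extends them by 0 to functions analytic near all of \<sigma>.\<close>

definition I :: "('a \<Rightarrow> 'a) \<Rightarrow> 'a" where "I f = \<mu> (cut_ball 0 R f)"

lemma r_bounds: "0 < r" "r \<le> R" "0 < R"
  using l_nonzero by (auto simp: r_def R_def)

lemma support_subset: "dist_support \<sigma> \<mu> \<subseteq> ball 0 R"
  using support_less by (auto simp: R_def dist_absv)

lemma \<omega>_nonzero: "\<omega> \<noteq> 0" and absv_\<omega>: "absv \<omega> = absv l"
  using l_nonzero by (simp_all add: \<omega>_def omega_v_nonzero absv_omega_v)

lemma u_eq: "u = l / \<omega>"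
  by (simp add: u_def \<omega>_def angle_def)

lemma absv_u: "absv u = 1" and absv_u_minus_1: "absv (u - 1) < 1"
  using absv_angle_minus_1_less[OF l_nonzero] l_nonzero by (simp_all add: u_eq absv_divide absv_\<omega> u_def[symmetric])

lemma A_eq: "A z = (u - 1) + z / \<omega>"
  by (simp add: A_def u_eq add_divide_distrib)

text \<open>Each point of \<open>U\<close> has absolute value below |l|, and compactness makes the
  gap uniform. \<open>U\<close> is compact because the ball is also closed.\<close>

lemma disc_nbhd_bound:
  "\<exists>\<rho>\<ge>0. \<rho> < 1 \<and> (\<forall>z\<in>disc_nbhd U r. absv (A z) \<le> \<rho> \<and> absv (z / l) \<le> \<rho>)"
proof -
  have "compact U"
    unfolding U_def using compact_\<sigma> closed_ball_ultrametric[OF r_bounds(3)] by (rule compact_Int_closed)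
  have "\<exists>B<R. 0 \<le> B \<and> (\<forall>a\<in>U. absv a \<le> B)"
  proof (cases "U = {}")
    case False
    have "continuous_on U (\<lambda>a. dist 0 a)"
      by (intro continuous_intros)
    then obtain m where "m \<in> U" "\<forall>a\<in>U. dist 0 a \<le> dist 0 m"
      using continuous_attains_sup[OF \<open>compact U\<close> False] by blast
    then show ?thesis
      by (intro exI[of _ "absv m"]) (auto simp: U_def dist_absv)
  qed (use r_bounds in \<open>auto intro: exI[of _ 0]\<close>)
  then obtain B where B: "B < R" "0 \<le> B" "\<And>a. a \<in> U \<Longrightarrow> absv a \<le> B"
    by blast
  define \<rho> where "\<rho> = max (absv (u - 1)) (max B r / absv l)"
  have z: "absv (z / l) \<le> max B r / absv l" if nbhd: "z \<in> disc_nbhd U r" for z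
  proof -
    obtain a where "a \<in> U" "absv (z - a) < r"
      using nbhd unfolding disc_nbhd_iff in_ball_absv by blast
    then have "absv (z - a + a) \<le> max B r"
      using B(3)[of a] by (intro absv_add_le) auto
    then show ?thesis
      by (simp add: absv_divide divide_right_mono)
  qed
  have "\<rho> < 1"
    using B(1) l_nonzero absv_u_minus_1 by (auto simp: \<rho>_def r_def R_def divide_less_eq)
  moreover have "0 \<le> \<rho>"
    by (simp add: \<rho>_def le_max_iff_disj)
  moreover have "absv (z / l) \<le> \<rho>" if "z \<in> disc_nbhd U r" for z
    using z[OF that] by (simp add: \<rho>_def)
  moreover have "absv (A z) \<le> \<rho>" if "z \<in> disc_nbhd U r" for z
    unfolding A_eq using z[OF that]
    by (intro absv_add_le) (auto simp: \<rho>_def absv_divide absv_\<omega> le_max_iff_disj)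
  ultimately show ?thesis
    by blast
qed

lemma cut_ball_locally_analytic: "f \<in> analytic_space U r \<Longrightarrow> cut_ball 0 R f \<in> locally_analytic \<sigma>"
  unfolding U_def using r_bounds by (auto intro: locally_analyticI analytic_space_cut_ball)

lemma I_add:
  assumes "f \<in> analytic_space U r" "g \<in> analytic_space U r"
  shows "I (\<lambda>z. f z + g z) = I f + I g"
proof -
  have "cut_ball 0 R (\<lambda>z. f z + g z) = (\<lambda>z. cut_ball 0 R f z + cut_ball 0 R g z)"
    by (auto simp: cut_ball_def)
  then show ?thesis
    unfolding I_def by (simp add: \<mu>_add cut_ball_locally_analytic assms)
qed

lemma I_cmult:
  assumes "f \<in> analytic_space U r"
  shows "I (\<lambda>z. c * f z) = c * I f"
proof -
  have "cut_ball 0 R (\<lambda>z. c * f z) = (\<lambda>z. c * cut_ball 0 R f z)"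
    by (auto simp: cut_ball_def)
  then show ?thesis
    unfolding I_def by (simp add: \<mu>_cmult cut_ball_locally_analytic assms)
qed

lemma I_diff:
  assumes "f \<in> analytic_space U r" "g \<in> analytic_space U r"
  shows "I (\<lambda>z. f z - g z) = I f - I g"
  using I_add[OF assms(1) analytic_space_cmult[OF assms(2), of "- 1"]] I_cmult[OF assms(2), of "- 1"]
  by simp

lemma is_poly_analytic_U: "is_poly f \<Longrightarrow> f \<in> analytic_space U r"
  unfolding U_def by (rule is_poly_analytic)

lemma I_poly: "is_poly f \<Longrightarrow> I f = \<mu> f"
  unfolding I_def by (intro \<mu>_cut_ball r_bounds support_subset is_poly_locally_analytic)

lemma I_0: "I (\<lambda>_. 0) = 0"
  using I_poly[OF is_poly_const] \<mu>_0 by simp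

lemma I_sum:
  assumes "finite S" "\<And>i. i \<in> S \<Longrightarrow> is_poly (f i)"
  shows "I (\<lambda>z. \<Sum>i\<in>S. c i * f i z) = (\<Sum>i\<in>S. c i * I (f i))"
  using assms
proof (induction S rule: finite_induct)
  case (insert i S)
  then have "I (\<lambda>z. c i * f i z + (\<Sum>i\<in>S. c i * f i z)) = c i * I (f i) + I (\<lambda>z. \<Sum>i\<in>S. c i * f i z)"
    using I_add[OF is_poly_analytic_U is_poly_analytic_U] I_cmult[OF is_poly_analytic_U]
    by (simp add: is_poly_intros)
  with insert show ?case
    by simp
qed (simp add: I_0)

lemma I_tendsto_0:
  assumes "\<And>n. g n \<in> analytic_space U r" "\<And>n z. z \<in> disc_nbhd U r \<Longrightarrow> absv (g n z) \<le> B n"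
    and "\<And>n. 0 \<le> B n" "B \<longlonglongrightarrow> 0"
  shows "(\<lambda>n. I (g n)) \<longlonglongrightarrow> 0"
  unfolding I_def
proof (rule \<mu>_tendsto_0[OF r_bounds(1) _ _ assms(4)])
  show "cut_ball 0 R (g n) \<in> analytic_space \<sigma> r" for n
    using assms(1) r_bounds by (intro analytic_space_cut_ball) (auto simp: U_def)
  show "absv (cut_ball 0 R (g n) z) \<le> B n" if "z \<in> disc_nbhd \<sigma> r" for n z
    using assms(2)[unfolded U_def] assms(3) r_bounds(2) that by (intro absv_cut_ball_le[of r R]) auto
qed

lemma is_poly_A: "is_poly A"
  unfolding A_def[abs_def] by (intro is_poly_intros)

lemma is_poly_A_power: "is_poly (\<lambda>z. A z ^ n)"
  by (intro is_poly_intros is_poly_A)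

section \<open>Moments and the derivative of the zeta function\<close>

definition M :: "nat \<Rightarrow> 'a" where "M n = I (\<lambda>z. A z ^ n)"

text \<open>The denominators come from t gchoose (n + 2) = t (t - 1) / ((n + 1)(n + 2)) times t - 2
  gchoose n. Stored with the moments, they leave \<open>G\<close> a plain binomial series.\<close>

definition N :: "nat \<Rightarrow> 'a" where "N n = M (n + 2) / (of_nat (Suc n) * of_nat (Suc (Suc n)))"

definition G :: "'a \<Rightarrow> 'a" where "G t = (\<Sum>n. (t gchoose n) * N n)"

lemma angle_power_eq:
  assumes "z \<in> ball 0 R"
  shows "angle_power p pw (l + z) t = binomial_power (A z) t" "absv (A z) < 1"
proof -
  have *: "absv (l + z - l) < absv l"
    using assms by (simp add: R_def dist_absv)
  have "l + z \<noteq> 0"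
    using absv_eq_of_close[OF *] l_nonzero by auto
  have "angle p pw (l + z) = (l + z) / \<omega>"
    unfolding angle_def \<omega>_def omega_v_cong[OF *] ..
  then have A: "A z = angle p pw (l + z) - 1"
    by (simp add: A_def)
  show "angle_power p pw (l + z) t = binomial_power (A z) t"
    by (simp add: angle_power_def binomial_power_def A)
  show "absv (A z) < 1"
    unfolding A using \<open>l + z \<noteq> 0\<close> by (rule absv_angle_minus_1_less)
qed

lemma disc_nbhd_U_subset: "z \<in> disc_nbhd U r \<Longrightarrow> z \<in> ball 0 R"
  unfolding disc_nbhd_iff U_def using ball_mem_cong[OF _ r_bounds(2)] by blast

text \<open>The expansion about \<open>a\<close> comes from \<open>\<langle>l + z\<rangle> = \<langle>l + a\<rangle> (1 + (z - a) / (l + a))\<close>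
  and the multiplicativity of \<open>t\<close>-th powers.\<close>

lemma analytic_angle_power:
  assumes t: "t \<in> padic_integers"
  shows "(\<lambda>z. angle_power p pw (l + z) t) \<in> analytic_space U r"
proof (rule analytic_spaceI)
  fix a assume a: "a \<in> U"
  then have aR: "a \<in> ball 0 R"
    by (simp add: U_def)
  have abs_la: "absv (l + a) = absv l"
    using aR by (intro absv_eq_of_close) (simp add: R_def dist_absv)
  then have la: "l + a \<noteq> 0"
    using l_nonzero by auto
  define c where "c n = binomial_power (A a) t * (t gchoose n) / (l + a) ^ n" for n
  have "(\<lambda>n. c n * (z - a) ^ n) sums angle_power p pw (l + z) t" if z: "z \<in> ball a r" for z
  proof -
    define y where "y = (z - a) / (l + a)"
    have zR: "z \<in> ball 0 R"
      using z aR ball_mem_cong[OF _ r_bounds(2)] by blast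
    have "absv (z - a) < absv l"
      using z r_bounds(2) unfolding in_ball_absv R_def by linarith
    then have y: "absv y < 1"
      using l_nonzero by (simp add: y_def absv_divide abs_la)
    have "1 + y = (l + z) / (l + a)"
      using la by (simp add: y_def field_simps)
    then have "1 + A z = (1 + A a) * (1 + y)"
      using la by (simp add: A_def)
    then have "A z = A a + y + A a * y"
      by (simp add: algebra_simps)
    then have "binomial_power (A a) t * binomial_power y t = angle_power p pw (l + z) t"
      using binomial_power_mult[OF angle_power_eq(2)[OF aR] y t] angle_power_eq(1)[OF zR] by simp
    moreover have "(\<lambda>n. (t gchoose n) * y ^ n) sums binomial_power y t"
      unfolding binomial_power_def
      by (intro summable_sums summable_binomial_series t power_tendsto_0 y)
    from sums_cmult[OF this, of "binomial_power (A a) t"]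
    have "(\<lambda>n. c n * (z - a) ^ n) sums (binomial_power (A a) t * binomial_power y t)"
      by (simp add: c_def y_def power_divide mult.assoc)
    ultimately show ?thesis
      by simp
  qed
  then show "\<exists>c. \<forall>z\<in>ball a r. (\<lambda>n. c n * (z - a) ^ n) sums angle_power p pw (l + z) t"
    by blast
next
  fix z assume "z \<in> disc_nbhd U r"
  then have zR: "z \<in> ball 0 R"
    by (rule disc_nbhd_U_subset)
  have "absv ((t gchoose n) * A z ^ n) \<le> 1" for n
    using absv_gbinomial_le_1[OF t, of n] angle_power_eq(2)[OF zR]
    by (auto simp: absv_mult absv_power intro!: mult_le_one power_le_one)
  then show "absv (angle_power p pw (l + z) t) \<le> 1"
    unfolding angle_power_eq(1)[OF zR] binomial_power_def
    using angle_power_eq(2)[OF zR]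
    by (intro absv_suminf_le summable_binomial_series t power_tendsto_0)
qed

text \<open>Partial sums of the binomial series approximate the power within \<rho>^n uniformly near
  the support, which permits integration term by term.\<close>

lemma integral_angle_power_sums:
  assumes t: "t \<in> padic_integers"
  shows "(\<lambda>n. (t gchoose n) * M n) sums dist_integral \<sigma> \<mu> (\<lambda>x. angle_power p pw (l + x) t)"
proof -
  obtain \<rho> where \<rho>: "0 \<le> \<rho>" "\<rho> < 1" "\<And>z. z \<in> disc_nbhd U r \<Longrightarrow> absv (A z) \<le> \<rho>"
    "\<And>z. z \<in> disc_nbhd U r \<Longrightarrow> absv (z / l) \<le> \<rho>"
    using disc_nbhd_bound by blast
  define \<phi> where "\<phi> z = angle_power p pw (l + z) t" for z
  define P where "P n z = (\<Sum>k<n. (t gchoose k) * A z ^ k)" for n z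
  have \<phi>: "\<phi> \<in> analytic_space U r"
    unfolding \<phi>_def using t by (rule analytic_angle_power)
  have P: "is_poly (P n)" for n
    unfolding P_def[abs_def] by (intro is_poly_intros is_poly_A)
  have "(\<lambda>n. I (\<lambda>z. \<phi> z - P n z)) \<longlonglongrightarrow> 0"
  proof (rule I_tendsto_0[where B = "\<lambda>n. \<rho> ^ n"])
    show "(\<lambda>z. \<phi> z - P n z) \<in> analytic_space U r" for n
      by (intro analytic_space_diff \<phi> is_poly_analytic_U P)
    show "(\<lambda>n. \<rho> ^ n) \<longlonglongrightarrow> 0"
      using \<rho> by (intro LIMSEQ_realpow_zero)
    fix n z assume z: "z \<in> disc_nbhd U r"
    have "absv ((t gchoose k) * A z ^ k) \<le> \<rho> ^ n" if "k \<ge> n" for k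
    proof -
      have "absv (t gchoose k) * absv (A z) ^ k \<le> 1 * \<rho> ^ k"
        using \<rho>(3)[OF z] absv_gbinomial_le_1[OF t] by (intro mult_mono power_mono) auto
      also have "\<dots> \<le> \<rho> ^ n"
        using that \<rho> by (simp add: power_decreasing)
      finally show ?thesis
        by (simp add: absv_mult absv_power)
    qed
    moreover have "absv (A z) < 1"
      using \<rho>(2) \<rho>(3)[OF z] by simp
    ultimately show "absv (\<phi> z - P n z) \<le> \<rho> ^ n"
      unfolding \<phi>_def P_def angle_power_eq(1)[OF disc_nbhd_U_subset[OF z]] binomial_power_def
      by (intro absv_suminf_minus_partial_sum_le summable_binomial_series t power_tendsto_0)
  qed (use \<rho> in auto)
  moreover have "I (\<lambda>z. \<phi> z - P n z) = I \<phi> - (\<Sum>k<n. (t gchoose k) * M k)" for n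
  proof -
    have "I (P n) = (\<Sum>k<n. (t gchoose k) * M k)"
      unfolding P_def[abs_def] M_def by (intro I_sum is_poly_A_power) auto
    then show ?thesis
      using I_diff[OF \<phi> is_poly_analytic_U[OF P]] by simp
  qed
  ultimately have "(\<lambda>n. I \<phi> - (\<Sum>k<n. (t gchoose k) * M k)) \<longlonglongrightarrow> 0"
    by simp
  from tendsto_diff[OF tendsto_const[of "I \<phi>"] this] have "(\<lambda>n. (t gchoose n) * M n) sums I \<phi>"
    by (simp add: sums_def)
  moreover have "dist_integral \<sigma> \<mu> \<phi> = I \<phi>"
    unfolding I_def using r_bounds support_subset \<phi> by (intro dist_integral_cut_ball[of r]) (auto simp: U_def)
  ultimately show ?thesis
    unfolding \<phi>_def by simp
qed

lemma N_eq: "N n = I (\<lambda>z. A z ^ (n + 2) / (of_nat (Suc n) * of_nat (Suc (Suc n))))"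
  unfolding N_def M_def
  using I_cmult[OF is_poly_analytic_U[OF is_poly_A_power[of "n + 2"]],
      of "inverse (of_nat (Suc n) * of_nat (Suc (Suc n)))"]
  by (simp only: divide_inverse mult.commute)

text \<open>The continuity used here yields limits but no rates, so the denominators are put under
  the integral, where the integrands are bounded by (n + 2) \<rho>^(n + 2) and still tend to 0
  uniformly.\<close>

lemma N_tendsto_0: "N \<longlonglongrightarrow> 0"
proof -
  obtain \<rho> where \<rho>: "0 \<le> \<rho>" "\<rho> < 1" "\<And>z. z \<in> disc_nbhd U r \<Longrightarrow> absv (A z) \<le> \<rho>"
    "\<And>z. z \<in> disc_nbhd U r \<Longrightarrow> absv (z / l) \<le> \<rho>"
    using disc_nbhd_bound by blast
  have "(\<lambda>n. I (\<lambda>z. A z ^ (n + 2) / (of_nat (Suc n) * of_nat (Suc (Suc n))))) \<longlonglongrightarrow> 0"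
    using \<rho> by (intro I_tendsto_0[where B = "\<lambda>n. real (n + 2) * \<rho> ^ (n + 2)"] times_power_tendsto_0
        absv_xlogx_term_le is_poly_analytic_U is_poly_divide is_poly_A_power) auto
  then show ?thesis
    unfolding N_eq .
qed

lemma integral_angle_power:
  assumes t: "t \<in> padic_integers"
  shows "dist_integral \<sigma> \<mu> (\<lambda>x. angle_power p pw (l + x) t) = M 0 + t * M 1 + t * (t - 1) * G (t - 2)"
proof -
  have t2: "t - 2 \<in> padic_integers"
    using padic_integers_diff[OF t padic_integers_of_nat[of 2]] by simp
  have "(\<lambda>n. t * (t - 1) * ((t - 2 gchoose n) * N n)) sums (t * (t - 1) * G (t - 2))"
    unfolding G_def by (intro sums_cmult summable_sums summable_binomial_series t2 N_tendsto_0)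
  moreover have "t * (t - 1) * ((t - 2 gchoose n) * N n) = (t gchoose (n + 2)) * M (n + 2)" for n
  proof -
    have frac: "x * y * (c * (m / (v * w))) = x / w * (y / v * c) * m" for x y c m v w :: 'a
      by (simp add: divide_inverse mult_ac)
    have "t gchoose (n + 2) = t / of_nat (Suc (Suc n)) * ((t - 1) / of_nat (Suc n) * (t - 2 gchoose n))"
      using gbinomial_absorption'[of "n + 2" t] gbinomial_absorption'[of "Suc n" "t - 1"]
      by (simp add: diff_diff_eq del: of_nat_Suc)
    then show ?thesis
      unfolding N_def frac by simp
  qed
  ultimately have "(\<lambda>n. (t gchoose Suc (Suc n)) * M (Suc (Suc n))) sums (t * (t - 1) * G (t - 2))"
    by simp
  from sums_Suc[OF sums_Suc[OF this]]
  have "(\<lambda>n. (t gchoose n) * M n) sums (M 0 + t * M 1 + t * (t - 1) * G (t - 2))"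
    by (simp add: algebra_simps)
  then show ?thesis
    using integral_angle_power_sums[OF t] sums_unique2 by blast
qed

text \<open>For t = 1 - s the zeta function is M 0 / (s - 1) - M 1 + s G(-1 - s). The difference
  quotient at 0 is therefore M 0 / (s - 1) + G(-1 - s), and continuity of \<open>G\<close> at -1
  gives the limit.\<close>

lemma padic_zeta_derivative: "has_padic_derivative (\<lambda>s. padic_zeta p pw \<sigma> \<mu> s l) (G (- 1) - M 0) 0"
proof -
  define Z where "Z = (\<lambda>s. padic_zeta p pw \<sigma> \<mu> s l)"
  let ?F = "at (0::'a) within padic_integers"
  have id: "((\<lambda>s. s) \<longlongrightarrow> 0) ?F"
    by (rule tendsto_ident_at)
  \<comment> \<open>The restriction |s| < 1 keeps s away from the pole at 1 and gives |s - 1| =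
    1.\<close>
  have mem: "\<forall>\<^sub>F s in ?F. s \<in> padic_integers \<and> s \<noteq> 0 \<and> absv s < 1"
    using eventually_absv_diff_less[OF id, of 1] by (auto simp: eventually_at_filter elim: eventually_mono)
  have Z: "Z s = 1 / (s - 1) * (M 0 + (1 - s) * M 1 + (1 - s) * (- s) * G (- 1 - s))"
    if "s \<in> padic_integers" for s
    using integral_angle_power[of "1 - s"] padic_integers_diff[OF padic_integers_of_nat[of 1] that]
    by (simp add: Z_def padic_zeta_def)
  have Z0: "Z 0 = - (M 0 + M 1)"
    using Z[of 0] padic_integers_of_nat[of 0] by simp
  have "((\<lambda>s. 1 / (s - 1)) \<longlongrightarrow> - 1) ?F"
  proof (subst tendsto_absv_iff, rule Lim_transform_eventually)
    show "((\<lambda>s. absv s) \<longlongrightarrow> 0) ?F"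
      by (rule iffD1[OF tendsto_0_absv_iff id])
    from mem show "\<forall>\<^sub>F s in ?F. absv s = absv (1 / (s - 1) - - 1)"
    proof eventually_elim
      case (elim s)
      then have "absv (s - 1) = 1"
        using absv_add_eq[of s "- 1"] by simp
      then have "s - 1 \<noteq> 0"
        by auto
      then have "1 / (s - 1) - - 1 = s / (s - 1)"
        by (simp add: field_simps)
      then show ?case
        using \<open>absv (s - 1) = 1\<close> by (simp add: absv_divide)
    qed
  qed
  moreover have "((\<lambda>s. G (- 1 - s)) \<longlongrightarrow> G (- 1)) ?F"
    unfolding G_def
  proof (intro tendsto_binomial_series N_tendsto_0)
    show "((\<lambda>s. - 1 - s) \<longlongrightarrow> - 1) ?F"
      using tendsto_diff[OF tendsto_const[of "- 1"] id] by simp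
    show m1: "- 1 \<in> (padic_integers :: 'a set)"
      using padic_integers_of_int[of "- 1"] by simp
    from mem show "\<forall>\<^sub>F s in ?F. - 1 - s \<in> padic_integers"
      using padic_integers_diff[OF m1] by (auto elim: eventually_mono)
  qed
  ultimately have "((\<lambda>s. M 0 * (1 / (s - 1)) + G (- 1 - s)) \<longlongrightarrow> M 0 * (- 1) + G (- 1)) ?F"
    by (intro tendsto_add tendsto_mult tendsto_const)
  moreover from mem have "\<forall>\<^sub>F s in ?F. M 0 * (1 / (s - 1)) + G (- 1 - s) = (Z s - Z 0) / (s - 0)"
  proof eventually_elim
    case (elim s)
    have "s \<noteq> 1"
      using elim by auto
    then have "Z s - Z 0 = s * (M 0 * (1 / (s - 1)) + G (- 1 - s))"
      using Z[of s] elim by (simp add: Z0 field_simps)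
    then show ?case
      using elim by simp
  qed
  ultimately have "((\<lambda>s. (Z s - Z 0) / (s - 0)) \<longlongrightarrow> M 0 * (- 1) + G (- 1)) ?F"
    by (rule Lim_transform_eventually)
  then show ?thesis
    by (simp add: has_padic_derivative_def Z_def)
qed

section \<open>Comparison with Stirling's series\<close>

lemma is_poly_xlogx_poly: "is_poly f \<Longrightarrow> is_poly (\<lambda>z. xlogx_poly n (f z))"
  unfolding xlogx_poly_def by (intro is_poly_intros)

lemma I_xlogx_poly:
  "I (\<lambda>z. xlogx_poly n (A z)) = M 1 + (\<Sum>k<n. (- 1) ^ k * N k)"
proof -
  have "I (\<lambda>z. A z + (\<Sum>k<n. (- 1) ^ k * (A z ^ (k + 2) / (of_nat (Suc k) * of_nat (Suc (Suc k)))))) =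
      I A + I (\<lambda>z. \<Sum>k<n. (- 1) ^ k * (A z ^ (k + 2) / (of_nat (Suc k) * of_nat (Suc (Suc k)))))"
    by (intro I_add is_poly_analytic_U is_poly_intros is_poly_A)
  also have "I (\<lambda>z. \<Sum>k<n. (- 1) ^ k * (A z ^ (k + 2) / (of_nat (Suc k) * of_nat (Suc (Suc k))))) =
      (\<Sum>k<n. (- 1) ^ k * N k)"
    unfolding N_eq by (intro I_sum is_poly_divide is_poly_A_power) auto
  finally show ?thesis
    by (simp add: xlogx_poly_def M_def)
qed

text \<open>As -1 gchoose n is (-1)^n, the series of \<open>G (- 1)\<close> is the integrated series
  of (1 + A) log (1 + A) without its linear term, whose integral is \<open>M 1\<close>.\<close>

lemma I_xlogx_poly_tendsto: "(\<lambda>n. I (\<lambda>z. xlogx_poly n (A z))) \<longlonglongrightarrow> M 1 + G (- 1)"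
proof -
  have "- 1 \<in> (padic_integers :: 'a set)"
    using padic_integers_of_int[of "- 1"] by simp
  then have "(\<lambda>n. (- 1 gchoose n) * N n) sums G (- 1)"
    unfolding G_def by (intro summable_sums summable_binomial_series N_tendsto_0)
  then show ?thesis
    unfolding I_xlogx_poly sums_def gbinomial_minus_1 by (intro tendsto_add tendsto_const)
qed

text \<open>Since \<open>\<omega> * u = l\<close>, multiplying by \<omega> gives (l + z) log l plus
  l times the partial sum in z / l, and the integral of the latter consists of Stirling's
  terms.\<close>

definition Q :: "nat \<Rightarrow> 'a \<Rightarrow> 'a" where
  "Q n z = log1p (u - 1) / \<omega> * (l + z) + u * xlogx_poly n (z / l)"

lemma is_poly_Q: "is_poly (Q n)"
  unfolding Q_def[abs_def] by (intro is_poly_intros is_poly_xlogx_poly)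

text \<open>Both polynomials approximate \<open>\<langle>l + z\<rangle> log \<langle>l + z\<rangle> = \<langle>l + z\<rangle> log \<langle>l\<rangle> + \<langle>l\<rangle> (1 + z / l) log (1 + z / l)\<close>.\<close>

lemma absv_xlogx_poly_minus_Q_le:
  assumes "0 \<le> \<rho>" "\<rho> < 1" "absv (A z) \<le> \<rho>" "absv (z / l) \<le> \<rho>"
    and "\<And>k. k \<ge> n \<Longrightarrow> real (k + 2) * \<rho> ^ (k + 2) \<le> B"
  shows "absv (xlogx_poly n (A z) - Q n z) \<le> B"
proof -
  define w where "w = (1 + A z) * log1p (A z)"
  define v where "v = (1 + z / l) * log1p (z / l)"
  have uA: "1 + A z = u * (1 + z / l)"
    using l_nonzero \<omega>_nonzero by (simp add: A_def u_eq field_simps)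
  then have "A z = (u - 1) + z / l + (u - 1) * (z / l)"
    by (simp add: algebra_simps)
  then have "log1p (A z) = log1p (u - 1) + log1p (z / l)"
    using log1p_add[OF absv_u_minus_1, of "z / l"] assms by simp
  then have "w = (1 + A z) * log1p (u - 1) + u * v"
    unfolding w_def v_def using uA by (simp add: algebra_simps)
  also have "(1 + A z) * log1p (u - 1) = log1p (u - 1) / \<omega> * (l + z)"
    by (simp add: A_def)
  finally have "xlogx_poly n (A z) - Q n z = u * (v - xlogx_poly n (z / l)) - (w - xlogx_poly n (A z))"
    by (simp add: Q_def algebra_simps)
  also have "absv \<dots> \<le> B"
  proof (rule absv_diff_le)
    show "absv (u * (v - xlogx_poly n (z / l))) \<le> B"
      unfolding v_def absv_mult[of u] absv_u mult_1 using assms(4,2,5) by (rule absv_xlogx_minus_poly_le)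
    show "absv (w - xlogx_poly n (A z)) \<le> B"
      unfolding w_def using assms(3,2,5) by (rule absv_xlogx_minus_poly_le)
  qed
  finally show ?thesis .
qed

lemma I_Q_tendsto: "(\<lambda>n. I (Q n)) \<longlonglongrightarrow> M 1 + G (- 1)"
proof -
  obtain \<rho> where \<rho>: "0 \<le> \<rho>" "\<rho> < 1" "\<And>z. z \<in> disc_nbhd U r \<Longrightarrow> absv (A z) \<le> \<rho>"
    "\<And>z. z \<in> disc_nbhd U r \<Longrightarrow> absv (z / l) \<le> \<rho>"
    using disc_nbhd_bound by blast
  define b where "b k = real (k + 2) * \<rho> ^ (k + 2)" for k
  have b: "b \<longlonglongrightarrow> 0"
    unfolding b_def using times_power_tendsto_0 \<rho>(1,2) .
  \<comment> \<open>Tail suprema dominate all later terms, as the comparison of the two polynomials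
    requires, and still tend to 0.\<close>
  define B where "B n = (SUP k\<in>{n..}. b k)" for n
  have bdd: "bdd_above (b ` {n..})" for n
    using convergent_imp_bounded[of b 0] b bounded_imp_bdd_above by (meson bdd_above_mono image_mono subset_UNIV)
  have B_le: "b k \<le> B n" if "k \<ge> n" for k n
    unfolding B_def using that by (intro cSUP_upper bdd) auto
  have b_nonneg: "0 \<le> b k" for k
    using \<rho>(1) by (simp add: b_def)
  have B_nonneg: "0 \<le> B n" for n
    using b_nonneg[of n] B_le[of n n] by simp
  have "B \<longlonglongrightarrow> 0"
  proof (rule tendstoI)
    fix e :: real assume "e > 0"
    then have "\<forall>\<^sub>F n in sequentially. b n < e / 2"
      by (intro order_tendstoD(2)[OF b]) simp
    then obtain m where m: "\<And>n. n \<ge> m \<Longrightarrow> b n < e / 2"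
      by (auto simp: eventually_sequentially)
    have "B n \<le> e / 2" if "n \<ge> m" for n
      unfolding B_def using that m by (intro cSUP_least) (auto intro: less_imp_le)
    then show "\<forall>\<^sub>F n in sequentially. dist (B n) 0 < e"
      using B_nonneg \<open>e > 0\<close> by (force simp: eventually_sequentially dist_real_def)
  qed
  moreover have "absv (xlogx_poly n (A z) - Q n z) \<le> B n" if "z \<in> disc_nbhd U r" for n z
    using \<rho> that B_le[unfolded b_def] by (intro absv_xlogx_poly_minus_Q_le) auto
  ultimately have "(\<lambda>n. I (\<lambda>z. xlogx_poly n (A z) - Q n z)) \<longlonglongrightarrow> 0"
    using B_nonneg
    by (intro I_tendsto_0[where B = B] is_poly_analytic_U is_poly_diff is_poly_xlogx_poly is_poly_A is_poly_Q)
  then have "(\<lambda>n. I (\<lambda>z. xlogx_poly n (A z)) - I (Q n)) \<longlonglongrightarrow> 0"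
    by (simp add: I_diff is_poly_analytic_U is_poly_xlogx_poly is_poly_A is_poly_Q)
  from tendsto_diff[OF I_xlogx_poly_tendsto this] show ?thesis
    by simp
qed

definition b1 :: 'a where "b1 = bernoulli_fun \<mu> 1 l"

lemma I_shift: "I (\<lambda>z. l + z) = b1"
  unfolding b1_def bernoulli_fun_def by (simp add: I_poly is_poly_intros)

text \<open>Integrate l + z = \<omega> (1 + A z).\<close>

lemma \<omega>_M: "\<omega> * (M 0 + M 1) = b1"
proof -
  have "(\<lambda>z. l + z) = (\<lambda>z. \<omega> * (A z ^ 0 + A z ^ 1))"
    using \<omega>_nonzero by (simp add: A_def)
  then have "b1 = I (\<lambda>z. \<omega> * (A z ^ 0 + A z ^ 1))"
    using I_shift by simp
  also have "\<dots> = \<omega> * I (\<lambda>z. A z ^ 0 + A z ^ 1)"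
    by (intro I_cmult is_poly_analytic_U is_poly_add is_poly_A_power)
  also have "I (\<lambda>z. A z ^ 0 + A z ^ 1) = M 0 + M 1"
    unfolding M_def by (intro I_add is_poly_analytic_U is_poly_A_power)
  finally show ?thesis ..
qed

lemma I_Q:
  "\<omega> * I (Q n) = b1 * iwasawa_log p l + bernoulli_fun \<mu> 1 0 +
    (\<Sum>k<n. (- 1) ^ (Suc k + 1) / (of_nat (Suc k) * of_nat (Suc k + 1))
       * bernoulli_fun \<mu> (Suc k + 1) 0 * (1 / l ^ Suc k))"
proof -
  have bern: "I (\<lambda>z. z ^ k) = bernoulli_fun \<mu> k 0" for k
    by (simp add: bernoulli_fun_def I_poly is_poly_intros)
  have frac: "(- 1) ^ k * ((z / l) ^ (k + 2) / c) = (- 1) ^ k / (l ^ (k + 2) * c) * z ^ (k + 2)" for k c z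
    unfolding power_divide by (simp add: divide_inverse mult_ac)
  have "I (\<lambda>z. xlogx_poly n (z / l)) =
      I (\<lambda>z. inverse l * z ^ 1 + (\<Sum>k<n. (- 1) ^ k / (l ^ (k + 2) * (of_nat (Suc k) * of_nat (Suc (Suc k)))) * z ^ (k + 2)))"
    by (rule arg_cong[of _ _ I], rule ext)
      (simp only: xlogx_poly_def frac power_one_right, simp add: divide_inverse mult.commute)
  also have "\<dots> = inverse l * I (\<lambda>z. z ^ 1) +
      (\<Sum>k<n. (- 1) ^ k / (l ^ (k + 2) * (of_nat (Suc k) * of_nat (Suc (Suc k)))) * I (\<lambda>z. z ^ (k + 2)))"
    by (subst I_add, (intro is_poly_analytic_U is_poly_intros)+, subst I_cmult,
        (intro is_poly_analytic_U is_poly_intros)+, subst I_sum)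
      (rule finite_lessThan, intro is_poly_intros, rule refl)
  finally have xlogx: "I (\<lambda>z. xlogx_poly n (z / l)) = \<dots>" .
  have "I (Q n) = log1p (u - 1) / \<omega> * b1 + u * I (\<lambda>z. xlogx_poly n (z / l))"
    unfolding Q_def[abs_def]
    by (subst I_add, (intro is_poly_analytic_U is_poly_intros is_poly_xlogx_poly)+,
        (subst I_cmult, intro is_poly_analytic_U is_poly_intros is_poly_xlogx_poly)+, simp only: I_shift)
  moreover have "log1p (u - 1) = iwasawa_log p l"
    using iwasawa_log_eq[OF l_nonzero] by (simp add: u_def)
  ultimately have "\<omega> * I (Q n) = b1 * iwasawa_log p l + l * I (\<lambda>z. xlogx_poly n (z / l))"
    using \<omega>_nonzero by (simp add: u_eq algebra_simps)
  \<comment> \<open>The outer factor l lowers l^(k+2) in the denominator to l^(k+1); Stirling's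
    index is therefore k + 1, whose sign (-1)^(k+2) equals (-1)^k.\<close>
  also have "l * I (\<lambda>z. xlogx_poly n (z / l)) = bernoulli_fun \<mu> 1 0 +
    (\<Sum>k<n. (- 1) ^ (Suc k + 1) / (of_nat (Suc k) * of_nat (Suc k + 1))
       * bernoulli_fun \<mu> (Suc k + 1) 0 * (1 / l ^ Suc k))"
    unfolding xlogx bern distrib_left sum_distrib_left
    using l_nonzero
    by (intro arg_cong2[of _ _ _ _ "(+)"] sum.cong) (simp_all add: field_simps del: of_nat_Suc)
  finally show ?thesis
    by (simp add: add.assoc)
qed

text \<open>The partial sums are \<omega> I(Q n) up to constants, so convergence of Stirling's
  series comes together with its value.\<close>

lemma stirling_sums:
  "(\<lambda>n. (- 1) ^ (Suc n + 1) / (of_nat (Suc n) * of_nat (Suc n + 1))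
       * bernoulli_fun \<mu> (Suc n + 1) 0 * (1 / l ^ Suc n)) sums
    (\<omega> * (M 1 + G (- 1)) - b1 * iwasawa_log p l - bernoulli_fun \<mu> 1 0)"
proof -
  have "(\<lambda>n. \<omega> * I (Q n) - b1 * iwasawa_log p l - bernoulli_fun \<mu> 1 0) \<longlonglongrightarrow>
      \<omega> * (M 1 + G (- 1)) - b1 * iwasawa_log p l - bernoulli_fun \<mu> 1 0"
    by (intro tendsto_diff tendsto_mult tendsto_const I_Q_tendsto)
  then show ?thesis
    unfolding sums_def I_Q by (simp add: algebra_simps)
qed

text \<open>The derivative is G(-1) - M 0; adding and subtracting M 1 splits off \<omega> (M 0 + M
  1), which is the last term of the formula.\<close>

lemma log_gamma_eq: "log_gamma p pw \<sigma> \<mu> l = \<omega> * (M 1 + G (- 1)) - b1"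
  unfolding log_gamma_def padic_deriv_eqI[OF padic_zeta_derivative] \<omega>_M[symmetric] \<omega>_def
  by (simp add: algebra_simps)

end

theorem theorem4p4:
  fixes p :: nat
    and pw :: "rat \<Rightarrow> 'a::ultrametric_field"
    and \<sigma> :: "'a set"
    and \<mu> :: "('a \<Rightarrow> 'a) \<Rightarrow> 'a"
    and l :: 'a
  assumes "padic_complex_numbers p TYPE('a)"
    and "odd p"
    and "fractional_powers p pw"
    and "compact \<sigma>"
    and "generalized_distribution \<sigma> \<mu>"
    and "\<forall>x \<in> dist_support \<sigma> \<mu>. absv x < absv l"
  shows "(\<exists>D. has_padic_derivative (\<lambda>s. padic_zeta p pw \<sigma> \<mu> s l) D 0) \<and>
    summable (\<lambda>n. (- 1) ^ (Suc n + 1) / (of_nat (Suc n) * of_nat (Suc n + 1))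
                    * bernoulli_fun \<mu> (Suc n + 1) 0 * (1 / l ^ Suc n)) \<and>
    log_gamma p pw \<sigma> \<mu> l =
      bernoulli_fun \<mu> 1 0
      + (\<Sum>n. (- 1) ^ (Suc n + 1) / (of_nat (Suc n) * of_nat (Suc n + 1))
                * bernoulli_fun \<mu> (Suc n + 1) 0 * (1 / l ^ Suc n))
      + bernoulli_fun \<mu> 1 l * iwasawa_log p l
      - bernoulli_fun \<mu> 1 l"
proof -
  interpret padic_complex_field p "TYPE('a)" pw
    using assms(1,3) by unfold_locales
      (auto simp: padic_complex_numbers_def fractional_powers_def)
  interpret distribution \<sigma> \<mu>
    using assms(4,5) by unfold_locales
  show ?thesis
  proof (cases "l = 0")
    \<comment> \<open>For \<lambda> = 0 the support is empty, so all integrals, the zeta function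
      and both sides of the formula are 0.\<close>
    case True
    with assms(6) have supp: "dist_support \<sigma> \<mu> = {}"
      using absv_nonneg by (metis absv_0 all_not_in_conv not_le)
    have "bernoulli_fun \<mu> m k = 0" for m k
      unfolding bernoulli_fun_def
      by (intro \<mu>_empty_support supp is_poly_locally_analytic is_poly_intros)
    moreover have "has_padic_derivative (\<lambda>s. padic_zeta p pw \<sigma> \<mu> s l) 0 0"
      by (simp add: has_padic_derivative_def padic_zeta_def dist_integral_empty_support[OF supp])
    ultimately show ?thesis
      using padic_deriv_eqI by (auto simp: log_gamma_def)
  next
    case False
    then interpret log_gamma_setting p "TYPE('a)" pw \<sigma> \<mu> l
      using assms(6) by unfold_locales auto
    show ?thesis
      using padic_zeta_derivative sums_summable[OF stirling_sums] sums_unique[OF stirling_sums, symmetric]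
      unfolding log_gamma_eq b1_def by auto
  qed
qed

end
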